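(* For every integer $k \geq 1$, every strongly $k$-connected tournament $T$ with $n$ vertices has a strongly $k$-connected spanning subgraph $D$ with at most $kn + 750 k^2 \log_2 (k+1)$ arcs.
   Context: A tournament is an orientation of a complete simple graph (no loops, no multiple arcs). A digraph $D$ is strongly connected if for any two vertices $u,v$ there is a directed path from $u$ to $v$. A digraph $D$ is strongly $k$-connected if $|V(D)| \geq k+1$ and for every set $S \subseteq V(D)$ with $|S| \leq k-1$, the digraph $D - S$ (obtained by deleting the vertices of $S$) is strongly connected. A spanning subgraph of $T$ is a subgraph with vertex set $V(T)$ and arc set a subset of the arcs of $T$. *)

theory Defs
  imports Complex_Main
begin

text \<open>A digraph is given by a vertex set V and an arc set A, a set of ordered pairs.\<close>

definition is_digraph :: "'a set \<Rightarrow> ('a \<times> 'a) set \<Rightarrow> bool" where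
  "is_digraph V A \<longleftrightarrow> A \<subseteq> V \<times> V \<and> (\<forall>v. (v, v) \<notin> A)"

text \<open>A tournament: orientation of the complete simple graph on finite V.\<close>
definition tournament :: "'a set \<Rightarrow> ('a \<times> 'a) set \<Rightarrow> bool" where
  "tournament V A \<longleftrightarrow> finite V \<and> is_digraph V A \<and>
     (\<forall>u\<in>V. \<forall>v\<in>V. u \<noteq> v \<longrightarrow> ((u, v) \<in> A \<longleftrightarrow> (v, u) \<notin> A))"

text \<open>Strong connectivity: directed path (inside V, using arcs of A) between any two vertices.\<close>
definition strongly_connected :: "'a set \<Rightarrow> ('a \<times> 'a) set \<Rightarrow> bool" where
  "strongly_connected V A \<longleftrightarrow> (\<forall>u\<in>V. \<forall>v\<in>V. (u, v) \<in> (A \<inter> (V \<times> V))\<^sup>*)"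

text \<open>Deleting a vertex set S.\<close>
definition del_verts_arcs :: "'a set \<Rightarrow> ('a \<times> 'a) set \<Rightarrow> 'a set \<Rightarrow> ('a \<times> 'a) set" where
  "del_verts_arcs V A S = A \<inter> ((V - S) \<times> (V - S))"

definition strongly_k_connected :: "nat \<Rightarrow> 'a set \<Rightarrow> ('a \<times> 'a) set \<Rightarrow> bool" where
  "strongly_k_connected k V A \<longleftrightarrow> card V \<ge> k + 1 \<and>
     (\<forall>S. S \<subseteq> V \<and> card S \<le> k - 1 \<longrightarrow> strongly_connected (V - S) (del_verts_arcs V A S))"

end

theory Submission
  imports Defs
begin

text \<open>
  Put aside the set \<open>A\<close> of the \<open>12 k\<close> vertices of smallest out-degree and the set \<open>B\<close> of the
  \<open>12 k\<close> vertices of smallest in-degree. Let \<open>X \<subseteq> A\<close> consist of the \<open>k\<close> vertices of smallest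
  out-degree inside \<open>A\<close>, and define \<open>Y \<subseteq> B\<close> dually. A vertex with \<open>4 k\<close> out-neighbours in \<open>A\<close>
  reaches all of \<open>X\<close> by paths of length at most three, whichever \<open>k - 1\<close> vertices are deleted.
  Menger's theorem gives \<open>k\<close> disjoint paths from \<open>X\<close> to \<open>Y\<close>; they are taken of minimal total
  length. The other vertices are ordered so that each of them has many out-neighbours after it
  and many in-neighbours before it (a median order). A degree-constrained subgraph then provides
  forward arcs with in- and out-degree \<open>k\<close> off the paths and \<open>k - 1\<close> on the paths, up to \<open>O(k)\<close>
  exceptional vertices; together with the arcs of the paths this costs \<open>k n + O(k\<^sup>2)\<close> arcs.

  After the deletion of a set \<open>Z\<close> of \<open>k - 1\<close> vertices one climbs along forward arcs to an
  exceptional vertex, and from there to \<open>X\<close>. The only way to get stuck is at a vertex of a path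
  whose \<open>k - 1\<close> forward out-neighbours are exactly \<open>Z\<close>; since a path of minimal length has no
  shortcuts, \<open>Z\<close> then misses the rest of that path, which can be followed to \<open>Y\<close>. In this case
  \<open>Z\<close> also misses \<open>A\<close> and \<open>B\<close>, so \<open>k\<close> internally disjoint short paths from \<open>B\<close> to \<open>A\<close> lead
  back to \<open>X\<close>.
\<close>

section \<open>Tournaments\<close>

text \<open>The term \<open>k n\<close> allows \<open>k\<close> arcs per vertex. On the linkage one
  of them is spent on the path, so \<open>k - 1\<close> remain for forward arcs, and
  \<open>Z\<close> may destroy all of these: this is the obstacle. Moreover the same arcs must
  supply out-degrees and in-degrees, since separate choices would cost \<open>2 k n\<close>; hence
  the degree-constrained subgraph, itself obtained from Menger's theorem. The climb to
  \<open>X\<close> and the dual climb to \<open>Y\<close> share the forward arcs. Here \<alpha>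
  measures progress towards \<open>A\<close>, and \<beta> progress towards \<open>B\<close> in the
  reversed tournament. Forward arcs stay within one of the nine classes of pairs (\<alpha>,
  \<beta>), so neither value drops; only exceptional vertices need arcs that raise a class. The
  linkage leads from \<open>X\<close> to \<open>Y\<close> only. If both climbs get stuck, a way from
  \<open>Y\<close> back to \<open>X\<close> is missing, which is why \<open>B\<close> and
  \<open>A\<close> are joined by extra paths. No logarithm arises: the bound proved is
  \<open>k n + 750 k^2\<close>. The constant comes from tournaments with at most \<open>39 k\<close>
  vertices, which keep all their arcs; the construction itself costs at most
  \<open>k n + 591 k^2\<close>.\<close>

lemma tournament_finite: "tournament V T \<Longrightarrow> finite V"
  by (simp add: tournament_def)

lemma tournament_subset: "tournament V T \<Longrightarrow> T \<subseteq> V \<times> V"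
  by (simp add: tournament_def is_digraph_def)

lemma tournament_irrefl: "tournament V T \<Longrightarrow> (v, v) \<notin> T"
  by (simp add: tournament_def is_digraph_def)

lemma tournament_total:
  assumes T: "tournament V T" and "u \<in> V" "v \<in> V" "u \<noteq> v" "(u, v) \<notin> T" shows "(v, u) \<in> T"
proof -
  have "\<forall>u\<in>V. \<forall>v\<in>V. u \<noteq> v \<longrightarrow> ((u, v) \<in> T \<longleftrightarrow> (v, u) \<notin> T)"
    using T unfolding tournament_def by (elim conjE)
  then show ?thesis using assms by blast
qed

lemma tournament_antisym:
  assumes T: "tournament V T" and "(u, v) \<in> T" shows "(v, u) \<notin> T"
proof -
  have "u \<in> V" "v \<in> V" "u \<noteq> v"
    using assms(2) tournament_subset[OF T] tournament_irrefl[OF T] by blast+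
  moreover have "\<forall>u\<in>V. \<forall>v\<in>V. u \<noteq> v \<longrightarrow> ((u, v) \<in> T \<longleftrightarrow> (v, u) \<notin> T)"
    using T unfolding tournament_def by (elim conjE)
  ultimately show ?thesis using assms(2) by blast
qed

lemma tournament_finite_arcs: "tournament V T \<Longrightarrow> finite T"
  by (rule finite_subset[OF tournament_subset]) (auto dest: tournament_finite)

lemma tournament_finite_out: "tournament V T \<Longrightarrow> finite (T `` {v})"
  by (rule finite_Image[OF tournament_finite_arcs])

lemma tournamentI:
  assumes "finite V" "T \<subseteq> V \<times> V" "\<And>v. (v, v) \<notin> T" "\<And>u v. (u, v) \<in> T \<Longrightarrow> (v, u) \<notin> T"
    "\<And>u v. u \<in> V \<Longrightarrow> v \<in> V \<Longrightarrow> u \<noteq> v \<Longrightarrow> (u, v) \<in> T \<or> (v, u) \<in> T"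
  shows "tournament V T"
  unfolding tournament_def is_digraph_def
proof (intro conjI ballI impI allI iffI)
  show "(u, v) \<in> T" if "u \<in> V" "v \<in> V" "u \<noteq> v" "(v, u) \<notin> T" for u v using assms(5) that by blast
qed (use assms in simp_all)

lemma tournament_converse: "tournament V T \<Longrightarrow> tournament V (T\<inverse>)"
proof (rule tournamentI)
  assume T: "tournament V T"
  show "finite V" "T\<inverse> \<subseteq> V \<times> V" "(v, v) \<notin> T\<inverse>" for v
    using tournament_finite[OF T] tournament_subset[OF T] tournament_irrefl[OF T] by auto
  show "(v, u) \<notin> T\<inverse>" if "(u, v) \<in> T\<inverse>" for u v using tournament_antisym[OF T] that by blast
  show "(u, v) \<in> T\<inverse> \<or> (v, u) \<in> T\<inverse>" if "u \<in> V" "v \<in> V" "u \<noteq> v" for u v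
    using tournament_total[OF T] that by blast
qed

lemma tournament_restrict:
  assumes T: "tournament V T" and W: "W \<subseteq> V"
  shows "tournament W (T \<inter> W \<times> W)"
proof (rule tournamentI)
  show "finite W" "T \<inter> W \<times> W \<subseteq> W \<times> W" "(v, v) \<notin> T \<inter> W \<times> W" for v
    using tournament_finite[OF T] finite_subset[OF W] tournament_irrefl[OF T] by auto
  show "(v, u) \<notin> T \<inter> W \<times> W" if "(u, v) \<in> T \<inter> W \<times> W" for u v
    using tournament_antisym[OF T] that by blast
  show "(u, v) \<in> T \<inter> W \<times> W \<or> (v, u) \<in> T \<inter> W \<times> W" if "u \<in> W" "v \<in> W" "u \<noteq> v" for u v
    using tournament_total[OF T] that W by blast
qed

section \<open>Counting arcs inside a vertex set\<close>

lemma tournament_inner_sum: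
  assumes T: "tournament V T" and "S \<subseteq> V"
  shows "2 * (\<Sum>v\<in>S. card (T `` {v} \<inter> S)) = card S * (card S - 1)"
proof -
  have "finite S" using assms tournament_finite finite_subset by blast
  then show ?thesis using \<open>S \<subseteq> V\<close>
  proof (induction S)
    case empty then show ?case by simp
  next
    case (insert x S)
    have fin: "finite S" by fact
    have split: "card (T `` {v} \<inter> insert x S) = card (T `` {v} \<inter> S) + (if (v, x) \<in> T then 1 else 0)"
      if "v \<in> S" for v
      using insert.hyps fin by (auto simp: Int_insert_right)
    have x: "T `` {x} \<inter> insert x S = T `` {x} \<inter> S"
      using tournament_irrefl[OF T] by auto
    have "(\<Sum>v\<in>S. if (v, x) \<in> T then 1 else 0) = card {v \<in> S. (v, x) \<in> T}"
      using fin by (simp add: sum.If_cases Int_def)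
    moreover have "{v \<in> S. (v, x) \<in> T} = S - T `` {x}"
      using insert.prems insert.hyps tournament_total[OF T] tournament_antisym[OF T] by blast
    moreover have "card (S - T `` {x}) + card (T `` {x} \<inter> S) = card S"
      using fin by (metis Int_commute add.commute card_Int_Diff)
    ultimately have "(\<Sum>v\<in>insert x S. card (T `` {v} \<inter> insert x S))
        = (\<Sum>v\<in>S. card (T `` {v} \<inter> S)) + card S"
      using insert.hyps by (simp add: split x sum.distrib)
    then have "2 * (\<Sum>v\<in>insert x S. card (T `` {v} \<inter> insert x S))
        = card S * (card S - 1) + 2 * card S" using insert by simp
    then show ?case using insert.hyps by (cases "card S") auto
  qed
qed

lemma card_arcs_Sigma:
  assumes "finite S" "\<And>v. finite (T `` {v})"
  shows "card (T \<inter> S \<times> R) = (\<Sum>v\<in>S. card (T `` {v} \<inter> R))"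
proof -
  have "T \<inter> S \<times> R = Sigma S (\<lambda>v. T `` {v} \<inter> R)" by auto
  then show ?thesis using assms by simp
qed

lemma tournament_inner_card:
  assumes "tournament V T" and "S \<subseteq> V"
  shows "2 * card (T \<inter> S \<times> S) = card S * (card S - 1)"
proof -
  have "finite S" using assms tournament_finite finite_subset by blast
  then have "card (T \<inter> S \<times> S) = (\<Sum>v\<in>S. card (T `` {v} \<inter> S))"
    using tournament_finite_out[OF assms(1)] by (rule card_arcs_Sigma)
  then show ?thesis using tournament_inner_sum[OF assms] by simp
qed

text \<open>The out-degrees inside \<open>S\<close> have mean \<open>(card S - 1) / 2\<close>, and
  some vertex does not exceed the mean.\<close>

lemma tournament_low_vertex:
  assumes T: "tournament V T" and "S \<subseteq> V" "S \<noteq> {}"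
  obtains u where "u \<in> S" "2 * card (T `` {u} \<inter> S) + 1 \<le> card S"
proof -
  have fin: "finite S" using assms tournament_finite finite_subset by blast
  have "\<exists>u\<in>S. 2 * card (T `` {u} \<inter> S) + 1 \<le> card S"
  proof (rule ccontr)
    assume "\<not> ?thesis"
    then have "card S \<le> 2 * card (T `` {u} \<inter> S)" if "u \<in> S" for u using that by force
    then have "(\<Sum>u\<in>S. card S) \<le> (\<Sum>u\<in>S. 2 * card (T `` {u} \<inter> S))" by (intro sum_mono) auto
    then have "card S * card S \<le> card S * (card S - 1)"
      using tournament_inner_sum[OF assms(1,2)] by (simp add: sum_distrib_left)
    moreover have "card S > 0" using fin assms by auto
    ultimately show False by auto
  qed
  then show ?thesis using that by blast
qed

text \<open>The low vertices induce a tournament \<open>L\<close> of their own, whose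
  \<open>card L * (card L - 1) / 2\<close> arcs number at most \<open>g * card L\<close>.\<close>

lemma tournament_few_low:
  assumes T: "tournament V T" and "S \<subseteq> V"
  shows "card {v \<in> S. card (T `` {v} \<inter> S) \<le> g} \<le> 2 * g + 1"
proof -
  define L where "L = {v \<in> S. card (T `` {v} \<inter> S) \<le> g}"
  have fin: "finite S" using assms tournament_finite finite_subset by blast
  have "card (T `` {v} \<inter> L) \<le> g" if "v \<in> L" for v
  proof -
    have "card (T `` {v} \<inter> L) \<le> card (T `` {v} \<inter> S)"
      by (rule card_mono) (auto simp: L_def fin)
    then show ?thesis using that by (simp add: L_def)
  qed
  then have "2 * (\<Sum>v\<in>L. card (T `` {v} \<inter> L)) \<le> 2 * (\<Sum>v\<in>L. g)"
    by (intro mult_left_mono sum_mono) auto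
  moreover have "L \<subseteq> V" using assms L_def by auto
  ultimately have "card L * (card L - 1) \<le> card L * (2 * g)"
    using tournament_inner_sum[OF T, of L] by (simp add: mult.commute mult.left_commute)
  then have "card L = 0 \<or> card L - 1 \<le> 2 * g" by (metis mult_le_cancel1 gr0I)
  then show ?thesis unfolding L_def by linarith
qed

lemma tournament_degree_sum:
  assumes T: "tournament V T" and "v \<in> V" "S \<subseteq> V" "v \<notin> S"
  shows "card (T `` {v} \<inter> S) + card (T\<inverse> `` {v} \<inter> S) = card S"
proof -
  have fin: "finite S" using assms tournament_finite finite_subset by blast
  have "T\<inverse> `` {v} \<inter> S = S - T `` {v}"
    using assms tournament_total[OF T] tournament_antisym[OF T] by blast
  then show ?thesis using fin card_Int_Diff[of S "T `` {v}"] by (simp add: Int_commute)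
qed

section \<open>Sets of vertices of smallest degree\<close>

lemma exists_lowest_subset:
  fixes f :: "'a \<Rightarrow> nat"
  assumes "finite V" "m \<le> card V"
  shows "\<exists>A\<subseteq>V. card A = m \<and> (\<forall>a\<in>A. \<forall>v\<in>V - A. f a \<le> f v)"
  using assms(2)
proof (induction m)
  case 0 then show ?case by (intro exI[of _ "{}"]) auto
next
  case (Suc m)
  then obtain A where A: "A \<subseteq> V" "card A = m" "\<forall>a\<in>A. \<forall>v\<in>V - A. f a \<le> f v" by auto
  have "V - A \<noteq> {}" using A Suc.prems by auto
  then obtain w where w: "w \<in> V - A" "\<forall>v\<in>V - A. f w \<le> f v"
    using assms(1) arg_min_if_finite[of "V - A" f] by (metis finite_Diff leI)
  have "finite A" using A assms finite_subset by blast
  then show ?case using A w by (intro exI[of _ "insert w A"]) auto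
qed

text \<open>If no path of length at most three survived, the out-neighbours of \<open>v\<close> in \<open>A\<close> and theirs
  would all lie in the out-neighbourhood of \<open>x\<close>, which is too small to hold them.\<close>

lemma dominated_reach:
  assumes T: "tournament V T" and A: "A \<subseteq> V" and X: "X \<subseteq> A"
    and low: "\<forall>x\<in>X. \<forall>u\<in>A - X. card (T `` {x} \<inter> A) \<le> card (T `` {u} \<inter> A)"
    and x: "x \<in> X - Z" and v: "v \<in> V - Z"
    and G: "G \<subseteq> A" "3 * card (Z \<inter> A) + card X + 1 \<le> card G" "\<And>g. g \<in> G \<Longrightarrow> (v, g) \<in> D"
    and D: "T \<inter> A \<times> A \<subseteq> D"
  shows "(v, x) \<in> (D \<inter> (V - Z) \<times> (V - Z))\<^sup>*"
proof (rule ccontr)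
  let ?R = "D \<inter> (V - Z) \<times> (V - Z)"
  assume no: "(v, x) \<notin> ?R\<^sup>*"
  have finA: "finite A" using A T tournament_finite finite_subset by blast
  have xA: "x \<in> A" using x X by auto
  \<comment> \<open>Besides \<open>Z\<close>, also \<open>X\<close> is discarded, because
    \<open>low\<close> compares \<open>x\<close> only with vertices of \<open>A - X\<close>.\<close>
  define Q where "Q = G - Z - X"
  define N where "N = T `` {x} \<inter> A"
  have QA: "Q \<subseteq> A" using G Q_def by auto
  have finQ: "finite Q" "finite N" using QA finA finite_subset N_def by auto
  have step1: "(v, u) \<in> ?R" if "u \<in> Q" for u
    using that G v A unfolding Q_def by auto
  have "card G \<le> card (Q \<union> (Z \<inter> A) \<union> X)"
    using G finA X finQ finite_subset[OF X finA] by (intro card_mono) (auto simp: Q_def)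
  also have "\<dots> \<le> card Q + card (Z \<inter> A) + card X"
    by (meson card_Un_le add_le_mono le_refl order_trans)
  finally have cQ: "2 * card (Z \<inter> A) + 1 \<le> card Q" using G by linarith
  have Qx: "(u, x) \<notin> T" if "u \<in> Q" for u
  proof
    assume "(u, x) \<in> T"
    then have "(u, x) \<in> ?R" using D that QA xA x A unfolding Q_def by auto
    then show False using step1[OF that] no by (meson rtrancl.rtrancl_into_rtrancl r_into_rtrancl)
  qed
  have QN: "Q \<subseteq> N"
    using Qx QA xA A x X tournament_total[OF T] unfolding N_def Q_def by blast
  \<comment> \<open>A vertex \<open>u\<close> of \<open>Q\<close> with few out-neighbours in
    \<open>Q\<close> gives the contradiction: its out-neighbours in \<open>A\<close> lie in
    \<open>Z\<close>, in \<open>Q\<close> or in \<open>N - Q\<close>, so there are at most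
    \<open>card (Z \<inter> A) + (card Q - 1) / 2 + card N - card Q\<close> of them. This is less
    than \<open>card N\<close>, although \<open>low\<close> demands at least
    \<open>card N\<close>.\<close>
  have "Q \<noteq> {}" using cQ by auto
  then obtain u where u: "u \<in> Q" "2 * card (T `` {u} \<inter> Q) + 1 \<le> card Q"
    using tournament_low_vertex[OF T, of Q] QA A by blast
  have "w \<in> N" if w: "w \<in> T `` {u} \<inter> A" "w \<notin> Z" for w
  proof (rule ccontr)
    assume "w \<notin> N"
    then have "(x, w) \<notin> T" using w N_def by auto
    moreover have "w \<noteq> x" using Qx u w by auto
    ultimately have "(w, x) \<in> T" using tournament_total[OF T, of x w] w xA A by auto
    then have "(u, w) \<in> ?R" "(w, x) \<in> ?R" using D w QA u A xA x unfolding Q_def by auto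
    then show False using step1[OF u(1)] no by (meson rtrancl.rtrancl_into_rtrancl r_into_rtrancl)
  qed
  then have "T `` {u} \<inter> A \<subseteq> (Z \<inter> A) \<union> (T `` {u} \<inter> Q) \<union> (N - Q)" by auto
  then have "card (T `` {u} \<inter> A) \<le> card ((Z \<inter> A) \<union> (T `` {u} \<inter> Q) \<union> (N - Q))"
    using finA finQ by (intro card_mono) auto
  also have "\<dots> \<le> card (Z \<inter> A) + card (T `` {u} \<inter> Q) + card (N - Q)"
    by (meson card_Un_le add_le_mono le_refl order_trans)
  also have "card (N - Q) = card N - card Q" using QN finQ card_Diff_subset by blast
  finally have "card (T `` {u} \<inter> A) \<le> card (Z \<inter> A) + card (T `` {u} \<inter> Q) + (card N - card Q)" .
  moreover have "card N \<le> card (T `` {u} \<inter> A)"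
    using low x u QA unfolding N_def Q_def by blast
  moreover have "card Q \<le> card N" using QN finQ card_mono by blast
  ultimately show False using u cQ by linarith
qed

text \<open>Let \<open>U\<close> be the set of vertices with fewer than \<open>4 k\<close> out-neighbours in \<open>A\<close>. Counting the arcs
  from \<open>A\<close> to \<open>U\<close> shows that every vertex of \<open>U\<close> has out-degree more than \<open>2 / 3\<close> of the size of
  \<open>U\<close>. Those with fewer than \<open>k\<close> out-neighbours outside \<open>A \<union> U\<close> (class \<open>0\<close>) thus have most of \<open>U\<close>
  as out-neighbours; so they are few, and each has many out-neighbours in the rest of \<open>U\<close>
  (class \<open>1\<close>).\<close>

lemma exists_dominated_classes:
  assumes T: "tournament V T" and A: "A \<subseteq> V" and cA: "card A = 12 * k" and k: "k \<ge> 1"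
    and low: "\<forall>a\<in>A. \<forall>v\<in>V - A. card (T `` {a}) \<le> card (T `` {v})"
  obtains \<alpha> :: "'a \<Rightarrow> nat" where "\<And>v. \<alpha> v < 3"
    and "\<And>v. v \<in> V - A \<Longrightarrow> \<alpha> v = 2 \<Longrightarrow> 4 * k \<le> card (T `` {v} \<inter> A)"
    and "\<And>v. v \<in> V - A \<Longrightarrow> \<alpha> v < 2 \<Longrightarrow> k \<le> card (T `` {v} \<inter> {w \<in> V - A. \<alpha> w = Suc (\<alpha> v)})"
proof -
  have finV: "finite V" using T tournament_finite by blast
  have finA: "finite A" using A finV finite_subset by blast
  define R where "R = {v \<in> V - A. 4 * k \<le> card (T `` {v} \<inter> A)}"
  define U where "U = V - A - R"
  define L where "L = {u \<in> U. card (T `` {u} \<inter> R) < k}"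
  have fin: "finite R" "finite U" "finite L" using finV by (auto simp: R_def U_def L_def)
  have UV: "U \<subseteq> V" "L \<subseteq> U" by (auto simp: U_def L_def)
  have mid: "k \<le> card (T `` {u} \<inter> (U - L))" if uL: "u \<in> L" for u
  proof -
    \<comment> \<open>The mean out-degree over \<open>A\<close> is at most that of \<open>u\<close>.
      Arcs inside \<open>A\<close> contribute \<open>(12 k - 1) / 2\<close> to the mean, and arcs to
      \<open>U\<close> contribute two thirds of \<open>card U\<close>, since each vertex of
      \<open>U\<close> receives at least \<open>8 k\<close> arcs from the \<open>12 k\<close>
      vertices of \<open>A\<close>. The inequality is this estimate times 6.\<close>
    have deg: "36 * k + 4 * card U \<le> 6 * card (T `` {u}) + 3" if "u \<in> U" for u
    proof -
      have "(\<Sum>a\<in>A. card (T `` {a})) \<le> (\<Sum>a\<in>A. card (T `` {u}))"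
        using low that by (intro sum_mono) (auto simp: U_def)
      then have 1: "(\<Sum>a\<in>A. card (T `` {a})) \<le> 12 * k * card (T `` {u})" using cA by simp
      have "card (T `` {a} \<inter> A) + card (T `` {a} \<inter> U) \<le> card (T `` {a})" for a
      proof -
        have "card (T `` {a} \<inter> A) + card (T `` {a} \<inter> U) = card (T `` {a} \<inter> A \<union> T `` {a} \<inter> U)"
          using finA fin by (subst card_Un_disjoint) (auto simp: U_def)
        also have "\<dots> \<le> card (T `` {a})"
          using tournament_finite_out[OF T] by (intro card_mono) auto
        finally show ?thesis .
      qed
      then have "(\<Sum>a\<in>A. card (T `` {a} \<inter> A) + card (T `` {a} \<inter> U)) \<le> (\<Sum>a\<in>A. card (T `` {a}))"
        by (intro sum_mono)
      then have 2: "(\<Sum>a\<in>A. card (T `` {a} \<inter> A)) + (\<Sum>a\<in>A. card (T `` {a} \<inter> U))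
          \<le> (\<Sum>a\<in>A. card (T `` {a}))" by (simp add: sum.distrib)
      have fo: "finite (T `` {v})" "finite (T\<inverse> `` {v})" for v
        using tournament_finite_out[OF T] tournament_finite_out[OF tournament_converse[OF T]] by auto
      have "(\<Sum>a\<in>A. card (T `` {a} \<inter> U)) = card (T \<inter> A \<times> U)"
        using card_arcs_Sigma[OF finA fo(1), of U] by simp
      also have "\<dots> = card ((T \<inter> A \<times> U)\<inverse>)" by (simp add: card_inverse)
      also have "(T \<inter> A \<times> U)\<inverse> = T\<inverse> \<inter> U \<times> A" by auto
      also have "card \<dots> = (\<Sum>w\<in>U. card (T\<inverse> `` {w} \<inter> A))"
        using card_arcs_Sigma[OF fin(2) fo(2), of A] by simp
      also have "\<dots> \<ge> (\<Sum>w\<in>U. 8 * k)"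
      proof (intro sum_mono)
        fix w assume w: "w \<in> U"
        then have "card (T `` {w} \<inter> A) + card (T\<inverse> `` {w} \<inter> A) = 12 * k"
          using tournament_degree_sum[OF T, of w A] A cA by (auto simp: U_def)
        moreover have "card (T `` {w} \<inter> A) < 4 * k" using w by (auto simp: U_def R_def)
        ultimately show "8 * k \<le> card (T\<inverse> `` {w} \<inter> A)" by linarith
      qed
      finally have 3: "8 * k * card U \<le> (\<Sum>a\<in>A. card (T `` {a} \<inter> U))" by (simp add: mult.commute)
      have 4: "2 * (\<Sum>a\<in>A. card (T `` {a} \<inter> A)) = 12 * k * (12 * k - 1)"
        using tournament_inner_sum[OF T A] cA by simp
      have "12 * k * (12 * k - 1) + 16 * k * card U \<le> 24 * k * card (T `` {u})"
        using 1 2 3 4 by linarith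
      then have "k * (12 * (12 * k - 1) + 16 * card U) \<le> k * (24 * card (T `` {u}))"
        by (simp add: algebra_simps)
      then have "12 * (12 * k - 1) + 16 * card U \<le> 24 * card (T `` {u})" using k by simp
      then show ?thesis by linarith
    qed
    \<comment> \<open>At most \<open>4 k - 1\<close> out-neighbours of \<open>u\<close> lie in
      \<open>A\<close> and at most \<open>k - 1\<close> in \<open>R\<close>; all others are in
      \<open>U\<close>.\<close>
    have inU: "6 * k + 9 + 4 * card U \<le> 6 * card (T `` {u} \<inter> U)" if u: "u \<in> L" for u
    proof -
      have "T `` {u} \<subseteq> T `` {u} \<inter> A \<union> T `` {u} \<inter> R \<union> T `` {u} \<inter> U"
        using tournament_subset[OF T] by (auto simp: U_def)
      then have "card (T `` {u}) \<le> card (T `` {u} \<inter> A \<union> T `` {u} \<inter> R \<union> T `` {u} \<inter> U)"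
        using finA fin by (intro card_mono) auto
      also have "\<dots> \<le> card (T `` {u} \<inter> A) + card (T `` {u} \<inter> R) + card (T `` {u} \<inter> U)"
        by (meson card_Un_le add_le_mono le_refl order_trans)
      finally have "card (T `` {u}) \<le> card (T `` {u} \<inter> A) + card (T `` {u} \<inter> R) + card (T `` {u} \<inter> U)" .
      moreover have "card (T `` {u} \<inter> A) < 4 * k" "card (T `` {u} \<inter> R) < k" "u \<in> U"
        using u by (auto simp: L_def U_def R_def)
      ultimately show ?thesis using deg[of u] by linarith
    qed
    have split: "card (T `` {u} \<inter> U) = card (T `` {u} \<inter> L) + card (T `` {u} \<inter> (U - L))" for u
    proof -
      have "T `` {u} \<inter> U = (T `` {u} \<inter> L) \<union> (T `` {u} \<inter> (U - L))" using UV by auto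
      moreover have "card ((T `` {u} \<inter> L) \<union> (T `` {u} \<inter> (U - L)))
          = card (T `` {u} \<inter> L) + card (T `` {u} \<inter> (U - L))"
        using fin by (intro card_Un_disjoint) auto
      ultimately show ?thesis by simp
    qed
    \<comment> \<open>This \<open>w\<close> finds at most half of \<open>L\<close> among its
      out-neighbours, so \<open>inU\<close> leaves \<open>L\<close> only about two thirds of the
      size of \<open>U\<close>. Then even the whole of \<open>L\<close> cannot absorb the
      out-neighbours that \<open>u\<close> has in \<open>U\<close>.\<close>
    obtain w where w: "w \<in> L" "2 * card (T `` {w} \<inter> L) + 1 \<le> card L"
      using tournament_low_vertex[OF T, of L] UV uL by blast
    have "card (T `` {w} \<inter> (U - L)) \<le> card (U - L)" using fin by (intro card_mono) auto
    also have "\<dots> = card U - card L" using UV fin card_Diff_subset by blast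
    finally have "card (T `` {w} \<inter> (U - L)) \<le> card U - card L" .
    moreover have "card L \<le> card U" using UV fin card_mono by blast
    ultimately have "3 * card L + 6 * k \<le> 2 * card U" using w inU[of w] split[of w] by linarith
    moreover have "card (T `` {u} \<inter> L) \<le> card L" using fin by (intro card_mono) auto
    ultimately show ?thesis using inU[OF uL] split[of u] by linarith
  qed
  define \<alpha> :: "'a \<Rightarrow> nat" where "\<alpha> = (\<lambda>v. if v \<in> L then 0 else if v \<in> U then 1 else 2)"
  show ?thesis
  proof (rule that[of \<alpha>])
    show "\<alpha> v < 3" for v by (simp add: \<alpha>_def)
    show "4 * k \<le> card (T `` {v} \<inter> A)" if "v \<in> V - A" "\<alpha> v = 2" for v
      using that by (auto simp: \<alpha>_def U_def R_def split: if_splits)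
    show "k \<le> card (T `` {v} \<inter> {w \<in> V - A. \<alpha> w = Suc (\<alpha> v)})" if v: "v \<in> V - A" "\<alpha> v < 2" for v
    proof (cases "v \<in> L")
      case True
      then have "{w \<in> V - A. \<alpha> w = Suc (\<alpha> v)} = U - L" by (auto simp: \<alpha>_def U_def)
      then show ?thesis using mid[OF True] by simp
    next
      case False
      then have vU: "v \<in> U" using v by (auto simp: \<alpha>_def split: if_splits)
      have "{w \<in> V - A. \<alpha> w = Suc (\<alpha> v)} = R"
        using False vU UV by (auto simp: \<alpha>_def U_def R_def L_def)
      then show ?thesis using False vU by (simp add: L_def)
    qed
  qed
qed

section \<open>Menger's theorem\<close>

definition dipath :: "('a \<times> 'a) set \<Rightarrow> 'a list \<Rightarrow> bool" where
  "dipath G p \<longleftrightarrow> p \<noteq> [] \<and> distinct p \<and> successively (\<lambda>u v. (u, v) \<in> G) p"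

definition linkage :: "('a \<times> 'a) set \<Rightarrow> 'a set \<Rightarrow> 'a set \<Rightarrow> 'a list set \<Rightarrow> bool" where
  "linkage G S T P \<longleftrightarrow> finite P \<and> (\<forall>p\<in>P. dipath G p \<and> hd p \<in> S \<and> last p \<in> T) \<and>
     (\<forall>p\<in>P. \<forall>q\<in>P. p \<noteq> q \<longrightarrow> set p \<inter> set q = {})"

definition separates :: "('a \<times> 'a) set \<Rightarrow> 'a set \<Rightarrow> 'a set \<Rightarrow> 'a set \<Rightarrow> bool" where
  "separates G S T W \<longleftrightarrow> (\<forall>p. dipath G p \<longrightarrow> hd p \<in> S \<longrightarrow> last p \<in> T \<longrightarrow> set p \<inter> W \<noteq> {})"

lemma dipath_mono: "dipath G p \<Longrightarrow> G \<subseteq> H \<Longrightarrow> dipath H p"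
  unfolding dipath_def by (blast intro: successively_mono)

lemma linkage_mono: "linkage G S T P \<Longrightarrow> G \<subseteq> H \<Longrightarrow> linkage H S T P"
  unfolding linkage_def using dipath_mono by blast

lemma dipath_appendD1: "dipath G (p @ q) \<Longrightarrow> p \<noteq> [] \<Longrightarrow> dipath G p"
  by (auto simp: dipath_def successively_append_iff)

lemma dipath_appendD2: "dipath G (p @ q) \<Longrightarrow> q \<noteq> [] \<Longrightarrow> dipath G q"
  by (auto simp: dipath_def successively_append_iff)

lemma successively_insert_arc:
  assumes "successively (\<lambda>u v. (u, v) \<in> insert (x, y) G) p"
    and "\<And>as bs. p \<noteq> as @ x # y # bs"
  shows "successively (\<lambda>u v. (u, v) \<in> G) p"
  using assms
proof (induction p rule: induct_list012)
  case (3 a b p)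
  have "successively (\<lambda>u v. (u, v) \<in> G) (b # p)"
  proof (rule 3(2))
    show "successively (\<lambda>u v. (u, v) \<in> insert (x, y) G) (b # p)" using 3(3) by simp
    show "b # p \<noteq> as @ x # y # bs" for as bs using 3(4)[of "a # as" bs] by auto
  qed
  moreover have "(a, b) \<in> G" using 3(3) 3(4)[of "[]" p] by auto
  ultimately show ?case by simp
qed auto

lemma dipath_rtrancl:
  assumes "successively (\<lambda>u v. (u, v) \<in> G) p" "p \<noteq> []" "set p \<inter> Z = {}" "set p \<subseteq> V"
  shows "(hd p, last p) \<in> (G \<inter> (V - Z) \<times> (V - Z))\<^sup>*"
  using assms
proof (induction p rule: induct_list012)
  case (3 a b p)
  then have "(b, last (b # p)) \<in> (G \<inter> (V - Z) \<times> (V - Z))\<^sup>*" by auto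
  moreover have "(a, b) \<in> G \<inter> (V - Z) \<times> (V - Z)" using 3 by auto
  ultimately have "(a, last (b # p)) \<in> (G \<inter> (V - Z) \<times> (V - Z))\<^sup>*"
    by (rule converse_rtrancl_into_rtrancl[rotated])
  then show ?case by simp
qed auto

lemma rtrancl_dipath:
  assumes "(u, v) \<in> (G \<inter> (V - Z) \<times> (V - Z))\<^sup>*" "u \<in> V - Z"
  shows "\<exists>p. dipath G p \<and> hd p = u \<and> last p = v \<and> set p \<subseteq> V - Z"
  using assms(1)
proof (induction rule: rtrancl_induct)
  case base then show ?case using assms(2) by (intro exI[of _ "[u]"]) (simp add: dipath_def)
next
  case (step v w)
  then obtain p where p: "dipath G p" "hd p = u" "last p = v" "set p \<subseteq> V - Z" by blast
  show ?case
  proof (cases "w \<in> set p")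
    case True
    then obtain as bs where s: "p = as @ w # bs" by (meson split_list)
    then have "dipath G (as @ [w])" "hd (as @ [w]) = u"
      using p dipath_appendD1[of G "as @ [w]" bs] by (auto simp: hd_append)
    moreover have "set (as @ [w]) \<subseteq> V - Z" using p s by auto
    ultimately show ?thesis by (metis last_snoc)
  next
    case False
    then have "dipath G (p @ [w])" using p step by (auto simp: dipath_def successively_append_iff)
    moreover have "hd (p @ [w]) = u" "set (p @ [w]) \<subseteq> V - Z"
      using p step by (auto simp: dipath_def hd_append)
    ultimately show ?thesis by (metis last_snoc)
  qed
qed

text \<open>Disjoint paths have distinct ends, so with as many paths as vertices in \<open>W\<close>
  the map \<open>last\<close> is a bijection onto \<open>W\<close>. Each vertex of \<open>W\<close>
  is then used up as an end, and no other path can pass through it.\<close>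

lemma linkage_end_indexed:
  assumes P: "linkage G S W P" and c: "card P = card W" and "finite W"
  obtains p where "\<And>w. w \<in> W \<Longrightarrow> dipath G (p w) \<and> hd (p w) \<in> S \<and> last (p w) = w"
    and "\<And>w. w \<in> W \<Longrightarrow> set (p w) \<inter> W = {w}"
    and "\<And>v w. v \<in> W \<Longrightarrow> w \<in> W \<Longrightarrow> v \<noteq> w \<Longrightarrow> set (p v) \<inter> set (p w) = {}"
proof -
  have ne: "p \<noteq> []" if "p \<in> P" for p using P that by (auto simp: linkage_def dipath_def)
  have inj: "inj_on last P"
    using P ne unfolding linkage_def inj_on_def by (metis disjoint_iff last_in_set)
  have "last ` P = W"
    using P c \<open>finite W\<close> inj by (intro card_subset_eq) (auto simp: linkage_def card_image)
  then have ex: "\<forall>w\<in>W. \<exists>p. p \<in> P \<and> last p = w" by blast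
  then obtain p where p: "\<And>w. w \<in> W \<Longrightarrow> p w \<in> P \<and> last (p w) = w" by metis
  have disj: "set (p v) \<inter> set (p w) = {}" if "v \<in> W" "w \<in> W" "v \<noteq> w" for v w
    using P p that unfolding linkage_def by metis
  show ?thesis
  proof (rule that[of p])
    show "dipath G (p w) \<and> hd (p w) \<in> S \<and> last (p w) = w" if "w \<in> W" for w
      using p[OF that] P by (auto simp: linkage_def)
    show "set (p w) \<inter> W = {w}" if "w \<in> W" for w
    proof -
      have "w \<in> set (p w)" using p[OF that] ne by (metis last_in_set)
      moreover have "v \<notin> set (p w)" if v: "v \<in> W" "v \<noteq> w" for v
        using disj[of v w] v \<open>w \<in> W\<close> p[of v] ne[of "p v"] last_in_set[of "p v"] by auto
      ultimately show ?thesis using that by auto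
    qed
  qed (use disj in auto)
qed

lemma dipath_rev: "dipath (G\<inverse>) (rev p) \<longleftrightarrow> dipath G p"
  by (auto simp: dipath_def)

lemma linkage_rev: "linkage (G\<inverse>) T S (rev ` P) \<longleftrightarrow> linkage G S T P"
proof -
  have *: "hd (rev p) = last p" "last (rev p) = hd p" if "dipath G p" for p
    using that by (auto simp: dipath_def hd_rev last_rev)
  show ?thesis unfolding linkage_def
    using * by (auto simp: dipath_rev finite_image_iff)
qed

lemma linkage_start_indexed:
  assumes P: "linkage G W T P" and c: "card P = card W" and "finite W"
  obtains p where "\<And>w. w \<in> W \<Longrightarrow> dipath G (p w) \<and> last (p w) \<in> T \<and> hd (p w) = w"
    and "\<And>w. w \<in> W \<Longrightarrow> set (p w) \<inter> W = {w}"
    and "\<And>v w. v \<in> W \<Longrightarrow> w \<in> W \<Longrightarrow> v \<noteq> w \<Longrightarrow> set (p v) \<inter> set (p w) = {}"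
proof -
  have "linkage (G\<inverse>) T W (rev ` P)" using P by (simp add: linkage_rev)
  moreover have "card (rev ` P) = card W" using c by (simp add: card_image)
  ultimately obtain p where p: "\<And>w. w \<in> W \<Longrightarrow> dipath (G\<inverse>) (p w) \<and> hd (p w) \<in> T \<and> last (p w) = w"
    "\<And>w. w \<in> W \<Longrightarrow> set (p w) \<inter> W = {w}"
    "\<And>v w. v \<in> W \<Longrightarrow> w \<in> W \<Longrightarrow> v \<noteq> w \<Longrightarrow> set (p v) \<inter> set (p w) = {}"
    using linkage_end_indexed \<open>finite W\<close> by metis
  show ?thesis
  proof (rule that[of "\<lambda>w. rev (p w)"])
    show "dipath G (rev (p w)) \<and> last (rev (p w)) \<in> T \<and> hd (rev (p w)) = w" if "w \<in> W" for w
      using p(1)[OF that] dipath_rev[of G "rev (p w)"] by (auto simp: dipath_def hd_rev last_rev)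
  qed (use p in auto)
qed

text \<open>Cut a path at its first vertex in \<open>insert x W\<close>. The part before it does not
  contain \<open>x\<close>, hence does not use the arc \<open>(x, y)\<close>; it is a path of
  \<open>G\<close>, and \<open>W'\<close> meets it.\<close>

lemma separates_prefix:
  assumes W: "separates (insert (x, y) G) S T (insert x W)" and W': "separates G S (insert x W) W'"
  shows "separates (insert (x, y) G) S T W'"
  unfolding separates_def
proof (intro allI impI)
  fix p assume p: "dipath (insert (x, y) G) p" "hd p \<in> S" "last p \<in> T"
  then have "\<exists>v\<in>set p. v \<in> insert x W" using W by (auto simp: separates_def)
  then obtain as v bs where s: "p = as @ v # bs" "v \<in> insert x W" "\<forall>u\<in>set as. u \<notin> insert x W"
    by (auto dest!: split_list_first_prop)
  have "dipath (insert (x, y) G) (as @ [v])" using p s dipath_appendD1[of _ "as @ [v]" bs] by simp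
  moreover have "as @ [v] \<noteq> cs @ x # y # ds" for cs ds
  proof
    assume a: "as @ [v] = cs @ x # y # ds"
    then have "as = cs @ x # butlast (y # ds)" by (metis butlast.simps(2) butlast_append butlast_snoc list.distinct(1))
    then show False using s by auto
  qed
  ultimately have "dipath G (as @ [v])"
    using successively_insert_arc by (fastforce simp: dipath_def)
  moreover have "hd (as @ [v]) \<in> S" using p s by (cases as) auto
  ultimately have "set (as @ [v]) \<inter> W' \<noteq> {}" using W' s by (fastforce simp: separates_def)
  then show "set p \<inter> W' \<noteq> {}" using s by auto
qed

lemma separates_rev: "separates (G\<inverse>) T S W \<longleftrightarrow> separates G S T W"
proof -
  have "separates (G\<inverse>) T S W" if "separates G S T W" for G :: "('a \<times> 'a) set" and S T W
    unfolding separates_def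
  proof (intro allI impI)
    fix p assume "dipath (G\<inverse>) p" "hd p \<in> T" "last p \<in> S"
    then have "dipath G (rev p)" "hd (rev p) \<in> S" "last (rev p) \<in> T"
      using dipath_rev[of G "rev p"] by (auto simp: dipath_def hd_rev last_rev)
    then show "set p \<inter> W \<noteq> {}" using that by (fastforce simp: separates_def)
  qed
  then show ?thesis by (metis converse_converse)
qed

lemma separates_suffix:
  assumes "separates (insert (x, y) G) S T (insert y W)" and "separates G (insert y W) T W'"
  shows "separates (insert (x, y) G) S T W'"
proof -
  have i: "(insert (x, y) G)\<inverse> = insert (y, x) (G\<inverse>)" by auto
  have "separates (insert (y, x) (G\<inverse>)) T S (insert y W)" "separates (G\<inverse>) T (insert y W) W'"
    using assms i separates_rev by metis+
  then have "separates (insert (y, x) (G\<inverse>)) T S W'" by (rule separates_prefix)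
  then show ?thesis using i separates_rev by metis
qed

text \<open>A path of \<open>P\<close> and a path of \<open>Q\<close> can meet only in
  \<open>W\<close>, for otherwise they could be spliced into a path of \<open>G\<close> avoiding the
  separator \<open>W\<close>. Hence they can be joined at their common vertices in \<open>W\<close>,
  and the last pair by the arc \<open>(x, y)\<close>, without losing disjointness.\<close>

lemma menger_glue:
  assumes G: "finite W" "x \<notin> W" "y \<notin> W"
    and sep: "separates G S T W"
    and P: "linkage G S (insert x W) P" "card P = Suc (card W)"
    and Q: "linkage G (insert y W) T Q" "card Q = Suc (card W)"
  shows "\<exists>R. linkage (insert (x, y) G) S T R \<and> card R = Suc (card W)"
proof -
  obtain p where p: "\<And>w. w \<in> insert x W \<Longrightarrow> dipath G (p w) \<and> hd (p w) \<in> S \<and> last (p w) = w"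
    "\<And>w. w \<in> insert x W \<Longrightarrow> set (p w) \<inter> insert x W = {w}"
    "\<And>v w. v \<in> insert x W \<Longrightarrow> w \<in> insert x W \<Longrightarrow> v \<noteq> w \<Longrightarrow> set (p v) \<inter> set (p w) = {}"
    using linkage_end_indexed[OF P(1)] P(2) G by (metis card_insert_disjoint finite_insert)
  obtain q where q: "\<And>w. w \<in> insert y W \<Longrightarrow> dipath G (q w) \<and> last (q w) \<in> T \<and> hd (q w) = w"
    "\<And>w. w \<in> insert y W \<Longrightarrow> set (q w) \<inter> insert y W = {w}"
    "\<And>v w. v \<in> insert y W \<Longrightarrow> w \<in> insert y W \<Longrightarrow> v \<noteq> w \<Longrightarrow> set (q v) \<inter> set (q w) = {}"
    using linkage_start_indexed[OF Q(1)] Q(2) G by (metis card_insert_disjoint finite_insert)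
  \<comment> \<open>\<open>p v\<close> can meet \<open>W\<close> only at its last vertex and
    \<open>q w\<close> only at its first one. If \<open>u\<close> is outside \<open>W\<close>, the
    segment of \<open>p v\<close> up to \<open>u\<close> and the segment of \<open>q w\<close> from
    \<open>u\<close> therefore miss \<open>W\<close>.\<close>
  have meet: "u \<in> W" if mt: "v \<in> insert x W" "w \<in> insert y W" "u \<in> set (p v)" "u \<in> set (q w)" for u v w
  proof (rule ccontr)
    assume u: "u \<notin> W"
    obtain as bs where s: "p v = as @ u # bs" using split_list[OF mt(3)] by blast
    obtain cs ds where t: "q w = cs @ u # ds" using split_list[OF mt(4)] by blast
    have "dipath G (as @ [u])" using p(1)[OF that(1)] s dipath_appendD1[of G "as @ [u]" bs] by simp
    moreover have "dipath G (u # ds)" using q(1)[OF that(2)] t dipath_appendD2[of G cs "u # ds"] by simp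
    moreover have "set (as @ [u]) \<inter> W = {}"
    proof (cases bs rule: rev_cases)
      case Nil
      then have "v = u" using p(1)[OF that(1)] s by simp
      then show ?thesis using p(2)[OF that(1)] s u by auto
    next
      case (snoc _ z)
      then have "z = v" using p(1)[OF that(1)] s by simp
      then show ?thesis using p(1)[OF that(1)] p(2)[OF that(1)] s snoc u
        by (auto simp: dipath_def)
    qed
    moreover have "set (u # ds) \<inter> W = {}"
    proof (cases cs)
      case Nil
      then have "w = u" using q(1)[OF that(2)] t by simp
      then show ?thesis using q(2)[OF that(2)] t u by auto
    next
      case (Cons z _)
      then have "z = w" using q(1)[OF that(2)] t by simp
      then show ?thesis using q(1)[OF that(2)] q(2)[OF that(2)] t Cons u
        by (auto simp: dipath_def)
    qed
    ultimately have R: "(hd (as @ [u]), u) \<in> (G \<inter> (UNIV - W) \<times> (UNIV - W))\<^sup>*"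
      "(u, last (u # ds)) \<in> (G \<inter> (UNIV - W) \<times> (UNIV - W))\<^sup>*"
      using dipath_rtrancl[of G "as @ [u]" W UNIV] dipath_rtrancl[of G "u # ds" W UNIV]
      by (auto simp: dipath_def)
    moreover have "hd (as @ [u]) = hd (p v)" "last (u # ds) = last (q w)"
      using s t by (auto simp: hd_append)
    ultimately have "(hd (p v), last (q w)) \<in> (G \<inter> (UNIV - W) \<times> (UNIV - W))\<^sup>*"
      by (metis rtrancl_trans)
    moreover have "hd (p v) \<in> UNIV - W"
      using \<open>set (as @ [u]) \<inter> W = {}\<close> \<open>hd (as @ [u]) = hd (p v)\<close> by (cases as) auto
    ultimately obtain r where r: "dipath G r" "hd r = hd (p v)" "last r = last (q w)" "set r \<subseteq> UNIV - W"
      using rtrancl_dipath by metis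
    have "hd r \<in> S" "last r \<in> T" using r p(1)[OF mt(1)] q(1)[OF mt(2)] by auto
    then show False using sep r by (auto simp: separates_def)
  qed
  \<comment> \<open>The path of \<open>P\<close> ending in \<open>w\<close> is continued by the path
    of \<open>Q\<close> starting in \<open>f w\<close>.\<close>
  define f where "f w = (if w = x then y else w)" for w
  have f: "f w \<in> insert y W" if "w \<in> insert x W" for w using that by (auto simp: f_def)
  have finj: "f v \<noteq> f w" if "v \<in> insert x W" "w \<in> insert x W" "v \<noteq> w" for v w
    using that G by (auto simp: f_def)
  define r where "r w = (if w = x then p x @ q y else p w @ tl (q w))" for w
  have setr: "set (r w) = set (p w) \<union> set (q (f w))" if "w \<in> insert x W" for w
  proof (cases "w = x")
    case False
    have "w \<in> set (p w)" using p(2)[OF that] by auto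
    moreover have "q w = w # tl (q w)" using q(1)[of w] False that by (cases "q w") (auto simp: dipath_def)
    then have "set (q w) = insert w (set (tl (q w)))" by (metis list.set(2))
    ultimately show ?thesis using False by (auto simp: r_def f_def)
  qed (simp add: r_def f_def)
  have dr: "dipath (insert (x, y) G) (r w) \<and> hd (r w) \<in> S \<and> last (r w) \<in> T" if w: "w \<in> insert x W" for w
  proof (cases "w = x")
    case True
    have "u \<notin> set (q y)" if "u \<in> set (p x)" for u
    proof
      assume "u \<in> set (q y)"
      then have "u \<in> W" using meet[of x y u] that by blast
      then have "u = x" using p(2)[of x] that by blast
      then show False using \<open>u \<in> W\<close> G by blast
    qed
    then have "set (p x) \<inter> set (q y) = {}" by blast
    moreover have "dipath (insert (x, y) G) (p x)" "dipath (insert (x, y) G) (q y)"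
      using p(1)[of x] q(1)[of y] dipath_mono by blast+
    ultimately show ?thesis using True p(1)[of x] q(1)[of y]
      by (auto simp: r_def dipath_def successively_append_iff)
  next
    case False
    then have wW: "w \<in> W" using w by simp
    obtain qs where qs: "q w = w # qs" using q(1)[of w] wW by (cases "q w") (auto simp: dipath_def)
    have "set (p w) \<inter> set qs = {}"
    proof (rule ccontr)
      assume "set (p w) \<inter> set qs \<noteq> {}"
      then obtain u where u: "u \<in> set (p w)" "u \<in> set qs" by auto
      then have "u \<in> W" using meet[of w w u] wW qs by auto
      then have "u = w" using p(2)[OF w] u by auto
      then show False using q(1)[of w] wW qs u by (auto simp: dipath_def)
    qed
    moreover have "dipath (insert (x, y) G) (p w)" "dipath (insert (x, y) G) (q w)"
      using p(1)[OF w] q(1)[of w] wW dipath_mono by blast+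
    ultimately show ?thesis using False p(1)[OF w] q(1)[of w] wW qs
      by (auto simp: r_def dipath_def successively_append_iff successively_Cons last_append split: if_splits)
  qed
  have disj: "set (r v) \<inter> set (r w) = {}" if vw: "v \<in> insert x W" "w \<in> insert x W" "v \<noteq> w" for v w
  proof -
    have a: "set (p v) \<inter> set (q (f w)) = {}" if "v \<in> insert x W" "w \<in> insert x W" "v \<noteq> w" for v w
    proof (rule ccontr)
      assume "set (p v) \<inter> set (q (f w)) \<noteq> {}"
      then obtain u where u: "u \<in> set (p v)" "u \<in> set (q (f w))" by auto
      then have "u \<in> W" using meet[of v "f w" u] that f by auto
      then have "u = v" "u = f w" using p(2)[of v] q(2)[of "f w"] u that f by blast+
      then show False using that \<open>u \<in> W\<close> G by (auto simp: f_def split: if_splits)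
    qed
    have "set (q (f v)) \<inter> set (q (f w)) = {}" using q(3)[OF f f finj] vw by simp
    then show ?thesis using setr vw a[OF vw] a[OF vw(2,1)] p(3)[OF vw] by auto
  qed
  have "inj_on r (insert x W)"
  proof (rule inj_onI, rule ccontr)
    fix v w assume "v \<in> insert x W" "w \<in> insert x W" "r v = r w" "v \<noteq> w"
    then have "set (r v) = {}" using disj[of v w] by auto
    then show False using dr[OF \<open>v \<in> insert x W\<close>] by (auto simp: dipath_def)
  qed
  then have "card (r ` insert x W) = Suc (card W)" using G by (simp add: card_image)
  moreover have "linkage (insert (x, y) G) S T (r ` insert x W)"
    unfolding linkage_def using G dr disj by (fastforce simp: image_iff)
  ultimately show ?thesis by blast
qed

text \<open>Induction on the arcs. If \<open>G\<close> without the arc \<open>(x, y)\<close> has a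
  separator \<open>W\<close> with fewer than \<open>k\<close> vertices, adding either
  \<open>x\<close> or \<open>y\<close> to it separates in the full graph, so \<open>W\<close> has
  exactly \<open>k - 1\<close> vertices. Separators of \<open>S\<close> from
  \<open>insert x W\<close>, or of \<open>insert y W\<close> from \<open>T\<close>, in the smaller
  graph separate \<open>S\<close> from \<open>T\<close> in the full one; the induction hypothesis
  gives two linkages to be glued.\<close>

theorem menger:
  assumes "finite G" "finite S" "\<And>W. finite W \<Longrightarrow> separates G S T W \<Longrightarrow> k \<le> card W"
  shows "\<exists>P. linkage G S T P \<and> card P = k"
  using assms
proof (induction G arbitrary: S T k rule: finite_induct)
  case empty
  have "p = [hd p]" if "dipath {} p" for p :: "'a list"
    using that by (cases p; cases "tl p") (auto simp: dipath_def)
  then have "separates {} S T (S \<inter> T)" unfolding separates_def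
    by (metis Int_iff disjoint_iff last_ConsL list.set_intros(1))
  then have "k \<le> card (S \<inter> T)" using empty by simp
  then obtain R where R: "R \<subseteq> S \<inter> T" "card R = k" "finite R" by (meson obtain_subset_with_card_n)
  then have "linkage {} S T ((\<lambda>v. [v]) ` R)" by (auto simp: linkage_def dipath_def)
  moreover have "card ((\<lambda>v. [v]) ` R) = k" using R by (simp add: card_image inj_on_def)
  ultimately show ?case by blast
next
  case (insert e G)
  obtain x y where e: "e = (x, y)" by force
  show ?case
  proof (cases "\<forall>W. finite W \<longrightarrow> separates G S T W \<longrightarrow> k \<le> card W")
    case True
    then obtain P where "linkage G S T P" "card P = k" using insert.IH[of S T k] insert.prems by blast
    then show ?thesis using linkage_mono by blast
  next
    case False
    then obtain W where W: "finite W" "separates G S T W" "card W < k" by fastforce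
    have xy: "separates (insert (x, y) G) S T (insert z W)" if z: "z = x \<or> z = y" for z
      unfolding separates_def
    proof (intro allI impI notI)
      fix p assume p: "dipath (insert (x, y) G) p" "hd p \<in> S" "last p \<in> T" "set p \<inter> insert z W = {}"
      then have "p \<noteq> as @ x # y # bs" for as bs using z by auto
      then have "dipath G p" using p(1) successively_insert_arc[of x y G p] by (simp add: dipath_def)
      then show False using W p by (auto simp: separates_def)
    qed
    have "k \<le> card (insert x W)" "k \<le> card (insert y W)" using xy insert.prems e W by auto
    then have "x \<notin> W" "y \<notin> W" and k: "k = Suc (card W)"
      using W by (auto simp: card_insert_if split: if_splits)
    have "\<exists>P. linkage G S (insert x W) P \<and> card P = k"
      using insert.prems e separates_prefix[OF xy] by (intro insert.IH) blast+
    moreover have "\<exists>Q. linkage G (insert y W) T Q \<and> card Q = k"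
      using insert.prems e separates_suffix[OF xy] W by (intro insert.IH) (blast | simp)+
    ultimately show ?thesis
      using menger_glue[OF W(1) \<open>x \<notin> W\<close> \<open>y \<notin> W\<close> W(2)] unfolding k e by blast
  qed
qed

section \<open>Median orders and degree-bounded arc sets\<close>

text \<open>A median order is a list of all vertices for which this number is maximal.\<close>

fun forward_count :: "('a \<times> 'a) set \<Rightarrow> 'a list \<Rightarrow> nat" where
  "forward_count T [] = 0"
| "forward_count T (x # xs) = card (T `` {x} \<inter> set xs) + forward_count T xs"

text \<open>Moving \<open>v\<close> to the front of the block \<open>bs\<close> gains the arcs from
  \<open>v\<close> to \<open>bs\<close> and loses those from \<open>bs\<close> to \<open>v\<close>.
  The additive form avoids truncated subtraction.\<close>

lemma forward_count_shift:
  assumes "v \<notin> set bs" "distinct bs" "set bs \<inter> set cs = {}" "v \<notin> set cs"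
  shows "forward_count T (bs @ v # cs) + card (T `` {v} \<inter> set bs)
    = forward_count T (v # bs @ cs) + card (T\<inverse> `` {v} \<inter> set bs)"
  using assms
proof (induction bs)
  case (Cons b bs)
  have *: "card (R `` {u} \<inter> insert w M) = card (R `` {u} \<inter> M) + (if (u, w) \<in> R then 1 else 0)"
    if "w \<notin> M" "finite M" for R :: "('a \<times> 'a) set" and u w M
    using that by (auto simp: Int_insert_right)
  have 1: "card (T `` {b} \<inter> insert v (set bs \<union> set cs))
      = card (T `` {b} \<inter> (set bs \<union> set cs)) + (if (b, v) \<in> T then 1 else 0)"
    using Cons.prems by (intro *) auto
  have 2: "card (T `` {v} \<inter> insert b (set bs \<union> set cs))
      = card (T `` {v} \<inter> (set bs \<union> set cs)) + (if (v, b) \<in> T then 1 else 0)"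
    using Cons.prems by (intro *) auto
  have 3: "card (T `` {v} \<inter> insert b (set bs)) = card (T `` {v} \<inter> set bs) + (if (v, b) \<in> T then 1 else 0)"
    using Cons.prems by (intro *) auto
  have 4: "card (T\<inverse> `` {v} \<inter> insert b (set bs))
      = card (T\<inverse> `` {v} \<inter> set bs) + (if (b, v) \<in> T then 1 else 0)"
    using Cons.prems *[of b "set bs" "T\<inverse>" v] by auto
  have "forward_count T (bs @ v # cs) + card (T `` {v} \<inter> set bs)
      = card (T `` {v} \<inter> (set bs \<union> set cs)) + forward_count T (bs @ cs) + card (T\<inverse> `` {v} \<inter> set bs)"
    using Cons by simp
  then show ?case using 1 2 3 4 by simp
qed simp

lemma forward_count_prefix:
  assumes "set xs = set ys"
  shows "forward_count T (as @ xs) + forward_count T ys = forward_count T (as @ ys) + forward_count T xs"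
proof (induction as)
  case (Cons a as)
  have "set (as @ xs) = set (as @ ys)" using assms by simp
  then show ?case using Cons by (simp only: append_Cons forward_count.simps)
qed simp

text \<open>In a list with maximal \<open>forward_count\<close>, moving \<open>v\<close> past an
  adjacent block cannot gain arcs.\<close>

lemma median_list:
  assumes T: "tournament V T"
  obtains xs where "distinct xs" "set xs = V"
    and "\<And>as v bs cs. xs = as @ v # bs @ cs \<Longrightarrow> card (T\<inverse> `` {v} \<inter> set bs) \<le> card (T `` {v} \<inter> set bs)"
    and "\<And>as v bs cs. xs = as @ bs @ v # cs \<Longrightarrow> card (T `` {v} \<inter> set bs) \<le> card (T\<inverse> `` {v} \<inter> set bs)"
proof -
  \<comment> \<open>Any bound would do; it only ensures that a maximum exists.\<close>
  have bound: "forward_count T xs \<le> length xs * length xs" for xs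
  proof (induction xs)
    case (Cons x xs)
    have "card (T `` {x} \<inter> set xs) \<le> card (set xs)" by (intro card_mono) auto
    then have "card (T `` {x} \<inter> set xs) \<le> length xs" using card_length[of xs] by linarith
    then show ?case using Cons by simp
  qed simp
  obtain xs0 where xs0: "distinct xs0 \<and> set xs0 = V"
    using finite_distinct_list[OF tournament_finite[OF T]] by blast
  have "length xs = card V" if "distinct xs \<and> set xs = V" for xs
    using that distinct_card by metis
  then have "\<forall>xs. distinct xs \<and> set xs = V \<longrightarrow> forward_count T xs < Suc (card V * card V)"
    using bound by (metis less_Suc_eq_le)
  from ex_has_greatest_nat[of "\<lambda>xs. distinct xs \<and> set xs = V", OF xs0 this]
  obtain xs where "distinct xs" "set xs = V"
    "\<forall>ys. distinct ys \<and> set ys = V \<longrightarrow> forward_count T ys \<le> forward_count T xs" by (elim exE conjE)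
  then have xs: "distinct xs" "set xs = V"
    and max: "\<And>ys. distinct ys \<Longrightarrow> set ys = V \<Longrightarrow> forward_count T ys \<le> forward_count T xs" by simp_all
  show ?thesis
  proof (rule that[OF xs])
    fix as v bs cs assume s: "xs = as @ v # bs @ cs"
    have "forward_count T (as @ bs @ v # cs) \<le> forward_count T (as @ v # bs @ cs)"
      unfolding s[symmetric] using xs s by (intro max) auto
    moreover have "forward_count T (as @ v # bs @ cs) + forward_count T (bs @ v # cs)
        = forward_count T (as @ bs @ v # cs) + forward_count T (v # bs @ cs)"
      by (rule forward_count_prefix) auto
    moreover have "forward_count T (bs @ v # cs) + card (T `` {v} \<inter> set bs)
        = forward_count T (v # bs @ cs) + card (T\<inverse> `` {v} \<inter> set bs)"
      using xs s by (intro forward_count_shift) auto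
    ultimately show "card (T\<inverse> `` {v} \<inter> set bs) \<le> card (T `` {v} \<inter> set bs)" by linarith
  next
    fix as v bs cs assume s: "xs = as @ bs @ v # cs"
    have "forward_count T (as @ v # bs @ cs) \<le> forward_count T (as @ bs @ v # cs)"
      unfolding s[symmetric] using xs s by (intro max) auto
    moreover have "forward_count T (as @ v # bs @ cs) + forward_count T (bs @ v # cs)
        = forward_count T (as @ bs @ v # cs) + forward_count T (v # bs @ cs)"
      by (rule forward_count_prefix) auto
    moreover have "forward_count T (bs @ v # cs) + card (T `` {v} \<inter> set bs)
        = forward_count T (v # bs @ cs) + card (T\<inverse> `` {v} \<inter> set bs)"
      using xs s by (intro forward_count_shift) auto
    ultimately show "card (T `` {v} \<inter> set bs) \<le> card (T\<inverse> `` {v} \<inter> set bs)" by linarith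
  qed
qed

lemma list_split_interval:
  assumes "i \<le> j" "j < length xs"
  shows "xs = take i xs @ xs ! i # map ((!) xs) [Suc i..<Suc j] @ drop (Suc j) xs"
    and "xs = take i xs @ map ((!) xs) [i..<j] @ xs ! j # drop (Suc j) xs"
proof -
  have seg: "take i xs @ map ((!) xs) [i..<l] = take l xs" if "i \<le> l" "l \<le> length xs" for l
  proof -
    have "map ((!) xs) [0..<l] = take l xs" if "l \<le> length xs" for l :: nat
      using that by (metis map_nth take_map take_upt add_0)
    then have "take i xs = map ((!) xs) [0..<i]" "take l xs = map ((!) xs) [0..<l]" using that by auto
    moreover have "[0..<l] = [0..<i] @ [i..<l]" using that upt_add_eq_append[of 0 i "l - i"] by simp
    ultimately show ?thesis by simp
  qed
  have "(take i xs @ map ((!) xs) [i..<j]) @ xs ! j # drop (Suc j) xs = xs"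
    using seg[of j] assms by (simp add: id_take_nth_drop[symmetric])
  then show "xs = take i xs @ map ((!) xs) [i..<j] @ xs ! j # drop (Suc j) xs"
    unfolding append_assoc by (rule sym)
  have "map ((!) xs) [i..<Suc j] = xs ! i # map ((!) xs) [Suc i..<Suc j]"
    using assms by (simp add: upt_conv_Cons del: upt_Suc)
  moreover have "(take i xs @ map ((!) xs) [i..<Suc j]) @ drop (Suc j) xs = xs"
    using seg[of "Suc j"] assms by (simp del: upt_Suc)
  ultimately have "take i xs @ xs ! i # map ((!) xs) [Suc i..<Suc j] @ drop (Suc j) xs = xs" by simp
  then show "xs = take i xs @ xs ! i # map ((!) xs) [Suc i..<Suc j] @ drop (Suc j) xs" by (rule sym)
qed

text \<open>The rank \<open>r\<close> replaces the list, and blocks become rank intervals. Out- and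
  in-neighbours of the end vertex fill the interval, so the larger of the two parts is at least half
  of it.\<close>

lemma median_order:
  assumes T: "tournament V T"
  obtains r :: "'a \<Rightarrow> nat" where "bij_betw r V {..<card V}"
    and "\<And>v w. v \<in> V \<Longrightarrow> w \<in> V \<Longrightarrow> r v \<le> r w \<Longrightarrow>
      card {u \<in> V. r v < r u \<and> r u \<le> r w} \<le> 2 * card (T `` {v} \<inter> {u \<in> V. r v < r u \<and> r u \<le> r w})"
    and "\<And>v w. v \<in> V \<Longrightarrow> w \<in> V \<Longrightarrow> r v \<le> r w \<Longrightarrow>
      card {u \<in> V. r v \<le> r u \<and> r u < r w} \<le> 2 * card (T\<inverse> `` {w} \<inter> {u \<in> V. r v \<le> r u \<and> r u < r w})"
proof -
  obtain xs where xs: "distinct xs" "set xs = V"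
    and out: "\<And>as v bs cs. xs = as @ v # bs @ cs \<Longrightarrow> card (T\<inverse> `` {v} \<inter> set bs) \<le> card (T `` {v} \<inter> set bs)"
    and inn: "\<And>as v bs cs. xs = as @ bs @ v # cs \<Longrightarrow> card (T `` {v} \<inter> set bs) \<le> card (T\<inverse> `` {v} \<inter> set bs)"
    using median_list[OF T] by metis
  have n: "length xs = card V" using xs distinct_card by metis
  have bij: "bij_betw ((!) xs) {..<card V} V" using bij_betw_nth[OF xs(1)] xs(2) n by simp
  define r where "r = the_inv_into {..<card V} ((!) xs)"
  have rbij: "bij_betw r V {..<card V}" unfolding r_def using bij by (rule bij_betw_the_inv_into)
  have rl: "r v < card V" "xs ! r v = v" if "v \<in> V" for v
    using rbij that bij f_the_inv_into_f_bij_betw[OF bij] by (auto simp: r_def bij_betw_def)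
  have rn: "r (xs ! i) = i" if "i < card V" for i
    using the_inv_into_f_f[of "(!) xs" "{..<card V}" i] bij that by (auto simp: r_def bij_betw_def)
  have seg: "(!) xs ` {i..<j} = {u \<in> V. i \<le> r u \<and> r u < j}" if "j \<le> card V" for i j
  proof (intro set_eqI iffI)
    fix u assume "u \<in> (!) xs ` {i..<j}"
    then show "u \<in> {u \<in> V. i \<le> r u \<and> r u < j}" using that rn n xs by auto
  next
    fix u assume "u \<in> {u \<in> V. i \<le> r u \<and> r u < j}"
    then show "u \<in> (!) xs ` {i..<j}" using rl[of u] by (intro image_eqI[of _ _ "r u"]) auto
  qed
  show ?thesis
  proof (rule that[OF rbij])
    fix v w assume vw: "v \<in> V" "w \<in> V" "r v \<le> r w"
    define I where "I = {u \<in> V. r v < r u \<and> r u \<le> r w}"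
    have I: "set (map ((!) xs) [Suc (r v)..<Suc (r w)]) = I"
      using seg[of "Suc (r w)" "Suc (r v)"] rl[OF vw(2)] by (simp add: I_def Suc_le_eq less_Suc_eq_le del: upt_Suc)
    have "card (T\<inverse> `` {v} \<inter> I) \<le> card (T `` {v} \<inter> I)"
      using out[OF list_split_interval(1)[of "r v" "r w" xs, unfolded rl(2)[OF vw(1)]]] vw rl n
      unfolding I by simp
    moreover have "card (T `` {v} \<inter> I) + card (T\<inverse> `` {v} \<inter> I) = card I"
      using vw by (intro tournament_degree_sum[OF T]) (auto simp: I_def)
    ultimately show "card {u \<in> V. r v < r u \<and> r u \<le> r w}
        \<le> 2 * card (T `` {v} \<inter> {u \<in> V. r v < r u \<and> r u \<le> r w})" unfolding I_def by linarith
  next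
    fix v w assume vw: "v \<in> V" "w \<in> V" "r v \<le> r w"
    define I where "I = {u \<in> V. r v \<le> r u \<and> r u < r w}"
    have I: "set (map ((!) xs) [r v..<r w]) = I"
      using seg[of "r w" "r v"] rl[OF vw(2)] by (simp add: I_def)
    have "card (T `` {w} \<inter> I) \<le> card (T\<inverse> `` {w} \<inter> I)"
      using inn[OF list_split_interval(2)[of "r v" "r w" xs, unfolded rl(2)[OF vw(2)]]] vw rl n
      unfolding I by simp
    moreover have "card (T `` {w} \<inter> I) + card (T\<inverse> `` {w} \<inter> I) = card I"
      using vw by (intro tournament_degree_sum[OF T]) (auto simp: I_def)
    ultimately show "card {u \<in> V. r v \<le> r u \<and> r u < r w}
        \<le> 2 * card (T\<inverse> `` {w} \<inter> {u \<in> V. r v \<le> r u \<and> r u < r w})" unfolding I_def by linarith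
  qed
qed

section \<open>Degree-constrained arc sets\<close>

datatype 'a flow_node = Out 'a nat | Arc 'a 'a | In 'a nat

text \<open>Copies \<open>Out x i\<close> and \<open>In y j\<close> with \<open>i, j < c\<close> turn the degree bound \<open>c\<close> into vertex
  disjointness, and the middle vertex \<open>Arc x y\<close> prevents an arc from being used twice.\<close>

lemma exists_degree_bounded_arcs:
  assumes V: "finite V" and G: "G \<subseteq> V \<times> V"
    and cut: "\<And>X Y. X \<subseteq> V \<Longrightarrow> Y \<subseteq> V \<Longrightarrow> q \<le> c * card (V - X) + c * card (V - Y) + card (G \<inter> X \<times> Y)"
  shows "\<exists>F\<subseteq>G. card F = q \<and> (\<forall>v. card (F `` {v}) \<le> c \<and> card (F\<inverse> `` {v}) \<le> c)"
proof -
  have finG: "finite G" using V G finite_subset by blast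
  define H where "H = (\<lambda>((x, y), i). (Out x i, Arc x y)) ` (G \<times> {..<c})
    \<union> (\<lambda>((x, y), j). (Arc x y, In y j)) ` (G \<times> {..<c})"
  define S where "S = (\<lambda>(x, i). Out x i) ` (V \<times> {..<c})"
  define R where "R = (\<lambda>(y, j). In y j) ` (V \<times> {..<c})"
  have H1: "(Out x i, z) \<in> H \<longleftrightarrow> (\<exists>y. z = Arc x y \<and> (x, y) \<in> G \<and> i < c)" for x i z
    by (force simp: H_def)
  have H2: "(Arc x y, z) \<in> H \<longleftrightarrow> (\<exists>j. z = In y j \<and> (x, y) \<in> G \<and> j < c)" for x y z
    by (force simp: H_def)
  have H3: "(In y j, z) \<notin> H" for y j z by (force simp: H_def)
  have "\<exists>P. linkage H S R P \<and> card P = q"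
  proof (rule menger)
    show "finite H" "finite S" using finG V by (auto simp: H_def S_def)
    fix W assume W: "finite W" "separates H S R W"
    \<comment> \<open>\<open>X\<close> and \<open>Y\<close> collect the vertices of which some copy
      survives. So \<open>W\<close> contains all \<open>c\<close> copies of every other vertex, and
      \<open>Arc x y\<close> for each arc of \<open>G\<close> from \<open>X\<close> to
      \<open>Y\<close>; this is the sum in \<open>cut\<close>.\<close>
    define X where "X = {x \<in> V. \<exists>i<c. Out x i \<notin> W}"
    define Y where "Y = {y \<in> V. \<exists>j<c. In y j \<notin> W}"
    define W1 where "W1 = (\<lambda>(x, i). Out x i) ` ((V - X) \<times> {..<c})"
    define W2 where "W2 = (\<lambda>(y, j). In y j) ` ((V - Y) \<times> {..<c})"
    define W3 where "W3 = (\<lambda>(x, y). Arc x y) ` (G \<inter> X \<times> Y)"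
    have "Arc x y \<in> W" if xy: "(x, y) \<in> G \<inter> X \<times> Y" for x y
    proof -
      obtain i j where ij: "i < c" "Out x i \<notin> W" "j < c" "In y j \<notin> W"
        using xy by (auto simp: X_def Y_def)
      have "dipath H [Out x i, Arc x y, In y j]" using xy ij by (auto simp: dipath_def H1 H2)
      moreover have "Out x i \<in> S" "In y j \<in> R" using xy ij G by (auto simp: S_def R_def)
      ultimately have "set [Out x i, Arc x y, In y j] \<inter> W \<noteq> {}"
        using W(2) unfolding separates_def by (metis last.simps list.distinct(1) list.sel(1))
      then show ?thesis using ij by auto
    qed
    then have "W1 \<union> W2 \<union> W3 \<subseteq> W" by (auto simp: W1_def W2_def W3_def X_def Y_def)
    then have "card (W1 \<union> W2 \<union> W3) \<le> card W" using W by (intro card_mono)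
    moreover have "card (W1 \<union> W2 \<union> W3) = card W1 + card W2 + card W3"
    proof -
      have "finite W1" "finite W2" "finite W3" using V finG by (auto simp: W1_def W2_def W3_def)
      moreover have "W1 \<inter> W2 = {}" "(W1 \<union> W2) \<inter> W3 = {}" by (auto simp: W1_def W2_def W3_def)
      ultimately show ?thesis by (simp add: card_Un_disjoint)
    qed
    moreover have "card W1 = card (V - X) * c" "card W2 = card (V - Y) * c" "card W3 = card (G \<inter> X \<times> Y)"
      unfolding W1_def W2_def W3_def
      by (subst card_image, auto simp: inj_on_def card_cartesian_product)+
    moreover have "q \<le> c * card (V - X) + c * card (V - Y) + card (G \<inter> X \<times> Y)"
      by (rule cut) (auto simp: X_def Y_def)
    ultimately show "q \<le> card W" by (simp add: mult.commute)
  qed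
  then obtain P where P: "linkage H S R P" "card P = q" by blast
  have "\<exists>x i y j. p = [Out x i, Arc x y, In y j] \<and> (x, y) \<in> G \<and> i < c \<and> j < c" if p: "p \<in> P" for p
  proof -
    have p': "dipath H p" "hd p \<in> S" "last p \<in> R" using P(1) p by (auto simp: linkage_def)
    obtain x i l where 1: "p = Out x i # l" using p' by (cases p) (auto simp: dipath_def S_def)
    then have "l \<noteq> []" using p' by (auto simp: R_def)
    then obtain y l' where 2: "l = Arc x y # l'" "(x, y) \<in> G" "i < c"
      using p' 1 by (cases l) (auto simp: dipath_def H1)
    then have "l' \<noteq> []" using p' 1 by (auto simp: R_def)
    then obtain j l'' where 3: "l' = In y j # l''" "j < c"
      using p' 1 2 by (cases l') (auto simp: dipath_def H2)
    have "l'' = []" using p' 1 2 3 by (cases l'') (auto simp: dipath_def H3)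
    then show ?thesis using 1 2 3 by blast
  qed
  then obtain x i y j where p: "\<And>p. p \<in> P \<Longrightarrow>
      p = [Out (x p) (i p), Arc (x p) (y p), In (y p) (j p)] \<and> (x p, y p) \<in> G \<and> i p < c \<and> j p < c"
    by metis
  have set_p: "set p = {Out (x p) (i p), Arc (x p) (y p), In (y p) (j p)}" if "p \<in> P" for p
    using p[OF that] by (metis list.set(1,2))
  have eq: "p = p'" if "p \<in> P" "p' \<in> P" "set p \<inter> set p' \<noteq> {}" for p p'
    using P(1) that by (auto simp: linkage_def)
  have finP: "finite P" using P(1) by (simp add: linkage_def)
  define F where "F = (\<lambda>p. (x p, y p)) ` P"
  \<comment> \<open>Paths naming the same arc share its middle vertex and thus coincide. Below,
    different paths at \<open>v\<close> use different copies of \<open>v\<close>, of which there are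
    \<open>c\<close>.\<close>
  have "inj_on (\<lambda>p. (x p, y p)) P" using eq set_p by (auto simp: inj_on_def)
  then have "card F = q" using P by (simp add: F_def card_image)
  moreover have "F \<subseteq> G" using p by (auto simp: F_def)
  moreover have "card (F `` {v}) \<le> c" for v
  proof -
    have "F `` {v} = y ` {p \<in> P. x p = v}" by (auto simp: F_def)
    then have "card (F `` {v}) \<le> card {p \<in> P. x p = v}" using finP by (simp add: card_image_le)
    also have "\<dots> \<le> card {..<c}"
      using eq set_p p by (intro card_inj_on_le[of i]) (auto simp: inj_on_def)
    finally show ?thesis by simp
  qed
  moreover have "card (F\<inverse> `` {v}) \<le> c" for v
  proof -
    have "F\<inverse> `` {v} = x ` {p \<in> P. y p = v}" by (auto simp: F_def)
    then have "card (F\<inverse> `` {v}) \<le> card {p \<in> P. y p = v}" using finP by (simp add: card_image_le)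
    also have "\<dots> \<le> card {..<c}"
      using eq set_p p by (intro card_inj_on_le[of j]) (auto simp: inj_on_def)
    finally show ?thesis by simp
  qed
  ultimately show ?thesis by blast
qed

text \<open>All of \<open>N \<inter> I\<close> lies outside \<open>Y\<close> except for at most
  \<open>c - 1\<close> elements of \<open>G\<close> and one of \<open>E\<close>. In use,
  \<open>E\<close> is the neighbour lost by deleting the arcs of the linkage.\<close>

lemma half_interval_bound:
  assumes "finite I" "card I \<le> 2 * card (N \<inter> I)" "N \<inter> I \<subseteq> G \<union> E" "card E \<le> 1" "finite G" "finite E"
    and "card (G \<inter> Y) < c"
  shows "2 * card (I \<inter> Y) \<le> card I + 2 * c"
proof -
  have "N \<inter> I \<subseteq> (G \<inter> Y) \<union> E \<union> (I - Y)" using assms by auto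
  then have "card (N \<inter> I) \<le> card ((G \<inter> Y) \<union> E \<union> (I - Y))" using assms by (intro card_mono) auto
  also have "\<dots> \<le> card (G \<inter> Y) + card E + card (I - Y)"
    by (meson card_Un_le add_le_mono le_refl order_trans)
  finally have "card (N \<inter> I) \<le> c + card (I - Y)" using assms by linarith
  moreover have "card (I \<inter> Y) + card (I - Y) = card I" using assms(1) card_Int_Diff[of I Y] by simp
  ultimately show ?thesis using assms(2) by linarith
qed

lemma card_arcs_remove_source:
  assumes "finite G" "v \<in> X"
  shows "card (G \<inter> X \<times> Y) = card (G \<inter> (X - {v}) \<times> Y) + card (G `` {v} \<inter> Y)"
proof -
  have "G \<inter> X \<times> Y = (G \<inter> (X - {v}) \<times> Y) \<union> {v} \<times> (G `` {v} \<inter> Y)" using assms by auto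
  moreover have "card \<dots> = card (G \<inter> (X - {v}) \<times> Y) + card ({v} \<times> (G `` {v} \<inter> Y))"
    using assms by (intro card_Un_disjoint) (auto intro: finite_Image)
  ultimately show ?thesis by (simp add: card_cartesian_product)
qed

lemma card_arcs_remove_target:
  assumes "finite G" "v \<in> Y"
  shows "card (G \<inter> X \<times> Y) = card (G \<inter> X \<times> (Y - {v})) + card (G\<inverse> `` {v} \<inter> X)"
proof -
  have *: "card (G \<inter> X \<times> Y) = card (G\<inverse> \<inter> Y \<times> X)" for Y
  proof -
    have "(G \<inter> X \<times> Y)\<inverse> = G\<inverse> \<inter> Y \<times> X" by auto
    then show ?thesis by (metis card_inverse)
  qed
  show ?thesis unfolding * using card_arcs_remove_source[of "G\<inverse>" v Y X] assms by simp
qed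

text \<open>A vertex of \<open>X\<close> with at least \<open>c\<close> out-neighbours in
  \<open>Y\<close> can be removed, as both sides of the inequality lose enough; likewise for
  \<open>Y\<close>. Once no such vertex is left, the median property bounds
  \<open>card X + card Y\<close> itself.\<close>

lemma median_cut:
  assumes T: "tournament V T" and D: "finite D"
    "\<And>v. v \<in> V \<Longrightarrow> card (D `` {v}) \<le> 1" "\<And>v. v \<in> V \<Longrightarrow> card (D\<inverse> `` {v}) \<le> 1"
    and r: "bij_betw r V {..<card V}"
    and out: "\<And>v w. v \<in> V \<Longrightarrow> w \<in> V \<Longrightarrow> r v \<le> r w \<Longrightarrow>
      card {u \<in> V. r v < r u \<and> r u \<le> r w} \<le> 2 * card (T `` {v} \<inter> {u \<in> V. r v < r u \<and> r u \<le> r w})"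
    and inn: "\<And>v w. v \<in> V \<Longrightarrow> w \<in> V \<Longrightarrow> r v \<le> r w \<Longrightarrow>
      card {u \<in> V. r v \<le> r u \<and> r u < r w} \<le> 2 * card (T\<inverse> `` {w} \<inter> {u \<in> V. r v \<le> r u \<and> r u < r w})"
    and G: "G = {(u, v) \<in> T. r u < r v} - D"
  shows "X \<subseteq> V \<Longrightarrow> Y \<subseteq> V \<Longrightarrow>
    c * card X + c * card Y \<le> c * card V + c * (2 * c + 1) + card (G \<inter> X \<times> Y)"
proof (induction "card X + card Y" arbitrary: X Y rule: less_induct)
  case less
  have finV: "finite V" using tournament_finite[OF T] .
  have fin: "finite X" "finite Y" using less.prems finV finite_subset by auto
  have finG: "finite G" using tournament_finite_arcs[OF T] G by (simp add: case_prod_unfold)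
  show ?case
  proof (cases "\<exists>v\<in>X. c \<le> card (G `` {v} \<inter> Y)")
    case True
    then obtain v where source: "v \<in> X" "c \<le> card (G `` {v} \<inter> Y)" by (elim bexE)
    define m where "m = card (X - {v})"
    have cX: "card X = Suc m" unfolding m_def by (rule card.remove[OF fin(1) source(1)])
    have "c * card (X - {v}) + c * card Y \<le> c * card V + c * (2 * c + 1) + card (G \<inter> (X - {v}) \<times> Y)"
      using less.prems cX unfolding m_def by (intro less.hyps) (linarith | blast)+
    then have "c * m + c * card Y \<le> c * card V + c * (2 * c + 1) + card (G \<inter> (X - {v}) \<times> Y)"
      unfolding m_def .
    moreover have "c * card X = c + c * m" using cX by simp
    ultimately show ?thesis using source card_arcs_remove_source[OF finG source(1), of Y] by linarith
  next
    case no_source: False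
    show ?thesis
    proof (cases "\<exists>v\<in>Y. c \<le> card (G\<inverse> `` {v} \<inter> X)")
    case True
    then obtain v where target: "v \<in> Y" "c \<le> card (G\<inverse> `` {v} \<inter> X)" by (elim bexE)
    define m where "m = card (Y - {v})"
    have cY: "card Y = Suc m" unfolding m_def by (rule card.remove[OF fin(2) target(1)])
    have "c * card X + c * card (Y - {v}) \<le> c * card V + c * (2 * c + 1) + card (G \<inter> X \<times> (Y - {v}))"
      using less.prems cY unfolding m_def by (intro less.hyps) (linarith | blast)+
    then have "c * card X + c * m \<le> c * card V + c * (2 * c + 1) + card (G \<inter> X \<times> (Y - {v}))"
      unfolding m_def .
    moreover have "c * card Y = c + c * m" using cY by simp
    ultimately show ?thesis using target card_arcs_remove_target[OF finG target(1), of X] by linarith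
  next
    case no_target: False
    have sparse: "card (G `` {v} \<inter> Y) < c" if "v \<in> X" for v
      by (rule ccontr) (use no_source that not_less in blast)
    have sparse': "card (G\<inverse> `` {v} \<inter> X) < c" if "v \<in> Y" for v
      by (rule ccontr) (use no_target that not_less in blast)
    \<comment> \<open>Let \<open>I\<close> be the rank interval spanned by
      \<open>X \<inter> Y\<close>. Outside \<open>I\<close> the two sets are disjoint. Behind
      \<open>i\<close> the set \<open>Y\<close> covers at most half of \<open>I\<close> plus
      \<open>c\<close> vertices, and before \<open>j\<close> the same holds for \<open>X\<close>.
      The ends \<open>i\<close> and \<open>j\<close> add 2, of which 1 is saved because both
      half-open intervals are one smaller than \<open>I\<close>.\<close>
    have "card X + card Y \<le> card V + (2 * c + 1)"
    proof (cases "X \<inter> Y = {}")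
      case True
      have "card X + card Y = card (X \<union> Y)" using True fin by (simp add: card_Un_disjoint)
      also have "\<dots> \<le> card V" using less.prems finV by (intro card_mono) auto
      finally show ?thesis by simp
    next
      case False
      obtain i where i: "i \<in> X \<inter> Y" "\<And>v. v \<in> X \<inter> Y \<Longrightarrow> r i \<le> r v"
        using arg_min_if_finite[of "X \<inter> Y" r] fin False by (metis finite_Int leI)
      have "finite (r ` (X \<inter> Y))" "r ` (X \<inter> Y) \<noteq> {}" using fin False by auto
      then obtain j where j: "j \<in> X \<inter> Y" "\<And>v. v \<in> X \<inter> Y \<Longrightarrow> r v \<le> r j"
        using Max_in[of "r ` (X \<inter> Y)"] Max_ge[of "r ` (X \<inter> Y)"] by (metis imageE imageI)
      have ij: "r i \<le> r j" "i \<in> V" "j \<in> V" using i j less.prems by auto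
      have rinj: "r u = r w \<longleftrightarrow> u = w" if "u \<in> V" "w \<in> V" for u w
        using r that by (auto simp: bij_betw_def inj_on_def)
      define I where "I = {u \<in> V. r i \<le> r u \<and> r u \<le> r j}"
      define Io where "Io = {u \<in> V. r i < r u \<and> r u \<le> r j}"
      define Ii where "Ii = {u \<in> V. r i \<le> r u \<and> r u < r j}"
      have finI: "finite I" "finite Io" "finite Ii" using finV by (auto simp: I_def Io_def Ii_def)
      have Io: "I = insert i Io" "i \<notin> Io" and Ii: "I = insert j Ii" "j \<notin> Ii"
        using ij rinj by (auto simp: I_def Io_def Ii_def le_less)
      have cI: "card I = Suc (card Io)" "card I = Suc (card Ii)"
        using Io finI apply simp using Ii finI by simp
      have "2 * card (Io \<inter> Y) \<le> card Io + 2 * c"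
      proof (rule half_interval_bound)
        show "card Io \<le> 2 * card (T `` {i} \<inter> Io)" using out ij unfolding Io_def by blast
        show "T `` {i} \<inter> Io \<subseteq> G `` {i} \<union> D `` {i}" by (auto simp: G Io_def)
        show "card (D `` {i}) \<le> 1" using D ij by auto
        show "card (G `` {i} \<inter> Y) < c" using sparse[of i] i by simp
      qed (use finI D finG in \<open>auto intro: finite_Image\<close>)
      moreover have "2 * card (Ii \<inter> X) \<le> card Ii + 2 * c"
      proof (rule half_interval_bound)
        show "card Ii \<le> 2 * card (T\<inverse> `` {j} \<inter> Ii)" using inn ij unfolding Ii_def by blast
        show "T\<inverse> `` {j} \<inter> Ii \<subseteq> G\<inverse> `` {j} \<union> D\<inverse> `` {j}" by (auto simp: G Ii_def)
        show "card (D\<inverse> `` {j}) \<le> 1" using D ij by auto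
        show "card (G\<inverse> `` {j} \<inter> X) < c" using sparse'[of j] j by simp
      qed (use finI D finG in \<open>auto intro: finite_Image\<close>)
      moreover have "card (I \<inter> Y) \<le> Suc (card (Io \<inter> Y))"
        using Io finI by (metis Int_insert_left card_insert_le_m1 card_insert_if finite_Int le_SucI order_refl)
      moreover have "card (I \<inter> X) \<le> Suc (card (Ii \<inter> X))"
        using Ii finI by (metis Int_insert_left card_insert_le_m1 card_insert_if finite_Int le_SucI order_refl)
      moreover have "card X = card (I \<inter> X) + card (X - I)" "card Y = card (I \<inter> Y) + card (Y - I)"
        using fin card_Int_Diff by (metis Int_commute)+
      moreover have "card (X - I) + card (Y - I) + card I \<le> card V"
      proof -
        have d: "(X - I) \<inter> (Y - I) = {}" using i j by (auto simp: I_def) (use less.prems in blast)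
        have "card (X - I) + card (Y - I) + card I = card ((X - I) \<union> (Y - I) \<union> I)"
          using d fin finI by (subst card_Un_disjoint; (subst card_Un_disjoint)?) auto
        also have "\<dots> \<le> card V" using less.prems finV by (intro card_mono) (auto simp: I_def)
        finally show ?thesis .
      qed
      ultimately show ?thesis using cI by linarith
    qed
    then have "c * (card X + card Y) \<le> c * (card V + (2 * c + 1))" by (rule mult_le_mono2)
    then show ?thesis by (simp add: algebra_simps)
  qed
  qed
qed

text \<open>Each vertex outside \<open>E\<close> is topped up to out-degree \<open>c\<close>. The
  total deficit of \<open>F\<close> is \<open>c * card V - card F\<close>, which is small when
  \<open>F\<close> is nearly as large as its degree bound permits.\<close>

lemma complete_out_degree:
  assumes "finite G" "finite V" "F \<subseteq> G" "F \<subseteq> V \<times> V" "\<And>v. card (F `` {v}) \<le> c"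
    and "E \<subseteq> V" "\<And>v. v \<in> V - E \<Longrightarrow> c \<le> card (G `` {v})"
  shows "\<exists>F'\<subseteq>G. card F' + card F \<le> c * card V \<and> (\<forall>v\<in>V - E. c \<le> card ((F \<union> F') `` {v}))"
proof -
  have finF: "finite F" using assms finite_subset by blast
  have "\<forall>v\<in>V - E. \<exists>B. F `` {v} \<subseteq> B \<and> B \<subseteq> G `` {v} \<and> card B = c"
    using assms by (intro ballI exists_subset_between) (auto intro: finite_Image)
  from bchoice[OF this]
  obtain B where B: "\<And>v. v \<in> V - E \<Longrightarrow> F `` {v} \<subseteq> B v \<and> B v \<subseteq> G `` {v} \<and> card (B v) = c" by blast
  define F' where "F' = Sigma (V - E) (\<lambda>v. B v - F `` {v})"
  have fB: "finite (B v)" if "v \<in> V - E" for v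
    using B[OF that] finite_subset[OF _ finite_Image[OF assms(1)]] by blast
  have "card F' = (\<Sum>v\<in>V - E. card (B v - F `` {v}))"
    unfolding F'_def using assms(2) fB by simp
  also have "\<dots> = (\<Sum>v\<in>V - E. c - card (F `` {v}))"
    using B card_Diff_subset[OF finite_Image[OF finF]] by (intro sum.cong refl) simp
  also have "\<dots> \<le> (\<Sum>v\<in>V. c - card (F `` {v}))" using assms by (intro sum_mono2) auto
  finally have "card F' \<le> (\<Sum>v\<in>V. c - card (F `` {v}))" .
  moreover have "F \<inter> V \<times> V = F" "\<And>v. F `` {v} \<inter> V = F `` {v}" using assms(4) by auto
  then have "card F = (\<Sum>v\<in>V. card (F `` {v}))"
    using card_arcs_Sigma[OF assms(2) finite_Image[OF finF], of V] by simp
  ultimately have "card F' + card F \<le> (\<Sum>v\<in>V. (c - card (F `` {v})) + card (F `` {v}))"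
    by (simp add: sum.distrib)
  also have "\<dots> = c * card V" using assms(5) by simp
  finally have "card F' + card F \<le> c * card V" .
  moreover have "c \<le> card ((F \<union> F') `` {v})" if "v \<in> V - E" for v
  proof -
    have "B v \<subseteq> (F \<union> F') `` {v}" using that by (auto simp: F'_def)
    moreover have "(F \<union> F') `` {v} \<subseteq> G `` {v}" using assms(3) that B by (auto simp: F'_def)
    then have "finite ((F \<union> F') `` {v})" using finite_Image[OF assms(1)] by (rule finite_subset)
    ultimately show ?thesis using B[OF that] card_mono by blast
  qed
  moreover have "F' \<subseteq> G" using B by (auto simp: F'_def)
  ultimately show ?thesis by blast
qed

text \<open>If \<open>v\<close> has fewer than \<open>c\<close> forward arcs, the interval from
  \<open>v\<close> to the last vertex \<open>w\<close>, at least half of which is dominated by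
  \<open>v\<close>, has at most \<open>2 c\<close> elements. So \<open>v\<close> is among the last
  \<open>2 c + 1\<close> vertices.\<close>

lemma few_low_forward:
  assumes T: "tournament V T" and r: "bij_betw r V {..<card V}"
    and out: "\<And>v w. v \<in> V \<Longrightarrow> w \<in> V \<Longrightarrow> r v \<le> r w \<Longrightarrow>
      card {u \<in> V. r v < r u \<and> r u \<le> r w} \<le> 2 * card (T `` {v} \<inter> {u \<in> V. r v < r u \<and> r u \<le> r w})"
    and D: "finite D" "\<And>v. v \<in> V \<Longrightarrow> card (D `` {v}) \<le> 1"
    and G: "G = {(u, v) \<in> T. r u < r v} - D"
  shows "card {v \<in> V. card (G `` {v}) < c} \<le> 2 * c + 1"
proof (cases "V = {}")
  case False
  define n where "n = card V"
  have finV: "finite V" using tournament_finite[OF T] .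
  have finG: "finite G" using tournament_finite_arcs[OF T] G by (simp add: case_prod_unfold)
  have "n > 0" using False finV by (simp add: n_def card_gt_0_iff)
  then obtain w where w: "w \<in> V" "r w = n - 1"
    using r by (metis bij_betw_def diff_less imageE lessThan_iff n_def zero_less_one)
  have "n \<le> r v + 2 * c + 1" if v: "v \<in> V" "card (G `` {v}) < c" for v
  proof -
    define I where "I = {u \<in> V. r v < r u \<and> r u \<le> r w}"
    have rv: "r v < n" using r v by (auto simp: bij_betw_def n_def)
    \<comment> \<open>With \<open>Y = UNIV\<close> the bound reads
      \<open>card I \<le> 2 * c\<close>.\<close>
    have "2 * card (I \<inter> UNIV) \<le> card I + 2 * c"
    proof (rule half_interval_bound)
      show "card I \<le> 2 * card (T `` {v} \<inter> I)" unfolding I_def using v w rv by (intro out) auto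
      show "T `` {v} \<inter> I \<subseteq> G `` {v} \<union> D `` {v}" by (auto simp: G I_def)
    qed (use finV D finG v I_def in \<open>auto intro: finite_Image\<close>)
    then have "card I \<le> 2 * c" by simp
    moreover have "r ` I = {r v<..<n}"
    proof (intro set_eqI iffI)
      fix m assume m: "m \<in> {r v<..<n}"
      then have "m \<in> r ` V" using r by (simp add: bij_betw_def n_def)
      then obtain u where "u \<in> V" "r u = m" by blast
      then show "m \<in> r ` I" using m w by (auto simp: I_def)
    qed (use w \<open>n > 0\<close> in \<open>auto simp: I_def\<close>)
    moreover have "card (r ` I) = card I"
      using r by (intro card_image) (auto simp: bij_betw_def I_def inj_on_def)
    ultimately show ?thesis using rv by simp
  qed
  moreover have "r v < n" if "v \<in> V" for v using r that by (auto simp: bij_betw_def n_def)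
  ultimately have "r ` {v \<in> V. card (G `` {v}) < c} \<subseteq> {n - (2 * c + 1)..<n}" by force
  then have "card (r ` {v \<in> V. card (G `` {v}) < c}) \<le> card {n - (2 * c + 1)..<n}"
    by (intro card_mono) auto
  moreover have "card (r ` {v \<in> V. card (G `` {v}) < c}) = card {v \<in> V. card (G `` {v}) < c}"
    using r by (intro card_image) (auto simp: bij_betw_def inj_on_def)
  ultimately show ?thesis by simp
qed simp

text \<open>A set of \<open>c * card V - c * (2 * c + 1)\<close> forward arcs with all in- and
  out-degrees at most \<open>c\<close> misses degree \<open>c\<close> only by a total of
  \<open>c * (2 * c + 1)\<close> in each direction. Topping up both directions costs twice this, one
  half of which is offset by the arcs missing at the start.\<close>

lemma acyclic_degree_arcs:
  assumes T: "tournament V T" and D: "finite D"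
    "\<And>v. v \<in> V \<Longrightarrow> card (D `` {v}) \<le> 1" "\<And>v. v \<in> V \<Longrightarrow> card (D\<inverse> `` {v}) \<le> 1"
  shows "\<exists>F r Eo Ei. F \<subseteq> T - D \<and> (\<forall>(u, v)\<in>F. r u < (r v :: nat)) \<and> (\<forall>v\<in>V. r v < card V)
    \<and> Eo \<subseteq> V \<and> Ei \<subseteq> V \<and> card Eo \<le> 2 * c + 1 \<and> card Ei \<le> 2 * c + 1
    \<and> (\<forall>v\<in>V - Eo. c \<le> card (F `` {v})) \<and> (\<forall>v\<in>V - Ei. c \<le> card (F\<inverse> `` {v}))
    \<and> card F \<le> c * card V + c * (2 * c + 1)"
proof -
  obtain r where r: "bij_betw r V {..<card V}"
    and out: "\<And>v w. v \<in> V \<Longrightarrow> w \<in> V \<Longrightarrow> r v \<le> r w \<Longrightarrow>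
      card {u \<in> V. r v < r u \<and> r u \<le> r w} \<le> 2 * card (T `` {v} \<inter> {u \<in> V. r v < r u \<and> r u \<le> r w})"
    and inn: "\<And>v w. v \<in> V \<Longrightarrow> w \<in> V \<Longrightarrow> r v \<le> r w \<Longrightarrow>
      card {u \<in> V. r v \<le> r u \<and> r u < r w} \<le> 2 * card (T\<inverse> `` {w} \<inter> {u \<in> V. r v \<le> r u \<and> r u < r w})"
    using median_order[OF T] by blast
  define G where "G = {(u, v) \<in> T. r u < r v} - D"
  have GT: "G \<subseteq> T" by (auto simp: G_def)
  have finV: "finite V" using tournament_finite[OF T] .
  have finG: "finite G" using tournament_finite_arcs[OF T] GT finite_subset by blast
  have GV: "G \<subseteq> V \<times> V" using GT tournament_subset[OF T] by blast
  \<comment> \<open>If the subtraction truncates to 0, the final bound still holds, because the two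
    completions together have at most \<open>2 * c * card V\<close> arcs.\<close>
  define q where "q = c * card V - c * (2 * c + 1)"
  have "\<exists>F\<subseteq>G. card F = q \<and> (\<forall>v. card (F `` {v}) \<le> c \<and> card (F\<inverse> `` {v}) \<le> c)"
  proof (rule exists_degree_bounded_arcs[OF finV GV])
    fix X Y assume XY: "X \<subseteq> V" "Y \<subseteq> V"
    have "c * card X + c * card Y \<le> c * card V + c * (2 * c + 1) + card (G \<inter> X \<times> Y)"
      using median_cut[OF T D r out inn G_def XY] by blast
    moreover have "card (V - X) + card X = card V" "card (V - Y) + card Y = card V"
      using XY finV by (metis add.commute card_Int_Diff inf.absorb_iff2)+
    then have "c * card (V - X) + c * card X = c * card V" "c * card (V - Y) + c * card Y = c * card V"
      by (metis distrib_left)+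
    ultimately show "q \<le> c * card (V - X) + c * card (V - Y) + card (G \<inter> X \<times> Y)"
      unfolding q_def by linarith
  qed
  then obtain F where F: "F \<subseteq> G" "card F = q" "\<And>v. card (F `` {v}) \<le> c" "\<And>v. card (F\<inverse> `` {v}) \<le> c"
    by blast
  define Eo where "Eo = {v \<in> V. card (G `` {v}) < c}"
  define Ei where "Ei = {v \<in> V. card (G\<inverse> `` {v}) < c}"
  have cEo: "card Eo \<le> 2 * c + 1"
    unfolding Eo_def by (rule few_low_forward[OF T r out D(1,2) G_def])
  have cEi: "card Ei \<le> 2 * c + 1"
  proof -
    define n where "n = card V"
    \<comment> \<open>The reversed order turns in-degrees in \<open>T\<close> into out-degrees in
      \<open>T\<inverse>\<close>, so \<open>few_low_forward\<close> applies again.\<close>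
    define s where "s v = n - 1 - r v" for v
    have rn: "r v < n" if "v \<in> V" for v using r that by (auto simp: bij_betw_def n_def)
    have less: "s v < s w \<longleftrightarrow> r w < r v" and le: "s v \<le> s w \<longleftrightarrow> r w \<le> r v" if "v \<in> V" "w \<in> V" for v w
      using rn[OF that(1)] rn[OF that(2)] by (auto simp: s_def)
    have s: "bij_betw s V {..<card V}"
      unfolding bij_betw_def
    proof
      show inj: "inj_on s V"
      proof (rule inj_onI)
        fix v w assume vw: "v \<in> V" "w \<in> V" "s v = s w"
        then have "r v = r w" using le[of v w] le[of w v] by simp
        then show "v = w" using r vw by (auto simp: bij_betw_def inj_on_def)
      qed
      have "s ` V \<subseteq> {..<card V}" using rn by (force simp: s_def n_def)
      then show "s ` V = {..<card V}" using inj by (intro card_subset_eq) (auto simp: card_image)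
    qed
    have Gs: "G\<inverse> = {(u, v) \<in> T\<inverse>. s u < s v} - D\<inverse>"
      using less tournament_subset[OF T] by (auto simp: G_def)
    have "card {u \<in> V. s v < s u \<and> s u \<le> s w} \<le> 2 * card (T\<inverse> `` {v} \<inter> {u \<in> V. s v < s u \<and> s u \<le> s w})"
      if "v \<in> V" "w \<in> V" "s v \<le> s w" for v w
    proof -
      have "{u \<in> V. s v < s u \<and> s u \<le> s w} = {u \<in> V. r w \<le> r u \<and> r u < r v}"
        using less le that by auto
      then show ?thesis using inn[of w v] that le by auto
    qed
    then show ?thesis unfolding Ei_def
      using few_low_forward[OF tournament_converse[OF T] s _ _ _ Gs] D by auto
  qed
  have "\<exists>F'\<subseteq>G. card F' + card F \<le> c * card V \<and> (\<forall>v\<in>V - Eo. c \<le> card ((F \<union> F') `` {v}))"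
    using F GV by (intro complete_out_degree[OF finG finV]) (auto simp: Eo_def)
  then obtain F1 where F1: "F1 \<subseteq> G" "card F1 + card F \<le> c * card V"
    "\<And>v. v \<in> V - Eo \<Longrightarrow> c \<le> card ((F \<union> F1) `` {v})" by blast
  have "\<exists>F'\<subseteq>G\<inverse>. card F' + card (F\<inverse>) \<le> c * card V \<and> (\<forall>v\<in>V - Ei. c \<le> card ((F\<inverse> \<union> F') `` {v}))"
    using finG F GV by (intro complete_out_degree[OF _ finV]) (auto simp: Ei_def)
  then obtain F2 where F2: "F2 \<subseteq> G\<inverse>" "card F2 + card F \<le> c * card V"
    "\<And>v. v \<in> V - Ei \<Longrightarrow> c \<le> card ((F\<inverse> \<union> F2) `` {v})" by (auto simp: card_inverse)
  define F3 where "F3 = F \<union> F1 \<union> F2\<inverse>"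
  have F3G: "F3 \<subseteq> G" using F F1 F2 by (auto simp: F3_def)
  have finF3: "finite F3" using F3G finG finite_subset by blast
  have "card F3 \<le> card F + card F1 + card (F2\<inverse>)"
    unfolding F3_def by (meson card_Un_le add_le_mono le_refl order_trans)
  then have cF3: "card F3 \<le> c * card V + c * (2 * c + 1)"
    using F1(2) F2(2) F(2) by (simp add: card_inverse q_def)
  have o: "c \<le> card (F3 `` {v})" if "v \<in> V - Eo" for v
  proof -
    have "card ((F \<union> F1) `` {v}) \<le> card (F3 `` {v})"
      using finF3 by (intro card_mono finite_Image) (auto simp: F3_def)
    then show ?thesis using F1(3)[OF that] by linarith
  qed
  have i: "c \<le> card (F3\<inverse> `` {v})" if "v \<in> V - Ei" for v
  proof -
    have "card ((F\<inverse> \<union> F2) `` {v}) \<le> card (F3\<inverse> `` {v})"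
      using finF3 by (intro card_mono finite_Image) (auto simp: F3_def)
    then show ?thesis using F2(3)[OF that] by linarith
  qed
  have "r v < card V" if "v \<in> V" for v using r that by (auto simp: bij_betw_def)
  moreover have "Eo \<subseteq> V" "Ei \<subseteq> V" by (auto simp: Eo_def Ei_def)
  moreover have "F3 \<subseteq> T - D" "\<forall>(u, v)\<in>F3. r u < r v" using F3G by (auto simp: G_def)
  ultimately show ?thesis using cEo cEi cF3 o i by (intro exI[of _ F3] exI[of _ r] exI[of _ Eo] exI[of _ Ei]) simp
qed

text \<open>Each colour class induces a tournament and is treated separately. The leading term
  \<open>c * card W\<close> is unaffected; only the error terms are multiplied by the number of
  colours.\<close>

lemma coloured_degree_arcs:
  fixes g :: "'a \<Rightarrow> 'c"
  assumes T: "tournament V T" and W: "W \<subseteq> V" and D: "finite D"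
    "\<And>v. v \<in> W \<Longrightarrow> card (D `` {v}) \<le> 1" "\<And>v. v \<in> W \<Longrightarrow> card (D\<inverse> `` {v}) \<le> 1"
    and g: "g ` W \<subseteq> C" "finite C"
  shows "\<exists>F r Eo Ei. F \<subseteq> T \<inter> W \<times> W - D \<and> (\<forall>(u, v)\<in>F. g u = g v \<and> r u < (r v :: nat)) \<and> (\<forall>v\<in>W. r v < card V)
    \<and> Eo \<subseteq> W \<and> Ei \<subseteq> W \<and> card Eo \<le> card C * (2 * c + 1) \<and> card Ei \<le> card C * (2 * c + 1)
    \<and> (\<forall>v\<in>W - Eo. c \<le> card (F `` {v})) \<and> (\<forall>v\<in>W - Ei. c \<le> card (F\<inverse> `` {v}))
    \<and> card F \<le> c * card W + card C * (c * (2 * c + 1))"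
proof -
  define B where "B x = {v \<in> W. g v = x}" for x
  have finW: "finite W" using W tournament_finite[OF T] finite_subset by blast
  have BW: "B x \<subseteq> W" for x by (auto simp: B_def)
  have BT: "tournament (B x) (T \<inter> B x \<times> B x)" for x
    using tournament_restrict[OF T, of "B x"] BW W by blast
  define good where "good x F r Eo Ei \<longleftrightarrow> F \<subseteq> T \<inter> B x \<times> B x - D \<and> (\<forall>(u, v)\<in>F. r u < (r v :: nat))
    \<and> (\<forall>v\<in>B x. r v < card (B x))
    \<and> Eo \<subseteq> B x \<and> Ei \<subseteq> B x \<and> card Eo \<le> 2 * c + 1 \<and> card Ei \<le> 2 * c + 1
    \<and> (\<forall>v\<in>B x - Eo. c \<le> card (F `` {v})) \<and> (\<forall>v\<in>B x - Ei. c \<le> card (F\<inverse> `` {v}))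
    \<and> card F \<le> c * card (B x) + c * (2 * c + 1)" for x F r Eo Ei
  have "\<exists>F r Eo Ei. good x F r Eo Ei" for x
    unfolding good_def using BW D by (intro acyclic_degree_arcs[OF BT D(1)]) blast+
  then obtain F r Eo Ei where good: "\<And>x. good x (F x) (r x) (Eo x) (Ei x)" by metis
  have *: "\<And>x. F x \<subseteq> T \<inter> B x \<times> B x - D"
    "\<And>x u v. (u, v) \<in> F x \<Longrightarrow> r x u < r x v" "\<And>x v. v \<in> B x \<Longrightarrow> r x v < card (B x)"
    "\<And>x. Eo x \<subseteq> B x" "\<And>x. Ei x \<subseteq> B x" "\<And>x. card (Eo x) \<le> 2 * c + 1" "\<And>x. card (Ei x) \<le> 2 * c + 1"
    "\<And>x v. v \<in> B x - Eo x \<Longrightarrow> c \<le> card (F x `` {v})" "\<And>x v. v \<in> B x - Ei x \<Longrightarrow> c \<le> card ((F x)\<inverse> `` {v})"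
    "\<And>x. card (F x) \<le> c * card (B x) + c * (2 * c + 1)"
    using good unfolding good_def by blast+
  define F' where "F' = (\<Union>x\<in>C. F x)"
  have F'W: "F' \<subseteq> T \<inter> W \<times> W - D" using *(1) BW by (fastforce simp: F'_def)
  have finF': "finite F'" using F'W finW by (meson finite_SigmaI finite_subset inf.cobounded2 Diff_subset order_trans)
  have gF: "g u = x \<and> g v = x" if "(u, v) \<in> F x" for u v x using *(1)[of x] that by (auto simp: B_def)
  have gC: "g v \<in> C" if "v \<in> W" for v using g that by auto
  have cardUn: "card (\<Union>x\<in>C. E x) \<le> card C * (2 * c + 1)" if "\<And>x. card (E x) \<le> 2 * c + 1" for E :: "'c \<Rightarrow> 'a set"
  proof -
    have "card (\<Union>x\<in>C. E x) \<le> (\<Sum>x\<in>C. card (E x))" using g(2) by (rule card_UN_le)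
    also have "\<dots> \<le> (\<Sum>x\<in>C. 2 * c + 1)" using that by (intro sum_mono)
    finally show ?thesis by simp
  qed
  have "card F' \<le> (\<Sum>x\<in>C. card (F x))" unfolding F'_def using g(2) by (rule card_UN_le)
  also have "\<dots> \<le> (\<Sum>x\<in>C. c * card (B x) + c * (2 * c + 1))" using * by (intro sum_mono)
  also have "\<dots> = c * (\<Sum>x\<in>C. card (B x)) + card C * (c * (2 * c + 1))"
    by (simp add: sum.distrib sum_distrib_left)
  also have "(\<Sum>x\<in>C. card (B x)) = card (\<Union>x\<in>C. B x)"
    using g(2) finW BW by (intro card_UN_disjoint[symmetric]) (auto simp: B_def intro: finite_subset)
  also have "(\<Union>x\<in>C. B x) = W" using gC by (auto simp: B_def)
  finally have cF: "card F' \<le> c * card W + card C * (c * (2 * c + 1))" .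
  have o: "c \<le> card (F' `` {v})" if v: "v \<in> W - (\<Union>x\<in>C. Eo x)" for v
  proof -
    have "c \<le> card (F (g v) `` {v})" using v gC by (intro *(8)) (auto simp: B_def)
    also have "\<dots> \<le> card (F' `` {v})"
      using finF' gC v by (intro card_mono finite_Image) (auto simp: F'_def)
    finally show ?thesis .
  qed
  have i: "c \<le> card (F'\<inverse> `` {v})" if v: "v \<in> W - (\<Union>x\<in>C. Ei x)" for v
  proof -
    have "c \<le> card ((F (g v))\<inverse> `` {v})" using v gC by (intro *(9)) (auto simp: B_def)
    also have "\<dots> \<le> card (F'\<inverse> `` {v})"
      using finF' gC v by (intro card_mono finite_Image) (auto simp: F'_def)
    finally show ?thesis .
  qed
  have "r (g v) v < card V" if "v \<in> W" for v
  proof -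
    have "r (g v) v < card (B (g v))" using that by (intro *(3)) (simp add: B_def)
    also have "\<dots> \<le> card V" using BW W tournament_finite[OF T] by (intro card_mono) blast+
    finally show ?thesis .
  qed
  moreover have "\<forall>(u, v)\<in>F'. g u = g v \<and> r (g u) u < r (g v) v"
    using gF *(2) by (fastforce simp: F'_def)
  moreover have "(\<Union>x\<in>C. Eo x) \<subseteq> W" "(\<Union>x\<in>C. Ei x) \<subseteq> W" using *(4,5) BW by blast+
  ultimately show ?thesis
    using F'W cF o i cardUn[of Eo] cardUn[of Ei] *(6,7)
    by (intro exI[of _ F'] exI[of _ "\<lambda>v. r (g v) v"] exI[of _ "\<Union>x\<in>C. Eo x"] exI[of _ "\<Union>x\<in>C. Ei x"]) simp
qed

section \<open>Linking paths and climbing\<close>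

lemma in_zip_tl_iff: "(u, v) \<in> set (zip p (tl p)) \<longleftrightarrow> (\<exists>as bs. p = as @ u # v # bs)"
proof (induction p rule: induct_list012)
  case (3 x y zs)
  have "(u, v) \<in> set (zip (x # y # zs) (tl (x # y # zs))) \<longleftrightarrow>
      (u = x \<and> v = y) \<or> (\<exists>as bs. y # zs = as @ u # v # bs)"
    using 3 by auto
  moreover have "(u = x \<and> v = y) \<or> (\<exists>as bs. y # zs = as @ u # v # bs)
      \<longleftrightarrow> (\<exists>as bs. x # y # zs = as @ u # v # bs)"
  proof
    assume "(u = x \<and> v = y) \<or> (\<exists>as bs. y # zs = as @ u # v # bs)"
    then show "\<exists>as bs. x # y # zs = as @ u # v # bs" by (metis append_Cons append_Nil)
  next
    assume "\<exists>as bs. x # y # zs = as @ u # v # bs"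
    then obtain as bs where "x # y # zs = as @ u # v # bs" by blast
    then show "(u = x \<and> v = y) \<or> (\<exists>as bs. y # zs = as @ u # v # bs)" by (cases as) auto
  qed
  ultimately show ?case by (rule trans)
qed (simp_all add: Cons_eq_append_conv)

lemma successively_iff_zip_tl: "successively R p \<longleftrightarrow> (\<forall>e\<in>set (zip p (tl p)). R (fst e) (snd e))"
  by (induction p rule: induct_list012) simp_all

lemma zip_tl_unique:
  assumes "distinct p" "(u, v) \<in> set (zip p (tl p))" "(u', v') \<in> set (zip p (tl p))"
  shows "u = u' \<longleftrightarrow> v = v'"
proof -
  obtain as bs where 1: "p = as @ u # v # bs" using assms(2) unfolding in_zip_tl_iff by blast
  obtain as' bs' where 2: "p = as' @ u' # v' # bs'" using assms(3) unfolding in_zip_tl_iff by blast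
  show ?thesis
  proof
    assume "u = u'"
    then have eq: "as @ u # v # bs = as' @ u # v' # bs'" using 1 2 by simp
    have "u \<notin> set as" "u \<notin> set (v # bs)" using assms(1) 1 by auto
    from eq[unfolded append_Cons_eq_iff[OF this]] show "v = v'" by simp
  next
    assume "v = v'"
    then have eq: "(as @ [u]) @ v # bs = (as' @ [u']) @ v # bs'" using 1 2 by simp
    have "v \<notin> set (as @ [u])" "v \<notin> set bs" using assms(1) 1 by auto
    from eq[unfolded append_Cons_eq_iff[OF this]] show "u = u'" by simp
  qed
qed

lemma dipath_in_vertices:
  assumes "dipath G p" "G \<subseteq> V \<times> V" "hd p \<in> V"
  shows "set p \<subseteq> V"
proof -
  have "p \<noteq> []" "\<forall>e\<in>set (zip p (tl p)). (fst e, snd e) \<in> G"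
    using assms(1) by (simp_all add: dipath_def successively_iff_zip_tl)
  then show ?thesis using assms(2,3) by (induction p rule: induct_list012) auto
qed

lemma strongly_k_connected_reach:
  assumes "strongly_k_connected k V T" "Z \<subseteq> V" "card Z < k" "u \<in> V - Z" "v \<in> V - Z"
  shows "(u, v) \<in> (T \<inter> (V - Z) \<times> (V - Z))\<^sup>*"
proof -
  have "card Z \<le> k - 1" using assms by linarith
  then have "strongly_connected (V - Z) (del_verts_arcs V T Z)"
    using assms by (simp add: strongly_k_connected_def)
  then show ?thesis using assms by (simp add: strongly_connected_def del_verts_arcs_def Int_assoc)
qed

text \<open>A set \<open>W\<close> of fewer than \<open>k\<close> vertices cannot separate, as
  \<open>T\<close> without it is strongly connected and neither \<open>X\<close> nor
  \<open>Y\<close> lies in it. Among all linkages one of least total length is taken: shortcutting a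
  path uses no new vertices, so disjointness would persist and the length would drop.\<close>

lemma exists_min_linkage:
  assumes T: "tournament V T" and k: "strongly_k_connected k V T"
    and X: "X \<subseteq> V" "card X = k" and Y: "Y \<subseteq> V" "card Y = k"
  obtains P where "linkage T X Y P" "card P = k"
    and "\<And>p as v bs z cs. p \<in> P \<Longrightarrow> p = as @ v # bs @ z # cs \<Longrightarrow> bs \<noteq> [] \<Longrightarrow> (v, z) \<notin> T"
proof -
  have fin: "finite V" "finite X" "finite T"
    using tournament_finite[OF T] tournament_finite_arcs[OF T] X finite_subset by auto
  have "\<exists>P. linkage T X Y P \<and> card P = k"
  proof (rule menger[OF fin(3,2)])
    fix W assume W: "finite W" "separates T X Y W"
    show "k \<le> card W"
    proof (rule ccontr)
      assume less: "\<not> k \<le> card W"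
      have "\<not> X \<subseteq> W" "\<not> Y \<subseteq> W" using less X Y W card_mono by metis+
      then obtain x y where xy: "x \<in> X - W" "y \<in> Y - W" by blast
      have "card (W \<inter> V) \<le> card W" using W by (intro card_mono) auto
      then have "(x, y) \<in> (T \<inter> (V - W \<inter> V) \<times> (V - W \<inter> V))\<^sup>*"
        using xy X Y less by (intro strongly_k_connected_reach[OF k]) auto
      then obtain p where "dipath T p" "hd p = x" "last p = y" "set p \<subseteq> V - W \<inter> V"
        using rtrancl_dipath[of x y T V "W \<inter> V"] xy X by blast
      then show False using W xy unfolding separates_def by blast
    qed
  qed
  then obtain P0 where P0: "linkage T X Y P0 \<and> card P0 = k" by blast
  obtain P where P: "linkage T X Y P" "card P = k"
    and min: "\<forall>Q. linkage T X Y Q \<and> card Q = k \<longrightarrow> (\<Sum>p\<in>P. length p) \<le> (\<Sum>p\<in>Q. length p)"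
    using ex_has_least_nat[of "\<lambda>P. linkage T X Y P \<and> card P = k" P0 "\<lambda>P. \<Sum>p\<in>P. length p", OF P0]
    by (elim exE conjE)
  show ?thesis
  proof (rule that)
    show "linkage T X Y P" "card P = k" using P by auto
    fix p as v bs z cs assume p: "p \<in> P" "p = as @ v # bs @ z # cs" "bs \<noteq> []"
    show "(v, z) \<notin> T"
    proof
      assume vz: "(v, z) \<in> T"
      define q where "q = as @ v # z # cs"
      have finP: "finite P" using P by (simp add: linkage_def)
      have dp: "dipath T p" "hd p \<in> X" "last p \<in> Y" using P p(1) by (auto simp: linkage_def)
      have "dipath T q" using dp(1) vz p(3) unfolding p(2) q_def
        by (auto simp: dipath_def successively_append_iff successively_Cons)
      moreover have "hd q \<in> X" using dp(2) by (cases as) (auto simp: q_def p(2))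
      moreover have "last q \<in> Y" using dp(3) by (auto simp: q_def p(2))
      moreover have sub: "set q \<subseteq> set p" by (auto simp: q_def p(2))
      moreover have disj: "set p \<inter> set p' = {}" if "p' \<in> P - {p}" for p'
        using P p(1) that unfolding linkage_def by blast
      moreover have "\<forall>a\<in>P. \<forall>b\<in>P. a \<noteq> b \<longrightarrow> set a \<inter> set b = {}" using P by (simp add: linkage_def)
      ultimately have Q: "linkage T X Y (insert q (P - {p}))"
        using P finP unfolding linkage_def by blast
      have "q \<noteq> []" by (simp add: q_def)
      then have qP: "q \<notin> P - {p}" using disj[of q] sub by (cases q) auto
      have "finite (P - {p})" using finP by simp
      from card_insert_disjoint[OF this qP] have cQ: "card (insert q (P - {p})) = k"
        using P(2) card.remove[OF finP p(1)] by linarith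
      have "(\<Sum>p\<in>insert q (P - {p}). length p) = length q + (\<Sum>p\<in>P - {p}. length p)"
        using qP finP by simp
      moreover have "(\<Sum>p\<in>P. length p) = length p + (\<Sum>p\<in>P - {p}. length p)"
        using finP p(1) by (rule sum.remove)
      moreover have "length q < length p" using p(3) by (simp add: q_def p(2))
      ultimately show False using min Q cQ by fastforce
    qed
  qed
qed

text \<open>Fewer than \<open>k\<close> vertices leave one of \<open>k\<close> disjoint paths
  intact. If \<open>Z\<close> consists of out-neighbours of \<open>v\<close> other than its
  successor on the path, then \<open>Z\<close> misses the whole remainder of that path, since a
  later vertex dominated by \<open>v\<close> would be a shortcut; the last claim is the
  dual.\<close>

lemma exists_linking_arcs:
  assumes T: "tournament V T" and k: "strongly_k_connected k V T"
    and X: "X \<subseteq> V" "card X = k" and Y: "Y \<subseteq> V" "card Y = k"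
  obtains L U where "L \<subseteq> T" "U \<subseteq> V" "card L + k \<le> card U"
    and "\<And>v. card (L `` {v}) \<le> 1" "\<And>v. card (L\<inverse> `` {v}) \<le> 1"
    and "\<And>Z. finite Z \<Longrightarrow> card Z < k \<Longrightarrow> \<exists>x\<in>X - Z. \<exists>y\<in>Y - Z. (x, y) \<in> (L \<inter> (V - Z) \<times> (V - Z))\<^sup>*"
    and "\<And>v Z. v \<in> U - Z \<Longrightarrow> Z \<subseteq> T `` {v} - L `` {v} \<Longrightarrow> \<exists>y\<in>Y - Z. (v, y) \<in> (L \<inter> (V - Z) \<times> (V - Z))\<^sup>*"
    and "\<And>v Z. v \<in> U - Z \<Longrightarrow> Z \<subseteq> T\<inverse> `` {v} - L\<inverse> `` {v} \<Longrightarrow> \<exists>x\<in>X - Z. (x, v) \<in> (L \<inter> (V - Z) \<times> (V - Z))\<^sup>*"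
proof -
  obtain P where P: "linkage T X Y P" "card P = k"
    and short: "\<And>p as v bs z cs. p \<in> P \<Longrightarrow> p = as @ v # bs @ z # cs \<Longrightarrow> bs \<noteq> [] \<Longrightarrow> (v, z) \<notin> T"
    using exists_min_linkage[OF T k X Y] by blast
  have finP: "finite P" and dp: "\<And>p. p \<in> P \<Longrightarrow> dipath T p \<and> hd p \<in> X \<and> last p \<in> Y"
    and disj: "\<And>p q. p \<in> P \<Longrightarrow> q \<in> P \<Longrightarrow> p \<noteq> q \<Longrightarrow> set p \<inter> set q = {}"
    using P(1) by (auto simp: linkage_def)
  have ne: "p \<noteq> []" and dist: "distinct p" if "p \<in> P" for p using dp[OF that] by (auto simp: dipath_def)
  have pV: "set p \<subseteq> V" if "p \<in> P" for p
    using dipath_in_vertices[of T p V] dp[OF that] tournament_subset[OF T] X by auto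
  define L where "L = (\<Union>p\<in>P. set (zip p (tl p)))"
  define U where "U = (\<Union>p\<in>P. set p)"
  have LT: "L \<subseteq> T" using dp unfolding L_def dipath_def successively_iff_zip_tl by fastforce
  have finL: "finite L" using finP by (simp add: L_def)
  have Lend: "u \<in> set p \<and> v \<in> set p" if "(u, v) \<in> set (zip p (tl p))" for u v p
    using that unfolding in_zip_tl_iff by auto
  have uniq: "u = u' \<longleftrightarrow> v = v'" if uv: "(u, v) \<in> L" "(u', v') \<in> L" for u v u' v'
  proof -
    obtain p where p: "p \<in> P" "(u, v) \<in> set (zip p (tl p))" using uv(1) by (auto simp: L_def)
    obtain q where q: "q \<in> P" "(u', v') \<in> set (zip q (tl q))" using uv(2) by (auto simp: L_def)
    show ?thesis
    proof (cases "p = q")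
      case True
      then show ?thesis using zip_tl_unique[OF dist[OF p(1)]] p q by blast
    next
      case False
      then have "set p \<inter> set q = {}" using disj p q by blast
      moreover have "u \<in> set p" "v \<in> set p" "u' \<in> set q" "v' \<in> set q" using Lend[OF p(2)] Lend[OF q(2)] by blast+
      ultimately show ?thesis by auto
    qed
  qed
  have succ: "successively (\<lambda>u v. (u, v) \<in> L) p" if "p \<in> P" for p
    using that unfolding successively_iff_zip_tl L_def by auto
  show ?thesis
  proof (rule that[of L U])
    show "L \<subseteq> T" by (rule LT)
    show "U \<subseteq> V" using pV by (auto simp: U_def)
    have "card L \<le> (\<Sum>p\<in>P. card (set (zip p (tl p))))" unfolding L_def using finP by (rule card_UN_le)
    moreover have "card (set (zip p (tl p))) + 1 \<le> length p" if "p \<in> P" for p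
      using card_length[of "zip p (tl p)"] ne[OF that] by (cases p) auto
    then have "(\<Sum>p\<in>P. card (set (zip p (tl p))) + 1) \<le> (\<Sum>p\<in>P. length p)" by (intro sum_mono) auto
    then have "(\<Sum>p\<in>P. card (set (zip p (tl p)))) + k \<le> (\<Sum>p\<in>P. length p)"
      using P(2) by (simp only: sum.distrib sum_constant) simp
    moreover have "card U = (\<Sum>p\<in>P. card (set p))"
      unfolding U_def using finP disj by (intro card_UN_disjoint) auto
    moreover have "(\<Sum>p\<in>P. card (set p)) = (\<Sum>p\<in>P. length p)"
      using dist distinct_card by (intro sum.cong) auto
    ultimately show "card L + k \<le> card U" by linarith
    show "card (L `` {v}) \<le> 1" for v
      using finL uniq by (subst card_le_Suc0_iff_eq[unfolded One_nat_def[symmetric]]) (auto intro: finite_Image)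
    show "card (L\<inverse> `` {v}) \<le> 1" for v
      using finL uniq by (subst card_le_Suc0_iff_eq[unfolded One_nat_def[symmetric]]) (auto intro: finite_Image)
  next
    fix Z :: "'a set" assume Z: "finite Z" "card Z < k"
    have "\<exists>p\<in>P. set p \<inter> Z = {}"
    proof (rule ccontr)
      assume "\<not> ?thesis"
      then have "\<forall>p\<in>P. \<exists>z. z \<in> set p \<inter> Z" by blast
      from bchoice[OF this] obtain f where f: "\<forall>p\<in>P. f p \<in> set p \<inter> Z" by blast
      then have "inj_on f P" using disj unfolding inj_on_def by fastforce
      then have "card P \<le> card Z" using f Z by (intro card_inj_on_le[of f]) auto
      then show False using P Z by simp
    qed
    then obtain p where p: "p \<in> P" "set p \<inter> Z = {}" by blast
    have "(hd p, last p) \<in> (L \<inter> (V - Z) \<times> (V - Z))\<^sup>*"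
      using dipath_rtrancl[OF succ[OF p(1)] ne[OF p(1)] p(2) pV[OF p(1)]] .
    moreover have "hd p \<in> X - Z" "last p \<in> Y - Z" using dp[OF p(1)] p(2) ne[OF p(1)] by (auto simp: disjoint_iff)
    ultimately show "\<exists>x\<in>X - Z. \<exists>y\<in>Y - Z. (x, y) \<in> (L \<inter> (V - Z) \<times> (V - Z))\<^sup>*" by blast
  next
    fix v Z assume v: "v \<in> U - Z" and Z: "Z \<subseteq> T `` {v} - L `` {v}"
    obtain p where p: "p \<in> P" "v \<in> set p" using v by (auto simp: U_def)
    obtain as bs where s: "p = as @ v # bs" using split_list[OF p(2)] by blast
    have "set bs \<inter> Z = {}"
    proof (rule ccontr)
      assume "set bs \<inter> Z \<noteq> {}"
      then obtain z where z: "z \<in> set bs" "z \<in> Z" by blast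
      obtain bs' cs where t: "bs = bs' @ z # cs" using split_list[OF z(1)] by blast
      show False
      proof (cases "bs' = []")
        case True
        then have "(v, z) \<in> set (zip p (tl p))" unfolding in_zip_tl_iff using s t by auto
        then have "(v, z) \<in> L" using p(1) by (auto simp: L_def)
        then show False using z Z by auto
      next
        case False
        then show False using short[OF p(1), of as v bs' z cs] s t z Z by auto
      qed
    qed
    moreover have "successively (\<lambda>u v. (u, v) \<in> L) (v # bs)"
      using succ[OF p(1)] s by (simp add: successively_append_iff)
    ultimately have "(hd (v # bs), last (v # bs)) \<in> (L \<inter> (V - Z) \<times> (V - Z))\<^sup>*"
      using v pV[OF p(1)] s by (intro dipath_rtrancl) auto
    moreover have "last (v # bs) = last p" using s by simp
    moreover have "last (v # bs) \<notin> Z" using \<open>set bs \<inter> Z = {}\<close> v by (auto simp: disjoint_iff)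
    ultimately show "\<exists>y\<in>Y - Z. (v, y) \<in> (L \<inter> (V - Z) \<times> (V - Z))\<^sup>*" using dp[OF p(1)] by auto
  next
    fix v Z assume v: "v \<in> U - Z" and Z: "Z \<subseteq> T\<inverse> `` {v} - L\<inverse> `` {v}"
    obtain p where p: "p \<in> P" "v \<in> set p" using v by (auto simp: U_def)
    obtain as bs where s: "p = as @ v # bs" using split_list[OF p(2)] by blast
    have "set as \<inter> Z = {}"
    proof (rule ccontr)
      assume "set as \<inter> Z \<noteq> {}"
      then obtain z where z: "z \<in> set as" "z \<in> Z" by blast
      obtain cs as' where t: "as = cs @ z # as'" using split_list[OF z(1)] by blast
      show False
      proof (cases "as' = []")
        case True
        then have "(z, v) \<in> set (zip p (tl p))" unfolding in_zip_tl_iff using s t by auto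
        then have "(z, v) \<in> L" using p(1) by (auto simp: L_def)
        then show False using z Z by auto
      next
        case False
        then show False using short[OF p(1), of cs z as' v bs] s t z Z by auto
      qed
    qed
    moreover have "successively (\<lambda>u v. (u, v) \<in> L) (as @ [v])"
      using succ[OF p(1)] s by (simp add: successively_append_iff)
    ultimately have "(hd (as @ [v]), last (as @ [v])) \<in> (L \<inter> (V - Z) \<times> (V - Z))\<^sup>*"
      using v pV[OF p(1)] s by (intro dipath_rtrancl) auto
    moreover have "hd (as @ [v]) = hd p" using s by (cases as) auto
    moreover have "hd (as @ [v]) \<notin> Z" using \<open>set as \<inter> Z = {}\<close> v by (cases as) auto
    ultimately show "\<exists>x\<in>X - Z. (x, v) \<in> (L \<inter> (V - Z) \<times> (V - Z))\<^sup>*" using dp[OF p(1)] by auto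
  qed
qed

text \<open>With \<open>k\<close> exits one survives the deletion of \<open>Z\<close>; with fewer
  available, all are kept, so nothing is lost compared with \<open>T\<close>.\<close>

lemma exists_exit_arcs:
  assumes T: "tournament V T" and A: "finite A"
  obtains S where "S \<subseteq> T" "card S \<le> k * card A"
    and "\<And>a. a \<in> A \<Longrightarrow> k \<le> card (S `` {a} - A) \<or> T `` {a} - A \<subseteq> S `` {a}"
proof -
  have "\<forall>a\<in>A. \<exists>B\<subseteq>T `` {a} - A. card B \<le> k \<and> (k \<le> card B \<or> T `` {a} - A \<subseteq> B)"
  proof
    fix a
    show "\<exists>B\<subseteq>T `` {a} - A. card B \<le> k \<and> (k \<le> card B \<or> T `` {a} - A \<subseteq> B)"
    proof (cases "k \<le> card (T `` {a} - A)")
      case True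
      then obtain B where "B \<subseteq> T `` {a} - A" "card B = k" by (meson obtain_subset_with_card_n)
      then show ?thesis by (intro exI[of _ B]) auto
    qed (intro exI[of _ "T `` {a} - A"], auto)
  qed
  from bchoice[OF this] obtain B
    where B: "\<forall>a\<in>A. B a \<subseteq> T `` {a} - A \<and> card (B a) \<le> k \<and> (k \<le> card (B a) \<or> T `` {a} - A \<subseteq> B a)"
    by blast
  define S where "S = Sigma A B"
  have finB: "finite (B a)" if "a \<in> A" for a
    using B that tournament_finite_out[OF T, of a] finite_subset[of "B a" "T `` {a}"] by blast
  have Sa: "S `` {a} = B a" if "a \<in> A" for a using that by (auto simp: S_def)
  show ?thesis
  proof (rule that[of S])
    show "S \<subseteq> T" using B by (auto simp: S_def)
    have "card S = (\<Sum>a\<in>A. card (B a))" unfolding S_def using A finB by simp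
    also have "\<dots> \<le> (\<Sum>a\<in>A. k)" using B by (intro sum_mono) auto
    finally show "card S \<le> k * card A" by (simp add: mult.commute)
    show "k \<le> card (S `` {a} - A) \<or> T `` {a} - A \<subseteq> S `` {a}" if a: "a \<in> A" for a
    proof -
      have "B a - A = B a" using B a by blast
      then show ?thesis using B a Sa[OF a] by simp
    qed
  qed
qed

text \<open>These arcs let an exceptional vertex jump to a higher class, or, in class 2, enter
  \<open>A\<close> with the \<open>4 * k\<close> arcs needed to reach \<open>X\<close>.\<close>

lemma exists_class_arcs:
  assumes T: "tournament V T" and E: "finite E" "E \<subseteq> V - A"
    and \<alpha>: "\<And>v. \<alpha> v < (3::nat)"
    "\<And>v. v \<in> V - A \<Longrightarrow> \<alpha> v = 2 \<Longrightarrow> 4 * k \<le> card (T `` {v} \<inter> A)"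
    "\<And>v. v \<in> V - A \<Longrightarrow> \<alpha> v < 2 \<Longrightarrow> k \<le> card (T `` {v} \<inter> {w \<in> V - A. \<alpha> w = Suc (\<alpha> v)})"
  obtains S where "S \<subseteq> T" "card S \<le> 4 * k * card E"
    and "\<And>v. v \<in> E \<Longrightarrow> 4 * k \<le> card (S `` {v} \<inter> A) \<or> k \<le> card (S `` {v} \<inter> {w \<in> V - A. \<alpha> v < \<alpha> w})"
proof -
  have "\<forall>v\<in>E. \<exists>B\<subseteq>T `` {v}. card B \<le> 4 * k \<and>
      (4 * k \<le> card (B \<inter> A) \<or> k \<le> card (B \<inter> {w \<in> V - A. \<alpha> v < \<alpha> w}))"
  proof
    fix v assume v: "v \<in> E"
    show "\<exists>B\<subseteq>T `` {v}. card B \<le> 4 * k \<and>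
      (4 * k \<le> card (B \<inter> A) \<or> k \<le> card (B \<inter> {w \<in> V - A. \<alpha> v < \<alpha> w}))"
    proof (cases "\<alpha> v < 2")
      case True
      then have "k \<le> card (T `` {v} \<inter> {w \<in> V - A. \<alpha> w = Suc (\<alpha> v)})" using \<alpha>(3) v E by blast
      then obtain B where B: "B \<subseteq> T `` {v} \<inter> {w \<in> V - A. \<alpha> w = Suc (\<alpha> v)}" "card B = k"
        by (meson obtain_subset_with_card_n)
      then have "B \<inter> {w \<in> V - A. \<alpha> v < \<alpha> w} = B" by auto
      then show ?thesis using B by (intro exI[of _ B]) auto
    next
      case False
      then have "4 * k \<le> card (T `` {v} \<inter> A)" using \<alpha>(1)[of v] \<alpha>(2)[of v] v E by auto
      then obtain B where B: "B \<subseteq> T `` {v} \<inter> A" "card B = 4 * k" by (meson obtain_subset_with_card_n)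
      then have "B \<inter> A = B" by auto
      then show ?thesis using B by (intro exI[of _ B]) auto
    qed
  qed
  from bchoice[OF this] obtain B where B: "\<forall>v\<in>E. B v \<subseteq> T `` {v} \<and> card (B v) \<le> 4 * k \<and>
      (4 * k \<le> card (B v \<inter> A) \<or> k \<le> card (B v \<inter> {w \<in> V - A. \<alpha> v < \<alpha> w}))" by blast
  define S where "S = Sigma E B"
  have finB: "finite (B v)" if "v \<in> E" for v
    using B that tournament_finite_out[OF T, of v] finite_subset[of "B v" "T `` {v}"] by blast
  have Sv: "S `` {v} = B v" if "v \<in> E" for v using that by (auto simp: S_def)
  show ?thesis
  proof (rule that[of S])
    show "S \<subseteq> T" using B by (auto simp: S_def)
    have "card S = (\<Sum>v\<in>E. card (B v))" unfolding S_def using E finB by simp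
    also have "\<dots> \<le> (\<Sum>v\<in>E. 4 * k)" using B by (intro sum_mono) auto
    finally show "card S \<le> 4 * k * card E" by (simp add: mult.commute)
  qed (use B Sv in auto)
qed

text \<open>The predicate \<open>S\<close> marks the vertices at which the climb may get stuck. From \<open>A\<close> the climb
  starts because the set reachable from a vertex cannot lie inside \<open>A\<close>: it would be closed under
  all arcs of \<open>T\<close> that avoid \<open>Z\<close>.\<close>

lemma climb_reach:
  assumes T: "tournament V T"
    and conn: "\<And>u v. u \<in> V - Z \<Longrightarrow> v \<in> V - Z \<Longrightarrow> (u, v) \<in> (T \<inter> (V - Z) \<times> (V - Z))\<^sup>*"
    and Z: "finite Z" "card Z < k"
    and A: "A \<subseteq> V" "V - A - Z \<noteq> {}" and X: "X \<subseteq> A" "card X = k"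
    and low: "\<forall>x\<in>X. \<forall>u\<in>A - X. card (T `` {x} \<inter> A) \<le> card (T `` {u} \<inter> A)"
    and D: "D \<subseteq> T" "T \<inter> A \<times> A \<subseteq> D"
    and exit: "\<And>a. a \<in> A \<Longrightarrow> k \<le> card (D `` {a} - A) \<or> T `` {a} - A \<subseteq> D `` {a}"
    and step: "\<And>v. v \<in> V - A - Z \<Longrightarrow> 4 * k \<le> card (D `` {v} \<inter> A)
      \<or> (\<exists>w\<in>V - A - Z. (v, w) \<in> D \<and> \<rho> v < (\<rho> w :: nat)) \<or> S v"
    and bounded: "\<And>v. v \<in> V \<Longrightarrow> \<rho> v \<le> M"
    and v: "v \<in> V - Z"
  shows "(\<forall>x\<in>X - Z. (v, x) \<in> (D \<inter> (V - Z) \<times> (V - Z))\<^sup>*) \<or>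
    (\<exists>u. (v, u) \<in> (D \<inter> (V - Z) \<times> (V - Z))\<^sup>* \<and> S u)"
proof -
  let ?R = "D \<inter> (V - Z) \<times> (V - Z)"
  have finV: "finite V" using tournament_finite[OF T] .
  have climb: "(\<forall>x\<in>X - Z. (u, x) \<in> ?R\<^sup>*) \<or> (\<exists>w. (u, w) \<in> ?R\<^sup>* \<and> S w)" if "u \<in> V - A - Z" for u
    using that
  proof (induction "M - \<rho> u" arbitrary: u rule: less_induct)
    case less
    from step[OF less.prems] consider "4 * k \<le> card (D `` {u} \<inter> A)"
      | w where "w \<in> V - A - Z" "(u, w) \<in> D" "\<rho> u < \<rho> w" | "S u" by blast
    then show ?case
    proof cases
      case 1
      have "(u, x) \<in> ?R\<^sup>*" if "x \<in> X - Z" for x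
      proof (rule dominated_reach[OF T A(1) X(1) low that])
        show "u \<in> V - Z" using less.prems by blast
        show "D `` {u} \<inter> A \<subseteq> A" by blast
        \<comment> \<open>The requirement of \<open>dominated_reach\<close> is at most
          \<open>3 (k - 1) + k + 1 = 4 k - 2\<close>; this is the origin of
          \<open>4 * k\<close>.\<close>
        have "card (Z \<inter> A) \<le> card Z" using Z by (intro card_mono) auto
        then show "3 * card (Z \<inter> A) + card X + 1 \<le> card (D `` {u} \<inter> A)" using 1 Z X by linarith
        show "T \<inter> A \<times> A \<subseteq> D" by (rule D)
      qed auto
      then show ?thesis by blast
    next
      case 2
      have "M - \<rho> w < M - \<rho> u" using 2 bounded[of w] by auto
      then have "(\<forall>x\<in>X - Z. (w, x) \<in> ?R\<^sup>*) \<or> (\<exists>w'. (w, w') \<in> ?R\<^sup>* \<and> S w')" using less.hyps 2 by blast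
      moreover have "(u, w) \<in> ?R" using 2 less.prems by blast
      ultimately show ?thesis by (meson converse_rtrancl_into_rtrancl)
    next
      case 3
      then show ?thesis by blast
    qed
  qed
  show ?thesis
  proof (cases "v \<in> A")
    case False
    then show ?thesis using climb v by blast
  next
    case True
    have "\<exists>u\<in>V - A - Z. (v, u) \<in> ?R\<^sup>*"
    proof (rule ccontr)
      assume no: "\<not> ?thesis"
      have stay: "(v, q) \<in> ?R\<^sup>* \<Longrightarrow> q \<in> V - Z \<Longrightarrow> q \<in> A" for q using no by blast
      have closed: "(v, w) \<in> ?R\<^sup>*" if q: "(v, q) \<in> ?R\<^sup>*" "(q, w) \<in> T \<inter> (V - Z) \<times> (V - Z)" for q w
      proof -
        have qA: "q \<in> A" using stay q by blast
        have "(q, w) \<in> D"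
        proof (cases "w \<in> A")
          case True
          then show ?thesis using D qA q by blast
        next
          case False
          have "\<not> k \<le> card (D `` {q} - A)"
          proof
            assume "k \<le> card (D `` {q} - A)"
            then have "\<not> D `` {q} - A \<subseteq> Z" using Z(2) card_mono[OF Z(1), of "D `` {q} - A"] by linarith
            then obtain u where "u \<in> D `` {q} - A" "u \<notin> Z" by blast
            moreover have "u \<in> V" using calculation D(1) tournament_subset[OF T] by blast
            ultimately have "(q, u) \<in> ?R" "u \<in> V - A - Z" using q by auto
            then show False using no q(1) by (meson rtrancl.rtrancl_into_rtrancl)
          qed
          then have "T `` {q} - A \<subseteq> D `` {q}" using exit qA by blast
          then show ?thesis using q False by blast
        qed
        then have "(q, w) \<in> ?R" using q(2) by blast
        then show ?thesis using q(1) by (rule rtrancl.rtrancl_into_rtrancl[rotated])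
      qed
      obtain w where w: "w \<in> V - A - Z" using A(2) by blast
      have "(v, w) \<in> (T \<inter> (V - Z) \<times> (V - Z))\<^sup>*" using conn v w by blast
      then have "(v, w) \<in> ?R\<^sup>*" by (induction rule: rtrancl_induct) (use closed in blast)+
      then show False using no w by blast
    qed
    then obtain u where u: "u \<in> V - A - Z" "(v, u) \<in> ?R\<^sup>*" by blast
    from climb[OF u(1)] show ?thesis
    proof
      assume "\<forall>x\<in>X - Z. (u, x) \<in> ?R\<^sup>*"
      then show ?thesis using u(2) by (meson rtrancl_trans)
    next
      assume "\<exists>w. (u, w) \<in> ?R\<^sup>* \<and> S w"
      then show ?thesis using u(2) by (meson rtrancl_trans)
    qed
  qed
qed

text \<open>The in-degree of \<open>b\<close> is at most that of every vertex outside
  \<open>B\<close>, hence at most their mean, which is bounded by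
  \<open>(card C - 1) / 2 + card B\<close> for \<open>C = V - B\<close>. The out-degree is the
  complement.\<close>

lemma high_out_degree:
  assumes T: "tournament V T" and B: "B \<subseteq> V" "card B < card V" and b: "b \<in> B"
    and low: "\<forall>b\<in>B. \<forall>v\<in>V - B. card (T\<inverse> `` {b}) \<le> card (T\<inverse> `` {v})"
  shows "card V \<le> 2 * card (T `` {b}) + card B + 1"
proof -
  note T' = tournament_converse[OF T]
  have fin: "finite V" "finite B" using tournament_finite[OF T] B finite_subset by auto
  define C where "C = V - B"
  define d where "d = card (T\<inverse> `` {b})"
  have cC: "card C + card B = card V"
    using card_Diff_subset[OF fin(2) B(1)] B by (simp add: C_def)
  have "(\<Sum>v\<in>C. d) \<le> (\<Sum>v\<in>C. card (T\<inverse> `` {v} \<inter> C) + card B)"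
  proof (intro sum_mono)
    fix v assume v: "v \<in> C"
    have "T\<inverse> `` {v} \<subseteq> T\<inverse> `` {v} \<inter> C \<union> B" using tournament_subset[OF T] by (auto simp: C_def)
    then have "card (T\<inverse> `` {v}) \<le> card (T\<inverse> `` {v} \<inter> C \<union> B)"
      using fin by (intro card_mono) (auto simp: C_def)
    also have "\<dots> \<le> card (T\<inverse> `` {v} \<inter> C) + card B" by (rule card_Un_le)
    finally have "card (T\<inverse> `` {v}) \<le> card (T\<inverse> `` {v} \<inter> C) + card B" .
    moreover have "d \<le> card (T\<inverse> `` {v})" using low b v unfolding d_def C_def by blast
    ultimately show "d \<le> card (T\<inverse> `` {v} \<inter> C) + card B" by linarith
  qed
  then have "card C * d \<le> (\<Sum>v\<in>C. card (T\<inverse> `` {v} \<inter> C)) + card C * card B"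
    by (simp add: sum.distrib)
  moreover have "2 * (\<Sum>v\<in>C. card (T\<inverse> `` {v} \<inter> C)) = card C * (card C - 1)"
    by (rule tournament_inner_sum[OF T']) (auto simp: C_def)
  ultimately have "2 * (card C * d) \<le> card C * (card C - 1) + 2 * (card C * card B)" by linarith
  then have "card C * (2 * d) \<le> card C * (card C - 1 + 2 * card B)" by (simp add: algebra_simps)
  moreover have "card C > 0" using cC B by linarith
  ultimately have "2 * d \<le> card C - 1 + 2 * card B" by simp
  moreover have "card (T `` {b}) + d = card V - 1"
  proof -
    have "T `` {b} \<inter> (V - {b}) = T `` {b}" "T\<inverse> `` {b} \<inter> (V - {b}) = T\<inverse> `` {b}"
      using tournament_subset[OF T] tournament_irrefl[OF T] by auto
    then show ?thesis using tournament_degree_sum[OF T, of b "V - {b}"] B b fin by (auto simp: d_def)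
  qed
  ultimately show ?thesis using cC \<open>card C > 0\<close> by linarith
qed

text \<open>If no path of length at most three from \<open>b\<close> to \<open>a\<close> avoids \<open>Y\<close>, the first and second
  out-neighbourhoods of \<open>b\<close> lie in the out-neighbourhood of \<open>a\<close>, although almost all of these
  vertices have out-degree at least that of \<open>a\<close>.\<close>

lemma exists_short_detour:
  assumes T: "tournament V T" and a: "a \<in> V" and b: "b \<in> V" and Y: "finite Y" and N: "finite N"
    and big: "\<And>u. u \<in> V - N \<Longrightarrow> card (T `` {a}) \<le> card (T `` {u})"
    and deg: "3 * card Y + card N < card (T `` {b})"
  obtains J K where "finite J" "card J \<le> 2" "J \<inter> Y = {}" "K \<subseteq> T" "card K \<le> 3"
    and "\<And>Z. Z \<inter> J = {} \<Longrightarrow> a \<notin> Z \<Longrightarrow> b \<notin> Z \<Longrightarrow> (b, a) \<in> (K \<inter> (V - Z) \<times> (V - Z))\<^sup>*"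
proof -
  have TV: "u \<in> V" "v \<in> V" if "(u, v) \<in> T" for u v using that tournament_subset[OF T] by auto
  consider "a = b" | "(b, a) \<in> T" | u where "u \<notin> Y" "(b, u) \<in> T" "(u, a) \<in> T"
    | u w where "u \<notin> Y" "w \<notin> Y" "(b, u) \<in> T" "(u, w) \<in> T" "(w, a) \<in> T"
    | (none) "a \<noteq> b" "(b, a) \<notin> T" "\<And>u. u \<notin> Y \<Longrightarrow> (b, u) \<in> T \<Longrightarrow> (u, a) \<notin> T"
      "\<And>u w. u \<notin> Y \<Longrightarrow> w \<notin> Y \<Longrightarrow> (b, u) \<in> T \<Longrightarrow> (u, w) \<in> T \<Longrightarrow> (w, a) \<notin> T"
    by blast
  then show ?thesis
  proof cases
    case 1
    show ?thesis by (rule that[of "{}" "{}"]) (use 1 in auto)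
  next
    case 2
    show ?thesis by (rule that[of "{}" "{(b, a)}"]) (use 2 TV in auto)
  next
    case 3
    show ?thesis
    proof (rule that[of "{u}" "{(b, u), (u, a)}"])
      fix Z assume "Z \<inter> {u} = {}" "a \<notin> Z" "b \<notin> Z"
      then have "(b, u) \<in> {(b, u), (u, a)} \<inter> (V - Z) \<times> (V - Z)"
        "(u, a) \<in> {(b, u), (u, a)} \<inter> (V - Z) \<times> (V - Z)" using 3 TV by auto
      then show "(b, a) \<in> ({(b, u), (u, a)} \<inter> (V - Z) \<times> (V - Z))\<^sup>*"
        by (meson converse_rtrancl_into_rtrancl rtrancl.rtrancl_refl)
    qed (use 3 in \<open>auto simp: card_insert_if\<close>)
  next
    case 4
    show ?thesis
    proof (rule that[of "{u, w}" "{(b, u), (u, w), (w, a)}"])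
      fix Z assume "Z \<inter> {u, w} = {}" "a \<notin> Z" "b \<notin> Z"
      then have "(b, u) \<in> {(b, u), (u, w), (w, a)} \<inter> (V - Z) \<times> (V - Z)"
        "(u, w) \<in> {(b, u), (u, w), (w, a)} \<inter> (V - Z) \<times> (V - Z)"
        "(w, a) \<in> {(b, u), (u, w), (w, a)} \<inter> (V - Z) \<times> (V - Z)" using 4 TV by auto
      then show "(b, a) \<in> ({(b, u), (u, w), (w, a)} \<inter> (V - Z) \<times> (V - Z))\<^sup>*"
        by (meson converse_rtrancl_into_rtrancl rtrancl.rtrancl_refl)
    qed (use 4 in \<open>auto simp: card_insert_if\<close>)
  next
    case none
    define M where "M = T `` {a}"
    \<comment> \<open>\<open>N\<close> contains the only vertices whose out-degree may be below that
      of \<open>a\<close>.\<close>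
    define Q where "Q = T `` {b} - Y - N"
    have fo: "finite (T `` {v})" for v using tournament_finite_out[OF T] .
    have fin: "finite M" "finite Q" using fo by (auto simp: M_def Q_def)
    have QM: "Q \<subseteq> M"
    proof
      fix u assume u: "u \<in> Q"
      then have "u \<noteq> a" "(u, a) \<notin> T" "u \<in> V" using none TV by (auto simp: Q_def)
      then show "u \<in> M" using tournament_total[OF T, of u a] a by (auto simp: M_def)
    qed
    have "card (T `` {b}) \<le> card (Q \<union> Y \<union> N)"
      using fin Y N by (intro card_mono) (auto simp: Q_def)
    also have "\<dots> \<le> card Q + card Y + card N" by (meson card_Un_le add_le_mono le_refl order_trans)
    finally have cQ: "2 * card Y < card Q" using deg by linarith
    then have "Q \<noteq> {}" by auto
    moreover have "Q \<subseteq> V" using TV by (auto simp: Q_def)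
    ultimately obtain u where u: "u \<in> Q" "2 * card (T `` {u} \<inter> Q) + 1 \<le> card Q"
      using tournament_low_vertex[OF T] by blast
    \<comment> \<open>As \<open>u\<close> dominates less than half of \<open>Q\<close>, this gives
      it out-degree at most \<open>card Y + (card Q - 1) / 2 + card M - card Q\<close>, less than
      \<open>card M\<close> because \<open>card Q\<close> exceeds \<open>2 * card Y\<close>.\<close>
    have "T `` {u} \<subseteq> Y \<union> (T `` {u} \<inter> Q) \<union> (M - Q)"
    proof
      fix w assume w: "w \<in> T `` {u}"
      show "w \<in> Y \<union> (T `` {u} \<inter> Q) \<union> (M - Q)"
      proof (cases "w \<in> Y")
        case False
        have "(w, a) \<notin> T" using none(4)[of u w] w u False by (auto simp: Q_def)
        moreover have "w \<noteq> a" using none(3)[of u] w u by (auto simp: Q_def)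
        ultimately have "w \<in> M" using tournament_total[OF T, of w a] a w TV by (auto simp: M_def)
        then show ?thesis using w by blast
      qed simp
    qed
    then have "card (T `` {u}) \<le> card (Y \<union> (T `` {u} \<inter> Q) \<union> (M - Q))"
      using Y fin by (intro card_mono) auto
    also have "\<dots> \<le> card Y + card (T `` {u} \<inter> Q) + card (M - Q)"
      by (meson card_Un_le add_le_mono le_refl order_trans)
    also have "card (M - Q) = card M - card Q" using QM fin card_Diff_subset by blast
    finally have "card (T `` {u}) \<le> card Y + card (T `` {u} \<inter> Q) + (card M - card Q)" .
    moreover have "card M \<le> card (T `` {u})" using big[of u] u \<open>Q \<subseteq> V\<close> by (auto simp: M_def Q_def)
    moreover have "card Q \<le> card M" using QM fin card_mono by blast
    ultimately have False using u cQ by linarith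
    then show ?thesis ..
  qed
qed

text \<open>Each new detour avoids the inner vertices of the earlier ones, at most two for each of
  at most \<open>k - 1\<close> detours. If \<open>Z\<close> hits the newest detour, it has one
  vertex fewer for the others.\<close>

lemma exists_many_detours:
  assumes step: "\<And>Y. finite Y \<Longrightarrow> card Y \<le> 2 * (k - 1) \<Longrightarrow>
      \<exists>J K. finite J \<and> card J \<le> 2 \<and> J \<inter> Y = {} \<and> K \<subseteq> T \<and> card K \<le> 3 \<and>
        (\<forall>Z. Z \<inter> J = {} \<longrightarrow> a \<notin> Z \<longrightarrow> b \<notin> Z \<longrightarrow> (b, a) \<in> (K \<inter> (V - Z) \<times> (V - Z))\<^sup>*)"
  shows "m \<le> k \<Longrightarrow> \<exists>J K. finite J \<and> card J \<le> 2 * m \<and> K \<subseteq> T \<and> card K \<le> 3 * m \<and>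
        (\<forall>Z. card (Z \<inter> J) < m \<longrightarrow> a \<notin> Z \<longrightarrow> b \<notin> Z \<longrightarrow> (b, a) \<in> (K \<inter> (V - Z) \<times> (V - Z))\<^sup>*)"
proof (induction m)
  case 0
  show ?case by (intro exI[of _ "{}"]) auto
next
  case (Suc m)
  then obtain J K where J: "finite J" "card J \<le> 2 * m" "K \<subseteq> T" "card K \<le> 3 * m"
    and old: "\<And>Z. card (Z \<inter> J) < m \<Longrightarrow> a \<notin> Z \<Longrightarrow> b \<notin> Z \<Longrightarrow> (b, a) \<in> (K \<inter> (V - Z) \<times> (V - Z))\<^sup>*"
    by force
  have "card J \<le> 2 * (k - 1)" using J Suc.prems by linarith
  from step[OF J(1) this] obtain J' K'
    where J': "finite J'" "card J' \<le> 2" "J' \<inter> J = {}" "K' \<subseteq> T" "card K' \<le> 3"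
    and new: "\<And>Z. Z \<inter> J' = {} \<Longrightarrow> a \<notin> Z \<Longrightarrow> b \<notin> Z \<Longrightarrow> (b, a) \<in> (K' \<inter> (V - Z) \<times> (V - Z))\<^sup>*" by blast
  show ?case
  proof (intro exI conjI allI impI)
    show "finite (J \<union> J')" "K \<union> K' \<subseteq> T" using J J' by auto
    show "card (J \<union> J') \<le> 2 * Suc m" "card (K \<union> K') \<le> 3 * Suc m"
      using card_Un_le[of J J'] card_Un_le[of K K'] J(2,4) J'(2,5) by simp_all
    fix Z assume Z: "card (Z \<inter> (J \<union> J')) < Suc m" "a \<notin> Z" "b \<notin> Z"
    have sub: "K \<inter> (V - Z) \<times> (V - Z) \<subseteq> (K \<union> K') \<inter> (V - Z) \<times> (V - Z)"
      "K' \<inter> (V - Z) \<times> (V - Z) \<subseteq> (K \<union> K') \<inter> (V - Z) \<times> (V - Z)" by auto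
    show "(b, a) \<in> ((K \<union> K') \<inter> (V - Z) \<times> (V - Z))\<^sup>*"
    proof (cases "Z \<inter> J' = {}")
      case True
      then show ?thesis using new[OF True Z(2,3)] rtrancl_mono[OF sub(2)] by blast
    next
      case False
      then have "Z \<inter> J \<subset> Z \<inter> (J \<union> J')" using J'(3) by blast
      moreover have "finite (Z \<inter> (J \<union> J'))" using J J' by simp
      ultimately have "card (Z \<inter> J) < card (Z \<inter> (J \<union> J'))" by (rule psubset_card_mono[rotated])
      then have "card (Z \<inter> J) < m" using Z by linarith
      then show ?thesis using old[OF _ Z(2,3)] rtrancl_mono[OF sub(1)] by blast
    qed
  qed
qed

text \<open>The ends need \<open>k + 1\<close> neighbours inside \<open>A\<close> and
  \<open>B\<close> because this is what \<open>dominated_reach\<close> requires when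
  \<open>Z\<close> misses these sets.\<close>

lemma exists_bridge:
  assumes T: "tournament V T" and k: "k \<ge> 1" and n: "39 * k < card V"
    and A: "A \<subseteq> V" "card A = 12 * k" "\<forall>a\<in>A. \<forall>v\<in>V - A. card (T `` {a}) \<le> card (T `` {v})"
    and B: "B \<subseteq> V" "card B = 12 * k" "\<forall>b\<in>B. \<forall>v\<in>V - B. card (T\<inverse> `` {b}) \<le> card (T\<inverse> `` {v})"
  obtains a b K where "a \<in> A" "k + 1 \<le> card (T `` {a} \<inter> A)" "b \<in> B" "k + 1 \<le> card (T\<inverse> `` {b} \<inter> B)"
    and "K \<subseteq> T" "card K \<le> 3 * k"
    and "\<And>Z. finite Z \<Longrightarrow> card Z < k \<Longrightarrow> a \<notin> Z \<Longrightarrow> b \<notin> Z \<Longrightarrow> (b, a) \<in> (K \<inter> (V - Z) \<times> (V - Z))\<^sup>*"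
proof -
  have fin: "finite A" "finite B"
    using finite_subset[OF A(1)] finite_subset[OF B(1)] tournament_finite[OF T] by auto
  define NA where "NA = {a \<in> A. card (T `` {a} \<inter> A) \<le> k}"
  define NB where "NB = {b \<in> B. card (T\<inverse> `` {b} \<inter> B) \<le> k}"
  have cN: "card NA \<le> 2 * k + 1" "card NB \<le> 2 * k + 1" unfolding NA_def NB_def
    using tournament_few_low[OF T A(1)] tournament_few_low[OF tournament_converse[OF T] B(1)] by blast+
  have finN: "finite NA" "finite NB" using fin by (auto simp: NA_def NB_def)
  have "\<not> A \<subseteq> NA" "\<not> B \<subseteq> NB" using card_mono[OF finN(1), of A] card_mono[OF finN(2), of B] cN A B k by linarith+
  then have ne: "A - NA \<noteq> {}" and "B - NB \<noteq> {}" by auto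
  then obtain b where b: "b \<in> B" "b \<notin> NB" by blast
  \<comment> \<open>By the choice of \<open>A\<close>, vertices outside \<open>A\<close> have no
    smaller out-degree; so only the at most \<open>2 k + 1\<close> vertices of \<open>NA\<close> can
    fall below \<open>a\<close>.\<close>
  obtain a where a: "a \<in> A - NA" and amin: "\<And>u. u \<in> A - NA \<Longrightarrow> card (T `` {a}) \<le> card (T `` {u})"
    using arg_min_if_finite[of "A - NA" "\<lambda>v. card (T `` {v})"] fin ne by (metis finite_Diff not_le)
  \<comment> \<open>More than \<open>39 k\<close> vertices give \<open>b\<close> out-degree at least
    \<open>27 k / 2\<close>, whereas the detours need more than
    \<open>6 (k - 1) + 2 k + 1\<close>.\<close>
  have "card V \<le> 2 * card (T `` {b}) + card B + 1"
    using n B k b by (intro high_out_degree[OF T]) auto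
  then have db: "27 * k \<le> 2 * card (T `` {b})" using n B by linarith
  have "\<exists>J K. finite J \<and> card J \<le> 2 \<and> J \<inter> Y = {} \<and> K \<subseteq> T \<and> card K \<le> 3 \<and>
        (\<forall>Z. Z \<inter> J = {} \<longrightarrow> a \<notin> Z \<longrightarrow> b \<notin> Z \<longrightarrow> (b, a) \<in> (K \<inter> (V - Z) \<times> (V - Z))\<^sup>*)"
    if Y: "finite Y" "card Y \<le> 2 * (k - 1)" for Y
  proof (rule exists_short_detour[OF T _ _ Y(1) finN(1), of a b])
    show "a \<in> V" "b \<in> V" using a b A B by auto
    show "card (T `` {a}) \<le> card (T `` {u})" if "u \<in> V - NA" for u
      using that a amin A(3) by (cases "u \<in> A") auto
    show "3 * card Y + card NA < card (T `` {b})" using Y cN db k by linarith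
  qed blast
  from exists_many_detours[of k T a b V k, OF this order_refl]
  obtain J K where J: "finite J" "K \<subseteq> T" "card K \<le> 3 * k"
    and reach: "\<And>Z. card (Z \<inter> J) < k \<Longrightarrow> a \<notin> Z \<Longrightarrow> b \<notin> Z \<Longrightarrow> (b, a) \<in> (K \<inter> (V - Z) \<times> (V - Z))\<^sup>*" by blast
  show ?thesis
  proof (rule that[OF _ _ _ _ J(2,3)])
    show "a \<in> A" "b \<in> B" "k + 1 \<le> card (T `` {a} \<inter> A)" "k + 1 \<le> card (T\<inverse> `` {b} \<inter> B)"
      using a b by (auto simp: NA_def NB_def)
    fix Z assume Z: "finite Z" "card Z < k" "a \<notin> Z" "b \<notin> Z"
    have "card (Z \<inter> J) \<le> card Z" using Z by (intro card_mono) auto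
    then show "(b, a) \<in> (K \<inter> (V - Z) \<times> (V - Z))\<^sup>*" using Z by (intro reach) auto
  qed
qed

text \<open>The potential orders vertices by class first and by rank second. Exceptional vertices
  rise in class; a vertex of \<open>I\<close> has \<open>k\<close> forward arcs, one of which
  survives; a vertex of \<open>N\<close> has only \<open>k - 1\<close> and may be blocked.\<close>

lemma climb_step:
  fixes \<alpha> r :: "'a \<Rightarrow> nat"
  assumes Z: "finite Z" "card Z < k" and D: "finite D" "S \<subseteq> D" "H \<subseteq> D" "G \<subseteq> D"
    and S: "\<And>v. v \<in> E \<Longrightarrow> 4 * k \<le> card (S `` {v} \<inter> A) \<or> k \<le> card (S `` {v} \<inter> {w \<in> V - A. \<alpha> v < \<alpha> w})"
    and H: "H \<subseteq> I \<times> I" "\<And>u v. (u, v) \<in> H \<Longrightarrow> \<alpha> u = \<alpha> v \<and> r u < r v"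
      "\<And>v. v \<in> I - E \<Longrightarrow> k \<le> card (H `` {v})"
    and G: "G \<subseteq> N \<times> N" "\<And>u v. (u, v) \<in> G \<Longrightarrow> \<alpha> u = \<alpha> v \<and> r u < r v"
      "\<And>v. v \<in> N - E \<Longrightarrow> k - 1 \<le> card (G `` {v})"
    and W: "I \<subseteq> V - A" "N \<subseteq> V - A" "V - A \<subseteq> I \<union> N \<union> E" and r: "\<And>v. r v \<le> n"
    and v: "v \<in> V - A - Z"
  shows "4 * k \<le> card (D `` {v} \<inter> A)
    \<or> (\<exists>w\<in>V - A - Z. (v, w) \<in> D \<and> \<alpha> v * (n + 1) + r v < \<alpha> w * (n + 1) + r w)
    \<or> (v \<in> N - Z \<and> Z \<subseteq> G `` {v})"
proof -
  have finF: "finite H" "finite G" "finite S" using D finite_subset by blast+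
  have survive: "\<exists>w\<in>M. w \<notin> Z" if "k \<le> card M" for M
  proof (rule ccontr)
    assume "\<not> ?thesis"
    then have "card M \<le> card Z" using Z by (intro card_mono) auto
    then show False using that Z by linarith
  qed
  show ?thesis
  proof (cases "v \<in> E")
    case True
    from S[OF True] show ?thesis
    proof
      assume "4 * k \<le> card (S `` {v} \<inter> A)"
      moreover have "card (S `` {v} \<inter> A) \<le> card (D `` {v} \<inter> A)"
        using D by (intro card_mono finite_Int disjI1 finite_Image) auto
      ultimately show ?thesis by linarith
    next
      assume "k \<le> card (S `` {v} \<inter> {w \<in> V - A. \<alpha> v < \<alpha> w})"
      from survive[OF this] obtain w where w: "w \<in> S `` {v}" "w \<in> V - A - Z" "\<alpha> v < \<alpha> w" by blast
      \<comment> \<open>The weight \<open>n + 1\<close> exceeds every rank, so a gain in class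
        outweighs any loss in rank.\<close>
      have "Suc (\<alpha> v) * (n + 1) \<le> \<alpha> w * (n + 1)" using w by (intro mult_le_mono1) simp
      then have "\<alpha> v * (n + 1) + r v < \<alpha> w * (n + 1) + r w" using r[of v] by simp
      then show ?thesis using w D by blast
    qed
  next
    case False
    then have "v \<in> I - E \<or> v \<in> N - E" using v W by blast
    then show ?thesis
    proof
      assume vW: "v \<in> I - E"
      from survive[OF H(3)[OF vW]] obtain w where w: "(v, w) \<in> H" "w \<notin> Z" by blast
      then have "w \<in> V - A - Z" "(v, w) \<in> D" using H(1) W(1) D by auto
      moreover have "\<alpha> v * (n + 1) + r v < \<alpha> w * (n + 1) + r w" using H(2)[OF w(1)] by simp
      ultimately show ?thesis by blast
    next
      assume vW: "v \<in> N - E"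
      show ?thesis
      proof (cases "G `` {v} \<subseteq> Z")
        case True
        \<comment> \<open>At least \<open>k - 1\<close> out-neighbours inside a set of at most
          \<open>k - 1\<close> vertices must be all of \<open>Z\<close>.\<close>
        have "card Z \<le> card (G `` {v})" using G(3)[OF vW] Z by linarith
        then have "G `` {v} = Z" using True Z card_seteq by blast
        then show ?thesis using vW v by blast
      next
        case False
        then obtain w where w: "(v, w) \<in> G" "w \<notin> Z" by blast
        then have "w \<in> V - A - Z" "(v, w) \<in> D" using G(1) W(2) D by auto
        moreover have "\<alpha> v * (n + 1) + r v < \<alpha> w * (n + 1) + r w" using G(2)[OF w(1)] by simp
        ultimately show ?thesis by blast
      qed
    qed
  qed
qed

text \<open>The factor 39 is the largest for which this estimate works:
  \<open>37 * 39 = 1443\<close> is at most \<open>2 * 750\<close>, but \<open>38 * 40 = 1520\<close>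
  is not.\<close>

lemma small_tournament_arcs:
  assumes T: "tournament V T" and n: "card V \<le> 39 * k"
  shows "card T \<le> k * card V + 750 * k\<^sup>2"
proof -
  have "T \<inter> V \<times> V = T" using tournament_subset[OF T] by blast
  then have "2 * card T = card V * (card V - 1)" using tournament_inner_card[OF T order_refl] by simp
  also have "\<dots> \<le> card V * (39 * k)" using n by (intro mult_le_mono2) simp
  also have "\<dots> = 2 * (k * card V) + (37 * k) * card V" by (simp add: algebra_simps)
  also have "(37 * k) * card V \<le> (37 * k) * (39 * k)" using n by (intro mult_le_mono2)
  finally show ?thesis by (simp add: power2_eq_square)
qed

lemma converse_rtrancl_restrict:
  "(u, v) \<in> (D\<inverse> \<inter> W \<times> W)\<^sup>* \<longleftrightarrow> (v, u) \<in> (D \<inter> W \<times> W)\<^sup>*"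
proof -
  have "D\<inverse> \<inter> W \<times> W = (D \<inter> W \<times> W)\<inverse>" by auto
  then show ?thesis by (simp add: rtrancl_converse)
qed

lemma large_tournament_sparse_spanning:
  assumes T: "tournament V T" and k: "k \<ge> 1" and conn: "strongly_k_connected k V T"
    and n: "39 * k < card V"
  shows "\<exists>D\<subseteq>T. strongly_k_connected k V D \<and> card D \<le> k * card V + 750 * k\<^sup>2"
proof -
  note T' = tournament_converse[OF T]
  have finV: "finite V" and finT: "finite T"
    using tournament_finite[OF T] tournament_finite_arcs[OF T] by auto

  \<comment> \<open>Extremal sets, classes and linkage\<close>
  obtain A where A: "A \<subseteq> V" "card A = 12 * k" "\<forall>a\<in>A. \<forall>v\<in>V - A. card (T `` {a}) \<le> card (T `` {v})"
    using exists_lowest_subset[OF finV, of "12 * k" "\<lambda>v. card (T `` {v})"] n by auto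
  obtain B where B: "B \<subseteq> V" "card B = 12 * k" "\<forall>b\<in>B. \<forall>v\<in>V - B. card (T\<inverse> `` {b}) \<le> card (T\<inverse> `` {v})"
    using exists_lowest_subset[OF finV, of "12 * k" "\<lambda>v. card (T\<inverse> `` {v})"] n by auto
  have finA: "finite A" and finB: "finite B"
    using finite_subset[OF A(1) finV] finite_subset[OF B(1) finV] by auto
  obtain X where X: "X \<subseteq> A" "card X = k" "\<forall>x\<in>X. \<forall>u\<in>A - X. card (T `` {x} \<inter> A) \<le> card (T `` {u} \<inter> A)"
    using exists_lowest_subset[OF finA, of k "\<lambda>v. card (T `` {v} \<inter> A)"] A by auto
  obtain Y where Y: "Y \<subseteq> B" "card Y = k" "\<forall>x\<in>Y. \<forall>u\<in>B - Y. card (T\<inverse> `` {x} \<inter> B) \<le> card (T\<inverse> `` {u} \<inter> B)"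
    using exists_lowest_subset[OF finB, of k "\<lambda>v. card (T\<inverse> `` {v} \<inter> B)"] B by auto
  obtain \<alpha> :: "'a \<Rightarrow> nat" where \<alpha>: "\<And>v. \<alpha> v < 3"
    "\<And>v. v \<in> V - A \<Longrightarrow> \<alpha> v = 2 \<Longrightarrow> 4 * k \<le> card (T `` {v} \<inter> A)"
    "\<And>v. v \<in> V - A \<Longrightarrow> \<alpha> v < 2 \<Longrightarrow> k \<le> card (T `` {v} \<inter> {w \<in> V - A. \<alpha> w = Suc (\<alpha> v)})"
    using exists_dominated_classes[OF T A(1,2) k A(3)] by blast
  obtain \<beta> :: "'a \<Rightarrow> nat" where \<beta>: "\<And>v. \<beta> v < 3"
    "\<And>v. v \<in> V - B \<Longrightarrow> \<beta> v = 2 \<Longrightarrow> 4 * k \<le> card (T\<inverse> `` {v} \<inter> B)"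
    "\<And>v. v \<in> V - B \<Longrightarrow> \<beta> v < 2 \<Longrightarrow> k \<le> card (T\<inverse> `` {v} \<inter> {w \<in> V - B. \<beta> w = Suc (\<beta> v)})"
    using exists_dominated_classes[OF T' B(1,2) k B(3)] by blast
  obtain L U where L: "L \<subseteq> T" "U \<subseteq> V" "card L + k \<le> card U"
    "\<And>v. card (L `` {v}) \<le> 1" "\<And>v. card (L\<inverse> `` {v}) \<le> 1"
    and link: "\<And>Z. finite Z \<Longrightarrow> card Z < k \<Longrightarrow> \<exists>x\<in>X - Z. \<exists>y\<in>Y - Z. (x, y) \<in> (L \<inter> (V - Z) \<times> (V - Z))\<^sup>*"
    and follow: "\<And>v Z. v \<in> U - Z \<Longrightarrow> Z \<subseteq> T `` {v} - L `` {v} \<Longrightarrow> \<exists>y\<in>Y - Z. (v, y) \<in> (L \<inter> (V - Z) \<times> (V - Z))\<^sup>*"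
    and follow': "\<And>v Z. v \<in> U - Z \<Longrightarrow> Z \<subseteq> T\<inverse> `` {v} - L\<inverse> `` {v} \<Longrightarrow> \<exists>x\<in>X - Z. (x, v) \<in> (L \<inter> (V - Z) \<times> (V - Z))\<^sup>*"
  proof (rule exists_linking_arcs[OF T conn _ X(2) _ Y(2)])
    show "X \<subseteq> V" "Y \<subseteq> V" using X Y A B by auto
  qed blast
  have finL: "finite L" using finite_subset[OF L(1) finT] .
  \<comment> \<open>Forward arcs run only outside \<open>A \<union> B\<close>, and separately off
    the paths (\<open>W1\<close>) and on them (\<open>W2\<close>). Hence a set \<open>Z\<close> that
    blocks a vertex of \<open>W2\<close> lies in \<open>W2\<close> and misses
    \<open>A \<union> B\<close>.\<close>
  define W1 where "W1 = V - A - B - U"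
  define W2 where "W2 = (V - A - B) \<inter> U"
  have W: "W1 \<subseteq> V" "W2 \<subseteq> V" by (auto simp: W1_def W2_def)
  define C :: "(nat \<times> nat) set" where "C = {..<3} \<times> {..<3}"
  have C: "(\<lambda>v. (\<alpha> v, \<beta> v)) ` M \<subseteq> C" "finite C" "card C = 9" for M using \<alpha>(1) \<beta>(1) by (auto simp: C_def)
  obtain F1 r1 E1 E1' where F1: "F1 \<subseteq> T \<inter> W1 \<times> W1"
    "\<forall>(u, v)\<in>F1. (\<alpha> u, \<beta> u) = (\<alpha> v, \<beta> v) \<and> r1 u < (r1 v :: nat)" "\<forall>v\<in>W1. r1 v < card V"
    "E1 \<subseteq> W1" "E1' \<subseteq> W1" "card E1 \<le> 9 * (2 * k + 1)" "card E1' \<le> 9 * (2 * k + 1)"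
    "\<forall>v\<in>W1 - E1. k \<le> card (F1 `` {v})" "\<forall>v\<in>W1 - E1'. k \<le> card (F1\<inverse> `` {v})"
    "card F1 \<le> k * card W1 + 9 * (k * (2 * k + 1))"
    using coloured_degree_arcs[OF T W(1), of "{}" "\<lambda>v. (\<alpha> v, \<beta> v)" C k] C by (auto simp del: Pair_inject)
  \<comment> \<open>\<open>F2\<close> is chosen outside \<open>L\<close> so that a \<open>Z\<close>
    consisting of \<open>F2\<close>-neighbours of a vertex avoids its neighbours on the path, as
    \<open>follow\<close> and \<open>follow'\<close> require.\<close>
  obtain F2 r2 E2 E2' where F2: "F2 \<subseteq> T \<inter> W2 \<times> W2 - L"
    "\<forall>(u, v)\<in>F2. (\<alpha> u, \<beta> u) = (\<alpha> v, \<beta> v) \<and> r2 u < (r2 v :: nat)" "\<forall>v\<in>W2. r2 v < card V"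
    "E2 \<subseteq> W2" "E2' \<subseteq> W2" "card E2 \<le> 9 * (2 * (k - 1) + 1)" "card E2' \<le> 9 * (2 * (k - 1) + 1)"
    "\<forall>v\<in>W2 - E2. k - 1 \<le> card (F2 `` {v})" "\<forall>v\<in>W2 - E2'. k - 1 \<le> card (F2\<inverse> `` {v})"
    "card F2 \<le> (k - 1) * card W2 + 9 * ((k - 1) * (2 * (k - 1) + 1))"
    using coloured_degree_arcs[OF T W(2) finL L(4,5), of "\<lambda>v. (\<alpha> v, \<beta> v)" C "k - 1"] C
    by (auto simp del: Pair_inject)
  \<comment> \<open>Vertices of \<open>B - A\<close> have no forward arcs, so the climb to
    \<open>A\<close> treats them as exceptional.\<close>
  define E where "E = (B - A) \<union> E1 \<union> E2"
  define E' where "E' = (A - B) \<union> E1' \<union> E2'"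
  have EV: "E \<subseteq> V - A" "E' \<subseteq> V - B"
    using F1(4,5) F2(4,5) A(1) B(1) by (auto simp: E_def E'_def W1_def W2_def)
  have finE: "finite E" "finite E'" using finite_subset[OF EV(1)] finite_subset[OF EV(2)] finV by auto
  have cE: "card E \<le> 48 * k" "card E' \<le> 48 * k"
  proof -
    have "card E \<le> card (B - A) + card E1 + card E2" "card E' \<le> card (A - B) + card E1' + card E2'"
      unfolding E_def E'_def by (meson card_Un_le add_le_mono le_refl order_trans)+
    moreover have "card (B - A) \<le> card B" "card (A - B) \<le> card A"
      using finA finB by (auto intro: card_mono)
    moreover have "9 * (2 * k + 1) + 9 * (2 * (k - 1) + 1) = 36 * k" using k by (simp add: algebra_simps)
    ultimately have "card E \<le> 48 * k \<and> card E' \<le> 48 * k"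
      using F1(6,7) F2(6,7) A(2) B(2) by linarith
    then show "card E \<le> 48 * k" "card E' \<le> 48 * k" by simp_all
  qed

  \<comment> \<open>Arcs for exceptional vertices, exits and the bridge\<close>
  obtain S where S: "S \<subseteq> T" "card S \<le> 4 * k * card E"
    "\<And>v. v \<in> E \<Longrightarrow> 4 * k \<le> card (S `` {v} \<inter> A) \<or> k \<le> card (S `` {v} \<inter> {w \<in> V - A. \<alpha> v < \<alpha> w})"
    using exists_class_arcs[OF T finE(1) EV(1) \<alpha>] by blast
  obtain S' where S': "S' \<subseteq> T\<inverse>" "card S' \<le> 4 * k * card E'"
    "\<And>v. v \<in> E' \<Longrightarrow> 4 * k \<le> card (S' `` {v} \<inter> B) \<or> k \<le> card (S' `` {v} \<inter> {w \<in> V - B. \<beta> v < \<beta> w})"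
    using exists_class_arcs[OF T' finE(2) EV(2) \<beta>] by blast
  obtain O1 where O1: "O1 \<subseteq> T" "card O1 \<le> k * card A"
    "\<And>a. a \<in> A \<Longrightarrow> k \<le> card (O1 `` {a} - A) \<or> T `` {a} - A \<subseteq> O1 `` {a}"
    using exists_exit_arcs[OF T finA] by blast
  obtain O2 where O2: "O2 \<subseteq> T\<inverse>" "card O2 \<le> k * card B"
    "\<And>a. a \<in> B \<Longrightarrow> k \<le> card (O2 `` {a} - B) \<or> T\<inverse> `` {a} - B \<subseteq> O2 `` {a}"
    using exists_exit_arcs[OF T' finB] by blast
  obtain a b K where a: "a \<in> A" "k + 1 \<le> card (T `` {a} \<inter> A)"
    and b: "b \<in> B" "k + 1 \<le> card (T\<inverse> `` {b} \<inter> B)" and K: "K \<subseteq> T" "card K \<le> 3 * k"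
    and bridge: "\<And>Z. finite Z \<Longrightarrow> card Z < k \<Longrightarrow> a \<notin> Z \<Longrightarrow> b \<notin> Z \<Longrightarrow> (b, a) \<in> (K \<inter> (V - Z) \<times> (V - Z))\<^sup>*"
    using exists_bridge[OF T k n A B] by blast
  define D where "D = (T \<inter> A \<times> A) \<union> (T \<inter> B \<times> B) \<union> (L \<union> F1 \<union> F2) \<union> (S \<union> S'\<inverse>) \<union> (O1 \<union> O2\<inverse>) \<union> K"
  have DT: "D \<subseteq> T"
    using L(1) F1(1) F2(1) S(1) S'(1) O1(1) O2(1) K(1) by (auto simp: D_def)
  have finD: "finite D" "finite (D\<inverse>)" using finite_subset[OF DT finT] by auto

  \<comment> \<open>Number of arcs\<close>
  have cD: "card D \<le> k * card V + 750 * k\<^sup>2"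
  proof -
    have "card D \<le> card (T \<inter> A \<times> A) + card (T \<inter> B \<times> B) + (card L + card F1 + card F2)
        + (card S + card (S'\<inverse>)) + (card O1 + card (O2\<inverse>)) + card K"
      unfolding D_def by (intro order_trans[OF card_Un_le] add_le_mono order_refl)
    moreover have "card (T \<inter> A \<times> A) \<le> 72 * k\<^sup>2" "card (T \<inter> B \<times> B) \<le> 72 * k\<^sup>2"
    proof -
      have "12 * k * (12 * k - 1) \<le> 12 * k * (12 * k)" by (intro mult_le_mono2) simp
      also have "\<dots> = 144 * k\<^sup>2" by (simp add: power2_eq_square)
      finally have "12 * k * (12 * k - 1) \<le> 144 * k\<^sup>2" .
      then show "card (T \<inter> A \<times> A) \<le> 72 * k\<^sup>2" "card (T \<inter> B \<times> B) \<le> 72 * k\<^sup>2"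
        using tournament_inner_card[OF T A(1)] tournament_inner_card[OF T B(1)] A(2) B(2) by simp_all
    qed
    moreover have "card S \<le> 192 * k\<^sup>2" "card (S'\<inverse>) \<le> 192 * k\<^sup>2"
    proof -
      have "4 * k * card M \<le> 192 * k\<^sup>2" if "card M \<le> 48 * k" for M :: "'a set"
      proof -
        have "4 * k * card M \<le> 4 * k * (48 * k)" using that by (rule mult_le_mono2)
        then show ?thesis by (simp add: power2_eq_square)
      qed
      then show "card S \<le> 192 * k\<^sup>2" "card (S'\<inverse>) \<le> 192 * k\<^sup>2"
        using S(2) S'(2) cE by (force simp: card_inverse)+
    qed
    moreover have "card O1 \<le> 12 * k\<^sup>2" "card (O2\<inverse>) \<le> 12 * k\<^sup>2"
      using O1(2) O2(2) A(2) B(2) by (simp_all add: power2_eq_square card_inverse)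
    moreover have "card K \<le> 3 * k\<^sup>2" using K(2) k by (simp add: power2_eq_square) (meson le_trans mult_le_mono2 le_square)
    \<comment> \<open>The arcs of \<open>L\<close> are charged to vertices of \<open>U\<close>, one
      each. A vertex of \<open>W2\<close> then pays \<open>k - 1\<close> forward arcs and one path
      arc, and a vertex of \<open>A \<union> B\<close> pays at most one.\<close>
    moreover have "card L + card F1 + card F2 \<le> k * card V + 36 * k\<^sup>2"
    proof -
      obtain j where j: "k = Suc j" using k by (cases k) auto
      have "U \<subseteq> W2 \<union> (A \<union> B)" using L(2) by (auto simp: W2_def)
      then have "card U \<le> card (W2 \<union> (A \<union> B))"
        using finite_subset[OF W(2) finV] finA finB by (intro card_mono) auto
      then have 1: "card U \<le> card W2 + card (A \<union> B)" using card_Un_le[of W2 "A \<union> B"] by linarith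
      have "V = W1 \<union> W2 \<union> (A \<union> B)" using A(1) B(1) by (auto simp: W1_def W2_def)
      moreover have "card (W1 \<union> W2 \<union> (A \<union> B)) = card W1 + card W2 + card (A \<union> B)"
      proof -
        have f: "finite W1" "finite W2" "finite (A \<union> B)"
          using finite_subset[OF W(1) finV] finite_subset[OF W(2) finV] finA finB by auto
        have "W1 \<inter> W2 = {}" "(W1 \<union> W2) \<inter> (A \<union> B) = {}" by (auto simp: W1_def W2_def)
        then show ?thesis using f by (simp add: card_Un_disjoint)
      qed
      ultimately have 2: "card V = card W1 + card W2 + card (A \<union> B)" by simp
      have "card L + card F1 + card F2 \<le> card W2 + card (A \<union> B) + (k * card W1 + 9 * (k * (2 * k + 1)))
          + (j * card W2 + 9 * (j * (2 * j + 1)))"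
        using 1 L(3) F1(10) F2(10) by (simp add: j)
      also have "\<dots> \<le> k * card W1 + k * card W2 + k * card (A \<union> B) + (9 * (k * (2 * k + 1)) + 9 * (j * (2 * j + 1)))"
        by (simp add: j algebra_simps)
      also have "9 * (k * (2 * k + 1)) + 9 * (j * (2 * j + 1)) \<le> 36 * k\<^sup>2"
        by (simp add: j power2_eq_square algebra_simps)
      finally show ?thesis unfolding 2 by (simp add: algebra_simps)
    qed
    ultimately show ?thesis by linarith
  qed
  \<comment> \<open>No forward arc joins \<open>W1\<close> to \<open>W2\<close>, so the two ranks
    need not be compatible; the value 0 elsewhere only has to respect the bound
    \<open>card V\<close>.\<close>
  define r where "r v = (if v \<in> W1 then r1 v else if v \<in> W2 then r2 v else 0)" for v
  have rV: "r v \<le> card V" for v using F1(3) F2(3) by (auto simp: r_def less_imp_le)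
  have W12: "W1 \<inter> W2 = {}" by (auto simp: W1_def W2_def)
  have rF1: "\<alpha> u = \<alpha> v \<and> \<beta> u = \<beta> v \<and> r u < r v" if "(u, v) \<in> F1" for u v
    using that F1(1,2) by (auto simp: r_def)
  have rF2: "\<alpha> u = \<alpha> v \<and> \<beta> u = \<beta> v \<and> r u < r v" if "(u, v) \<in> F2" for u v
  proof -
    have "u \<in> W2" "v \<in> W2" using that F2(1) by auto
    then have "u \<notin> W1" "v \<notin> W1" using W12 by auto
    then show ?thesis using that F2(2) \<open>u \<in> W2\<close> \<open>v \<in> W2\<close> by (auto simp: r_def)
  qed

  \<comment> \<open>Strong connectivity after deleting \<open>Z\<close>\<close>
  have "strongly_k_connected k V D"
    unfolding strongly_k_connected_def
  proof (intro conjI allI impI)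
    show "k + 1 \<le> card V" using n k by linarith
    fix Z assume "Z \<subseteq> V \<and> card Z \<le> k - 1"
    then have Z: "Z \<subseteq> V" "finite Z" "card Z < k" using finite_subset finV k by auto
    let ?R = "D \<inter> (V - Z) \<times> (V - Z)"
    have mono: "(u, v) \<in> ?R\<^sup>*" if "(u, v) \<in> (H \<inter> (V - Z) \<times> (V - Z))\<^sup>*" "H \<subseteq> D" for u v H
      using rtrancl_mono[of "H \<inter> (V - Z) \<times> (V - Z)" ?R] that by blast
    have VZ: "V - M - Z \<noteq> {}" if "card M = 12 * k" for M
    proof
      assume "V - M - Z = {}"
      then have "V \<subseteq> M \<union> Z" by blast
      moreover have "finite (M \<union> Z)" using that k Z card_ge_0_finite[of M] by auto
      ultimately have "card V \<le> card (M \<union> Z)" by (intro card_mono)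
      then show False using card_Un_le[of M Z] that Z n by linarith
    qed
    have reach: "(u, v) \<in> (T \<inter> (V - Z) \<times> (V - Z))\<^sup>*" if "u \<in> V - Z" "v \<in> V - Z" for u v
      using strongly_k_connected_reach[OF conn Z(1,3) that] .
    have out: "(\<forall>x\<in>X - Z. (v, x) \<in> ?R\<^sup>*) \<or> (\<exists>u. (v, u) \<in> ?R\<^sup>* \<and> u \<in> W2 - Z \<and> Z \<subseteq> F2 `` {u})"
      if v: "v \<in> V - Z" for v
    proof (rule climb_reach[OF T reach Z(2,3) A(1) VZ[OF A(2)] X DT, where \<rho> = "\<lambda>v. \<alpha> v * (card V + 1) + r v"
          and M = "3 * (card V + 1) + card V"])
      show "T \<inter> A \<times> A \<subseteq> D" by (auto simp: D_def)
      show "k \<le> card (D `` {a} - A) \<or> T `` {a} - A \<subseteq> D `` {a}" if "a \<in> A" for a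
      proof -
        have "O1 \<subseteq> D" by (auto simp: D_def)
        then have "O1 `` {a} \<subseteq> D `` {a}" by blast
        moreover have "card (O1 `` {a} - A) \<le> card (D `` {a} - A)"
          using calculation finD by (intro card_mono finite_Diff finite_Image) auto
        ultimately show ?thesis using O1(3)[OF that] by fastforce
      qed
      show "4 * k \<le> card (D `` {v} \<inter> A)
        \<or> (\<exists>w\<in>V - A - Z. (v, w) \<in> D \<and> \<alpha> v * (card V + 1) + r v < \<alpha> w * (card V + 1) + r w)
        \<or> (v \<in> W2 - Z \<and> Z \<subseteq> F2 `` {v})" if "v \<in> V - A - Z" for v
      proof (rule climb_step[OF Z(2,3) finD(1) _ _ _ S(3), where H = F1 and G = F2 and I = W1 and N = W2 and r = r])
        show "S \<subseteq> D" "F1 \<subseteq> D" "F2 \<subseteq> D" by (auto simp: D_def)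
        show "F1 \<subseteq> W1 \<times> W1" "F2 \<subseteq> W2 \<times> W2" using F1(1) F2(1) by auto
        show "\<alpha> u = \<alpha> v \<and> r u < r v" if "(u, v) \<in> F1" for u v using rF1[OF that] by blast
        show "\<alpha> u = \<alpha> v \<and> r u < r v" if "(u, v) \<in> F2" for u v using rF2[OF that] by blast
        show "k \<le> card (F1 `` {v})" if "v \<in> W1 - E" for v using that F1(8) by (auto simp: E_def)
        show "k - 1 \<le> card (F2 `` {v})" if "v \<in> W2 - E" for v using that F2(8) by (auto simp: E_def)
        show "W1 \<subseteq> V - A" "W2 \<subseteq> V - A" "V - A \<subseteq> W1 \<union> W2 \<union> E" by (auto simp: W1_def W2_def E_def)
      qed (use rV that in auto)
      show "\<alpha> v * (card V + 1) + r v \<le> 3 * (card V + 1) + card V" for v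
        using \<alpha>(1)[of v] rV[of v] by (intro add_le_mono mult_le_mono1) auto
    qed (use v in simp_all)
    \<comment> \<open>The dual climb in \<open>T\<inverse>\<close>. The same forward arcs are used
      backwards, so the rank becomes \<open>card V - r v\<close>, while \<beta> is constant along
      them just as \<alpha> is.\<close>
    have "(\<forall>y\<in>Y - Z. (v, y) \<in> (D\<inverse> \<inter> (V - Z) \<times> (V - Z))\<^sup>*)
        \<or> (\<exists>u. (v, u) \<in> (D\<inverse> \<inter> (V - Z) \<times> (V - Z))\<^sup>* \<and> u \<in> W2 - Z \<and> Z \<subseteq> F2\<inverse> `` {u})"
      if v: "v \<in> V - Z" for v
    proof (rule climb_reach[OF T' _ Z(2,3) B(1) VZ[OF B(2)] Y,
          where \<rho> = "\<lambda>v. \<beta> v * (card V + 1) + (card V - r v)" and M = "3 * (card V + 1) + card V"])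
      show "(u, v) \<in> (T\<inverse> \<inter> (V - Z) \<times> (V - Z))\<^sup>*" if "u \<in> V - Z" "v \<in> V - Z" for u v
        unfolding converse_rtrancl_restrict using reach that by blast
      show "D\<inverse> \<subseteq> T\<inverse>" using DT by auto
      show "T\<inverse> \<inter> B \<times> B \<subseteq> D\<inverse>" by (auto simp: D_def)
      show "k \<le> card (D\<inverse> `` {a} - B) \<or> T\<inverse> `` {a} - B \<subseteq> D\<inverse> `` {a}" if "a \<in> B" for a
      proof -
        have "O2 \<subseteq> D\<inverse>" by (auto simp: D_def)
        then have "O2 `` {a} \<subseteq> D\<inverse> `` {a}" by blast
        moreover have "card (O2 `` {a} - B) \<le> card (D\<inverse> `` {a} - B)"
          using calculation finD by (intro card_mono finite_Diff finite_Image) auto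
        ultimately show ?thesis using O2(3)[OF that] by fastforce
      qed
      show "4 * k \<le> card (D\<inverse> `` {v} \<inter> B)
        \<or> (\<exists>w\<in>V - B - Z. (v, w) \<in> D\<inverse> \<and>
            \<beta> v * (card V + 1) + (card V - r v) < \<beta> w * (card V + 1) + (card V - r w))
        \<or> (v \<in> W2 - Z \<and> Z \<subseteq> F2\<inverse> `` {v})" if "v \<in> V - B - Z" for v
      proof (rule climb_step[OF Z(2,3) finD(2) _ _ _ S'(3),
            where H = "F1\<inverse>" and G = "F2\<inverse>" and I = W1 and N = W2 and r = "\<lambda>v. card V - r v"])
        show "S' \<subseteq> D\<inverse>" "F1\<inverse> \<subseteq> D\<inverse>" "F2\<inverse> \<subseteq> D\<inverse>" by (auto simp: D_def)
        show "F1\<inverse> \<subseteq> W1 \<times> W1" "F2\<inverse> \<subseteq> W2 \<times> W2" using F1(1) F2(1) by auto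
        show "\<beta> u = \<beta> v \<and> card V - r u < card V - r v" if "(u, v) \<in> F1\<inverse>" for u v
          using rF1[of v u] that rV[of u] by auto
        show "\<beta> u = \<beta> v \<and> card V - r u < card V - r v" if "(u, v) \<in> F2\<inverse>" for u v
          using rF2[of v u] that rV[of u] by auto
        show "k \<le> card (F1\<inverse> `` {v})" if "v \<in> W1 - E'" for v using that F1(9) by (auto simp: E'_def)
        show "k - 1 \<le> card (F2\<inverse> `` {v})" if "v \<in> W2 - E'" for v using that F2(9) by (auto simp: E'_def)
        show "W1 \<subseteq> V - B" "W2 \<subseteq> V - B" "V - B \<subseteq> W1 \<union> W2 \<union> E'" by (auto simp: W1_def W2_def E'_def)
      qed (use that in auto)
      show "\<beta> v * (card V + 1) + (card V - r v) \<le> 3 * (card V + 1) + card V" for v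
        using \<beta>(1)[of v] by (intro add_le_mono mult_le_mono1) auto
    qed (use v in simp_all)
    then have inn: "(\<forall>y\<in>Y - Z. (y, v) \<in> ?R\<^sup>*) \<or> (\<exists>u. (u, v) \<in> ?R\<^sup>* \<and> u \<in> W2 - Z \<and> Z \<subseteq> F2\<inverse> `` {u})"
      if "v \<in> V - Z" for v using that unfolding converse_rtrancl_restrict by blast
    have sub: "L \<subseteq> D" "K \<subseteq> D" "T \<inter> A \<times> A \<subseteq> D" "T \<inter> B \<times> B \<subseteq> D" by (auto simp: D_def)
    obtain x0 y0 where xy0: "x0 \<in> X - Z" "y0 \<in> Y - Z" "(x0, y0) \<in> ?R\<^sup>*"
      using link[OF Z(2,3)] mono[OF _ sub(1)] by blast
    have stuck_out: "Z \<inter> (A \<union> B) = {} \<and> (\<exists>y\<in>Y - Z. (u, y) \<in> ?R\<^sup>*)" if u: "u \<in> W2 - Z" "Z \<subseteq> F2 `` {u}" for u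
    proof -
      have "Z \<subseteq> T `` {u} - L `` {u}" using u(2) F2(1) by blast
      moreover have "u \<in> U - Z" using u(1) by (auto simp: W2_def)
      ultimately have "\<exists>y\<in>Y - Z. (u, y) \<in> (L \<inter> (V - Z) \<times> (V - Z))\<^sup>*" using follow by blast
      moreover have "Z \<subseteq> W2" using u(2) F2(1) by blast
      ultimately show ?thesis using mono[OF _ sub(1)] by (auto simp: W2_def)
    qed
    have stuck_in: "Z \<inter> (A \<union> B) = {} \<and> (\<exists>x\<in>X - Z. (x, u) \<in> ?R\<^sup>*)" if u: "u \<in> W2 - Z" "Z \<subseteq> F2\<inverse> `` {u}" for u
    proof -
      have "Z \<subseteq> T\<inverse> `` {u} - L\<inverse> `` {u}" using u(2) F2(1) by blast
      moreover have "u \<in> U - Z" using u(1) by (auto simp: W2_def)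
      ultimately have "\<exists>x\<in>X - Z. (x, u) \<in> (L \<inter> (V - Z) \<times> (V - Z))\<^sup>*" using follow' by blast
      moreover have "Z \<subseteq> W2" using u(2) F2(1) by blast
      ultimately show ?thesis using mono[OF _ sub(1)] by (auto simp: W2_def)
    qed
    \<comment> \<open>The route goes from \<open>y\<close> to \<open>b\<close> inside
      \<open>B\<close>, over the bridge to \<open>a\<close>, and inside \<open>A\<close> to
      \<open>x\<close>. It needs \<open>Z\<close> to miss \<open>A\<close> and \<open>B\<close>, as
      \<open>k + 1\<close> neighbours suffice only then.\<close>
    have cross: "(y, x) \<in> ?R\<^sup>*" if AB: "Z \<inter> (A \<union> B) = {}" and xy: "x \<in> X" "y \<in> Y" for x y
    proof -
      have ab: "a \<notin> Z" "b \<notin> Z" "a \<in> V - Z" "b \<in> V - Z" using AB a(1) b(1) A(1) B(1) by auto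
      have ZA: "Z \<inter> A = {}" "Z \<inter> B = {}" using AB by auto
      have "(b, y) \<in> (D\<inverse> \<inter> (V - Z) \<times> (V - Z))\<^sup>*"
      proof (rule dominated_reach[OF T' B(1) Y(1,3) _ ab(4)])
        show "y \<in> Y - Z" using xy Y(1) ZA by auto
        show "3 * card (Z \<inter> B) + card Y + 1 \<le> card (T\<inverse> `` {b} \<inter> B)" using b(2) Y(2) ZA by simp
        show "(b, g) \<in> D\<inverse>" if "g \<in> T\<inverse> `` {b} \<inter> B" for g using that b(1) sub(4) by auto
        show "T\<inverse> \<inter> B \<times> B \<subseteq> D\<inverse>" using sub(4) by auto
      qed simp
      then have "(y, b) \<in> ?R\<^sup>*" unfolding converse_rtrancl_restrict .
      also have "(b, a) \<in> ?R\<^sup>*" using mono[OF bridge[OF Z(2,3) ab(1,2)] sub(2)] .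
      also have "(a, x) \<in> ?R\<^sup>*"
      proof (rule dominated_reach[OF T A(1) X(1,3) _ ab(3)])
        show "x \<in> X - Z" using xy X(1) ZA by auto
        show "3 * card (Z \<inter> A) + card X + 1 \<le> card (T `` {a} \<inter> A)" using a(2) X(2) ZA by simp
        show "(a, g) \<in> D" if "g \<in> T `` {a} \<inter> A" for g using that a(1) sub(3) by auto
      qed (use sub(3) in auto)
      finally show ?thesis .
    qed
    have main: "(v, w) \<in> ?R\<^sup>*" if vw: "v \<in> V - Z" "w \<in> V - Z" for v w
    proof -
      \<comment> \<open>In both cases \<open>v\<close> reaches some vertex of \<open>Y - Z\<close>,
        if necessary through the surviving path from \<open>x0\<close> to \<open>y0\<close>. Either
        all of \<open>Y - Z\<close> reaches \<open>w\<close>, or the backward climb is stuck and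
        \<open>cross\<close> leads on to a vertex of \<open>X - Z\<close> that reaches
        \<open>w\<close>.\<close>
      have v: "(\<forall>x\<in>X - Z. (v, x) \<in> ?R\<^sup>*) \<or> (Z \<inter> (A \<union> B) = {} \<and> (\<exists>y\<in>Y - Z. (v, y) \<in> ?R\<^sup>*))"
        using out[OF vw(1)] stuck_out by (meson rtrancl_trans)
      have w: "(\<forall>y\<in>Y - Z. (y, w) \<in> ?R\<^sup>*) \<or> (Z \<inter> (A \<union> B) = {} \<and> (\<exists>x\<in>X - Z. (x, w) \<in> ?R\<^sup>*))"
        using inn[OF vw(2)] stuck_in by (meson rtrancl_trans)
      have "\<exists>y\<in>Y - Z. (v, y) \<in> ?R\<^sup>*" using v xy0 by (meson rtrancl_trans)
      then obtain y where y: "y \<in> Y - Z" "(v, y) \<in> ?R\<^sup>*" by blast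
      from w show ?thesis
      proof
        assume "\<forall>y\<in>Y - Z. (y, w) \<in> ?R\<^sup>*"
        then show ?thesis using y by (meson rtrancl_trans)
      next
        assume "Z \<inter> (A \<union> B) = {} \<and> (\<exists>x\<in>X - Z. (x, w) \<in> ?R\<^sup>*)"
        then obtain x where x: "Z \<inter> (A \<union> B) = {}" "x \<in> X - Z" "(x, w) \<in> ?R\<^sup>*" by blast
        then have "(y, x) \<in> ?R\<^sup>*" using cross y by blast
        then show ?thesis using x y by (meson rtrancl_trans)
      qed
    qed
    show "strongly_connected (V - Z) (del_verts_arcs V D Z)"
      unfolding strongly_connected_def del_verts_arcs_def Int_assoc Int_absorb using main by blast
  qed
  then show ?thesis using DT cD by blast
qed

theorem theorem1p3:
  fixes k n :: nat and V :: "'a set" and A :: "('a \<times> 'a) set"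
  assumes "k \<ge> 1"
    and "tournament V A"
    and "card V = n"
    and "strongly_k_connected k V A"
  shows "\<exists>B. B \<subseteq> A \<and> strongly_k_connected k V B \<and>
           real (card B) \<le> real k * real n + 750 * (real k)\<^sup>2 * log 2 (real k + 1)"
proof -
  have "\<exists>B\<subseteq>A. strongly_k_connected k V B \<and> card B \<le> k * card V + 750 * k\<^sup>2"
  proof (cases "card V \<le> 39 * k")
    case True
    then show ?thesis using small_tournament_arcs[OF assms(2)] assms(4) by blast
  next
    case False
    then show ?thesis using large_tournament_sparse_spanning[OF assms(2,1,4)] by simp
  qed
  then obtain B where B: "B \<subseteq> A" "strongly_k_connected k V B" "card B \<le> k * n + 750 * k\<^sup>2"
    using assms(3) by blast
  have "real (card B) \<le> real (k * n + 750 * k\<^sup>2)" using B(3) by (rule of_nat_mono)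
  then have "real (card B) \<le> real k * real n + 750 * (real k)\<^sup>2" by simp
  \<comment> \<open>Since \<open>k + 1\<close> is at least 2, the logarithmic factor only weakens
    the bound already proved.\<close>
  moreover have "1 \<le> log 2 (real k + 1)" using assms(1) by (subst one_le_log_cancel_iff) auto
  then have "750 * (real k)\<^sup>2 * 1 \<le> 750 * (real k)\<^sup>2 * log 2 (real k + 1)"
    by (intro mult_left_mono) auto
  ultimately show ?thesis using B by (intro exI[of _ B]) auto
qed

end
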